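(* Let $X$ be a symmetric jump-paring Lévy process in $\mathbb R^d$ (context, with Lévy density $\nu(x)$ and profile $f$), let $V$ be a decaying $X$-Kato class potential such that $\lambda_0=\inf\operatorname{Spec}H<0$ is an isolated eigenvalue of $H=-L+V$, let $\varphi_0$ be the ground state, and let $\widetilde X$ be the corresponding ground state-transformed process with path measure $\widetilde{\mathbb P}$. (1) Suppose that there are constants $C_1,C_2>0$ with $C_1(1\wedge\nu(x))\le\varphi_0(x)\le C_2(1\wedge\nu(x))$ for all $x\in\mathbb R^d$, and that there exists $A\in(0,\infty)$ such that $$\log f(r)=-A\,\mathcal R(r)+o(\mathcal R(r))\quad\text{as }r\to\infty,$$ with increasing $\mathcal R(r)=r^\lambda\mathcal L(r)$, where $\lambda\in(0,1]$ and $\mathcal L:[r_0,\infty)\to(0,\infty)$ is slowly varying at infinity. Then $$\limsup_{n\to\infty}\frac{|\widetilde X_n|}{(\log n)^{1/\lambda}\mathcal L^*(\log n)}=\frac1{(2A)^{1/\lambda}},\qquad\widetilde{\mathbb P}\text{-a.s.},$$ where $\mathcal L^*$ is the conjugate slowly varying function of $\mathcal L$. (2) Suppose that there is a constant $\theta>0$ such that for every $\varepsilon\in(0,1)$ there is a constant $C>0$ with $$\varphi_0(x)\ge C\Big(e^{-\theta\sqrt{|\lambda_0|+\varepsilon}\,|x|}\vee(1\wedge\nu(x))\Big),\qquad x\in\mathbb R^d .$$ Then $$\limsup_{n\to\infty}\frac{|\widetilde X_n|}{\log n}\ge\frac1{2\theta\sqrt{|\lambda_0|}},\qquad\widetilde{\mathbb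 P}\text{-a.s.}$$
   Context: Regular variation: $\mathcal L:[r_0,\infty)\to(0,\infty)$ is slowly varying at infinity if $\lim_{r\to\infty}\mathcal L(sr)/\mathcal L(r)=1$ for every $s>0$ (it may be taken continuous). For $\mathcal R(r)=r^\lambda\mathcal L(r)$ let $\mathcal R^*(r)=\inf\{s\in[r_0,\infty):\mathcal R(s)\ge r\}$ for $r>\mathcal R(r_0)$. Then $\mathcal R^*(r)=r^{1/\lambda}\mathcal L^*(r)$ with $\mathcal L^*$ slowly varying, called the conjugate slowly varying function of $\mathcal L$; up to asymptotic equivalence it is the unique slowly varying function for which $\mathcal R(r^{1/\lambda}\mathcal L^*(r))/r\to1$. Lévy process: $d\ge1$; $(X_t)_{t\ge0}$ is an $\mathbb R^d$-valued Lévy process ($\mathbb P^x,\mathbb E^x$: law and expectation when started at $x$) with $\mathbb E^0[e^{i\xi\cdot X_t}]=e^{-t\psi(\xi)}$, $\psi(\xi)=A_0\xi\cdot\xi+\int(1-\cos(\xi\cdot z))\,\nu(dz)$, $A_0$ a symmetric non-negative definite matrix, $\nu$ a symmetric Lévy measure with $\nu(\mathbb R^d\setminus\{0\})=\infty$ and $\nu(dx)=\nu(x)dx$, $\nu(x)>0$. Its $L^2(\mathbb R^d)$-generator is $\widehat{Lf}=-\psi\widehat f$, and $p(t,y-x)$ is its transition density. It is jump-paring if: (i) there are a non-increasing $f:(0,\infty)\to(0,\infty)$ and positive constants $c_1,c_2,c_3$ with $c_1f(|x|)\le\nu(x)\le c_2f(|x|)$ for $x\ne0$ and $\int_{|y|>1/2,\,|x-y|>1/2}f(|x-y|)f(|y|)dy\le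 c_3f(|x|)$ for $|x|\ge1$; (ii) there are $t_{\mathrm b}>0$, $c_4>0$ with $0<p(t_{\mathrm b},x)\le c_4$ for all $x\in\mathbb R^d$; (iii) for all $0<p<q<R\le1$, $\sup_{x\in B(0,p)}\sup_{y\in B(0,q)^c}G_{B(0,R)}(x,y)<\infty$, where $G_{B(0,R)}(x,y)=\int_0^\infty p_{B(0,R)}(t,x,y)dt$ is the Green function of $X$ in (i.e. killed on leaving) the ball $B(0,R)$. Potential: a Borel $V:\mathbb R^d\to\mathbb R$ is of $X$-Kato class if $V_-\in\mathcal K^X$ and $V_+1_C\in\mathcal K^X$ for every compact $C$, where $h\in\mathcal K^X$ means $\lim_{t\downarrow0}\sup_x\mathbb E^x[\int_0^t|h(X_s)|ds]=0$. $V$ is decaying if $V(x)\to0$ as $|x|\to\infty$. $T_tf(x)=\mathbb E^x[e^{-\int_0^tV(X_s)ds}f(X_t)]$ is a strongly continuous symmetric semigroup on $L^2(\mathbb R^d)$, and $H=-L+V$ (form sum) is the self-adjoint operator with $T_t=e^{-tH}$. Ground state-transformed (GST) process: $\varphi_0$ (the ground state) is the unique strictly positive eigenfunction of $H$ for $\lambda_0=\inf\operatorname{Spec}H$ (an isolated eigenvalue), $\|\varphi_0\|_{L^2}=1$. $\widetilde T_tf=\frac{e^{\lambda_0t}}{\varphi_0}T_t(\varphi_0f)$ is a Markov semigroup on $L^2(\mathbb R^d,\varphi_0^2dx)$; the GST process $(\widetilde X_t)_{t\in\mathbb R}$ is the associated stationary càdlàg Markov process, $\widetilde{\mathbb P}^x$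 is its law with $\widetilde X_0=x$, and its path measure is $\widetilde{\mathbb P}(\cdot)=\int\widetilde{\mathbb P}^x(\cdot)\varphi_0^2(x)dx$. Thus for $t_0\le\dots\le t_n$, $\mathbb E_{\widetilde{\mathbb P}}[\prod_{j=0}^nf_j(\widetilde X_{t_j})]=(f_0,\widetilde T_{t_1-t_0}f_1\cdots\widetilde T_{t_n-t_{n-1}}f_n)_{L^2(\varphi_0^2dx)}$. *)

theory Defs
  imports "HOL-Probability.Probability" "HOL-Library.Landau_Symbols"
begin

section \<open>Slowly varying functions\<close>

definition slowly_varying :: "real \<Rightarrow> (real \<Rightarrow> real) \<Rightarrow> bool" where
  "slowly_varying r0 \<L> \<longleftrightarrow>
     (\<forall>r\<ge>r0. 0 < \<L> r) \<and> (\<forall>s>0. ((\<lambda>r. \<L> (s * r) / \<L> r) \<longlongrightarrow> 1) at_top)"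

definition regular_part :: "real \<Rightarrow> (real \<Rightarrow> real) \<Rightarrow> real \<Rightarrow> real" where
  "regular_part \<alpha> \<L> r = r powr \<alpha> * \<L> r"

definition gen_inverse :: "real \<Rightarrow> (real \<Rightarrow> real) \<Rightarrow> real \<Rightarrow> real" where
  "gen_inverse r0 R r = Inf {s. r0 \<le> s \<and> r \<le> R s}"

text \<open>Meaningful for \<open>r > regular_part \<alpha> \<L> r0\<close> only; it is used near infinity.\<close>

definition conj_slow :: "real \<Rightarrow> real \<Rightarrow> (real \<Rightarrow> real) \<Rightarrow> real \<Rightarrow> real" where
  "conj_slow r0 \<alpha> \<L> r = gen_inverse r0 (regular_part \<alpha> \<L>) r / r powr (1 / \<alpha>)"


section \<open>Levy processes\<close>

definition cadlag_on :: "real set \<Rightarrow> (real \<Rightarrow> 'a::euclidean_space) \<Rightarrow> bool" where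
  "cadlag_on I x \<longleftrightarrow>
     (\<forall>t\<in>I. continuous (at t within I \<inter> {t..}) x \<and>
             (\<exists>l. (x \<longlongrightarrow> l) (at t within I \<inter> {..<t})))"

text \<open>The process is started at 0. Its law \<open>P\<^sup>x\<close> is throughout realised as the law of
  \<open>x + X\<close> under \<open>M\<close>, and \<open>E\<^sup>x\<close> accordingly.\<close>

definition levy_process :: "'w measure \<Rightarrow> (real \<Rightarrow> 'w \<Rightarrow> 'a::euclidean_space) \<Rightarrow> bool" where
  "levy_process M X \<longleftrightarrow>
     prob_space M \<and>
     (\<forall>t\<ge>0. X t \<in> borel_measurable M) \<and>
     (AE \<omega> in M. X 0 \<omega> = 0) \<and>
     (\<forall>n (t::nat \<Rightarrow> real). 0 \<le> t 0 \<and> mono t \<longrightarrow>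
        prob_space.indep_vars M (\<lambda>_. borel)
          (\<lambda>i \<omega>. X (t (Suc i)) \<omega> - X (t i) \<omega>) {..<n}) \<and>
     (\<forall>s\<ge>0. \<forall>t\<ge>0. distr M borel (\<lambda>\<omega>. X (s + t) \<omega> - X s \<omega>) = distr M borel (X t)) \<and>
     (\<forall>\<omega>\<in>space M. cadlag_on {0..} (\<lambda>t. X t \<omega>))"

definition jump_measure :: "('a::euclidean_space \<Rightarrow> real) \<Rightarrow> 'a measure" where
  "jump_measure \<nu> = density lborel (\<lambda>z. ennreal (\<nu> z))"

text \<open>Infinite symmetric Levy measure with a positive density. The value of the density at the
  origin is immaterial for the measure; it is an arbitrary positive number.\<close>

definition symmetric_levy_density :: "('a::euclidean_space \<Rightarrow> real) \<Rightarrow> bool" where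
  "symmetric_levy_density \<nu> \<longleftrightarrow>
     \<nu> \<in> borel_measurable borel \<and> (\<forall>z. 0 < \<nu> z) \<and>
     distr (jump_measure \<nu>) borel uminus = jump_measure \<nu> \<and>
     (\<integral>\<^sup>+z. ennreal (min 1 ((norm z)\<^sup>2)) \<partial>jump_measure \<nu>) < \<infinity> \<and>
     emeasure (jump_measure \<nu>) (- {0}) = \<infinity>"

definition levy_exponent :: "real^'n^'n \<Rightarrow> (real^'n \<Rightarrow> real) \<Rightarrow> real^'n \<Rightarrow> real" where
  "levy_exponent A0 \<nu> \<xi> = (A0 *v \<xi>) \<bullet> \<xi> + (\<integral>z. 1 - cos (\<xi> \<bullet> z) \<partial>jump_measure \<nu>)"

definition symmetric_levy_process ::
    "'w measure \<Rightarrow> (real \<Rightarrow> 'w \<Rightarrow> real^'n) \<Rightarrow> real^'n^'n \<Rightarrow> (real^'n \<Rightarrow> real) \<Rightarrow> bool" where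
  "symmetric_levy_process M X A0 \<nu> \<longleftrightarrow>
     levy_process M X \<and>
     transpose A0 = A0 \<and> (\<forall>\<xi>. 0 \<le> (A0 *v \<xi>) \<bullet> \<xi>) \<and>
     symmetric_levy_density \<nu> \<and>
     (\<forall>t\<ge>0. \<forall>\<xi>. (\<integral>\<omega>. exp (\<i> * complex_of_real (\<xi> \<bullet> X t \<omega>)) \<partial>M) =
                  complex_of_real (exp (- t * levy_exponent A0 \<nu> \<xi>)))"

text \<open>\<open>p t (y - x)\<close> is the transition density from \<open>x\<close> to \<open>y\<close>.\<close>

definition transition_density ::
    "'w measure \<Rightarrow> (real \<Rightarrow> 'w \<Rightarrow> 'a::euclidean_space) \<Rightarrow> (real \<Rightarrow> 'a \<Rightarrow> real) \<Rightarrow> bool" where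
  "transition_density M X p \<longleftrightarrow>
     (\<forall>t>0. (\<forall>x. 0 \<le> p t x) \<and> distributed M lborel (X t) (\<lambda>x. ennreal (p t x)))"

definition exit_time ::
    "(real \<Rightarrow> 'w \<Rightarrow> 'a::euclidean_space) \<Rightarrow> 'a set \<Rightarrow> 'a \<Rightarrow> 'w \<Rightarrow> ereal" where
  "exit_time X D x \<omega> = (INF t\<in>{t. 0 \<le> t \<and> x + X t \<omega> \<notin> D}. ereal t)"

text \<open>Exit events are projections of Borel sets and hence measurable for the completion of \<open>M\<close>,
  but in general not for \<open>M\<close> itself.\<close>

definition killed_transition_density ::
    "'w measure \<Rightarrow> (real \<Rightarrow> 'w \<Rightarrow> 'a::euclidean_space) \<Rightarrow> 'a set \<Rightarrow>
     (real \<Rightarrow> 'a \<Rightarrow> 'a \<Rightarrow> ennreal) \<Rightarrow> bool" where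
  "killed_transition_density M X D q \<longleftrightarrow>
     (\<lambda>(t, x, y). q t x y) \<in> borel_measurable borel \<and>
     (\<forall>t>0. \<forall>x\<in>D. \<forall>B\<in>sets borel.
        emeasure (completion M)
          {\<omega>\<in>space M. x + X t \<omega> \<in> B \<and> ereal t < exit_time X D x \<omega>} =
        (\<integral>\<^sup>+y\<in>B. q t x y \<partial>lborel))"

definition green_function :: "(real \<Rightarrow> 'a \<Rightarrow> 'a \<Rightarrow> ennreal) \<Rightarrow> 'a \<Rightarrow> 'a \<Rightarrow> ennreal" where
  "green_function q x y = (\<integral>\<^sup>+t\<in>{0<..}. q t x y \<partial>lborel)"

text \<open>The transition density of the process killed on leaving a ball is determined up to Lebesgue
  null sets in \<open>y\<close>, so the pointwise bound on the Green function refers to a suitable version.\<close>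

definition jump_paring ::
    "'w measure \<Rightarrow> (real \<Rightarrow> 'w \<Rightarrow> 'a::euclidean_space) \<Rightarrow> (real \<Rightarrow> 'a \<Rightarrow> real) \<Rightarrow>
     ('a \<Rightarrow> real) \<Rightarrow> (real \<Rightarrow> real) \<Rightarrow> bool" where
  "jump_paring M X p \<nu> f \<longleftrightarrow>
     (\<forall>r>0. 0 < f r) \<and> antimono_on {0<..} f \<and>
     (\<exists>c1>0. \<exists>c2>0. \<forall>x. x \<noteq> 0 \<longrightarrow> c1 * f (norm x) \<le> \<nu> x \<and> \<nu> x \<le> c2 * f (norm x)) \<and>
     (\<exists>c3>0. \<forall>x::'a. 1 \<le> norm x \<longrightarrow>
        (\<integral>\<^sup>+y\<in>{y. 1/2 < norm y \<and> 1/2 < norm (x - y)}.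
           ennreal (f (norm (x - y)) * f (norm y)) \<partial>lborel) \<le> ennreal (c3 * f (norm x))) \<and>
     (\<exists>tb>0. \<exists>c4>0. \<forall>x. 0 < p tb x \<and> p tb x \<le> c4) \<and>
     (\<forall>R. 0 < R \<and> R \<le> 1 \<longrightarrow>
        (\<exists>q. killed_transition_density M X (ball 0 R) q \<and>
             (\<forall>a b. 0 < a \<and> a < b \<and> b < R \<longrightarrow>
                (SUP x\<in>ball 0 a. SUP y\<in>- ball 0 b. green_function q x y) < \<infinity>)))"


section \<open>Kato class potentials and Schroedinger operators\<close>

definition kato :: "'w measure \<Rightarrow> (real \<Rightarrow> 'w \<Rightarrow> 'a::euclidean_space) \<Rightarrow> ('a \<Rightarrow> real) \<Rightarrow> bool" where
  "kato M X h \<longleftrightarrow>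
     ((\<lambda>t. SUP x. \<integral>\<^sup>+\<omega>. (\<integral>\<^sup>+s\<in>{0..t}. ennreal \<bar>h (x + X s \<omega>)\<bar> \<partial>lborel) \<partial>M) \<longlongrightarrow> 0)
       (at_right 0)"

definition kato_potential ::
    "'w measure \<Rightarrow> (real \<Rightarrow> 'w \<Rightarrow> 'a::euclidean_space) \<Rightarrow> ('a \<Rightarrow> real) \<Rightarrow> bool" where
  "kato_potential M X V \<longleftrightarrow>
     V \<in> borel_measurable borel \<and>
     kato M X (\<lambda>x. max 0 (- V x)) \<and>
     (\<forall>C. compact C \<longrightarrow> kato M X (\<lambda>x. max 0 (V x) * indicator C x))"

definition decaying :: "('a::euclidean_space \<Rightarrow> real) \<Rightarrow> bool" where
  "decaying V \<longleftrightarrow> (V \<longlongrightarrow> 0) at_infinity"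

definition feynman_kac ::
    "'w measure \<Rightarrow> (real \<Rightarrow> 'w \<Rightarrow> 'a::euclidean_space) \<Rightarrow> ('a \<Rightarrow> real) \<Rightarrow>
     real \<Rightarrow> ('a \<Rightarrow> real) \<Rightarrow> 'a \<Rightarrow> real" where
  "feynman_kac M X V t g x =
     (\<integral>\<omega>. exp (- (LBINT s:{0..t}. V (x + X s \<omega>))) * g (x + X t \<omega>) \<partial>M)"

text \<open>Elements of the (real) space \<open>L\<^sup>2\<close> are represented by Borel functions, and operators by
  their graphs. As the semigroup is real and symmetric, its generator is the complexification of
  the operator on real \<open>L\<^sup>2\<close>, with the same, real, spectrum.\<close>

definition L2_fun :: "('a::euclidean_space \<Rightarrow> real) \<Rightarrow> bool" where
  "L2_fun g \<longleftrightarrow> g \<in> borel_measurable borel \<and> integrable lborel (\<lambda>x. (g x)\<^sup>2)"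

definition L2_norm :: "('a::euclidean_space \<Rightarrow> real) \<Rightarrow> real" where
  "L2_norm g = sqrt (\<integral>x. (g x)\<^sup>2 \<partial>lborel)"

text \<open>\<open>H = -L + V\<close> is the self-adjoint operator with \<open>T\<^sub>t = exp (-t H)\<close> for the Feynman--Kac
  semigroup \<open>T\<close>, that is, \<open>-H\<close> is the infinitesimal generator of \<open>T\<close> in \<open>L\<^sup>2\<close>: the limit of
  \<open>(g - T\<^sub>t g) / t\<close> is \<open>H g\<close>. The extended integral excludes convergence due to
  non-integrability.\<close>

definition schroedinger_op ::
    "'w measure \<Rightarrow> (real \<Rightarrow> 'w \<Rightarrow> 'a::euclidean_space) \<Rightarrow> ('a \<Rightarrow> real) \<Rightarrow>
     (('a \<Rightarrow> real) \<times> ('a \<Rightarrow> real)) set" where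
  "schroedinger_op M X V =
     {(g, h). L2_fun g \<and> L2_fun h \<and>
        ((\<lambda>t. \<integral>\<^sup>+x. ennreal (((g x - feynman_kac M X V t g x) / t - h x)\<^sup>2) \<partial>lborel) \<longlongrightarrow> 0)
          (at_right 0)}"

definition resolvent_set :: "(('a::euclidean_space \<Rightarrow> real) \<times> ('a \<Rightarrow> real)) set \<Rightarrow> real set" where
  "resolvent_set H =
     {\<mu>. (\<exists>C. \<forall>(g, h)\<in>H. L2_norm g \<le> C * L2_norm (\<lambda>x. h x - \<mu> * g x)) \<and>
          (\<forall>k. L2_fun k \<longrightarrow> (\<exists>(g, h)\<in>H. AE x in lborel. h x - \<mu> * g x = k x))}"

definition spectrum :: "(('a::euclidean_space \<Rightarrow> real) \<times> ('a \<Rightarrow> real)) set \<Rightarrow> real set" where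
  "spectrum H = - resolvent_set H"

definition isolated_eigenvalue ::
    "(('a::euclidean_space \<Rightarrow> real) \<times> ('a \<Rightarrow> real)) set \<Rightarrow> real \<Rightarrow> bool" where
  "isolated_eigenvalue H \<mu> \<longleftrightarrow>
     (\<exists>g. (g, \<lambda>x. \<mu> * g x) \<in> H \<and> \<not> (AE x in lborel. g x = 0)) \<and>
     (\<exists>\<epsilon>>0. spectrum H \<inter> {\<mu> - \<epsilon><..<\<mu> + \<epsilon>} = {\<mu>})"

definition ground_state ::
    "(('a::euclidean_space \<Rightarrow> real) \<times> ('a \<Rightarrow> real)) set \<Rightarrow> real \<Rightarrow> ('a \<Rightarrow> real) \<Rightarrow> bool" where
  "ground_state H \<mu> \<phi> \<longleftrightarrow>
     (\<phi>, \<lambda>x. \<mu> * \<phi> x) \<in> H \<and> (\<forall>x. 0 < \<phi> x) \<and> L2_norm \<phi> = 1"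


section \<open>Ground state-transformed processes\<close>

definition gst_semigroup ::
    "'w measure \<Rightarrow> (real \<Rightarrow> 'w \<Rightarrow> 'a::euclidean_space) \<Rightarrow> ('a \<Rightarrow> real) \<Rightarrow> real \<Rightarrow> ('a \<Rightarrow> real) \<Rightarrow>
     real \<Rightarrow> ('a \<Rightarrow> real) \<Rightarrow> 'a \<Rightarrow> real" where
  "gst_semigroup M X V \<mu> \<phi> t g x =
     exp (\<mu> * t) / \<phi> x * feynman_kac M X V t (\<lambda>y. \<phi> y * g y) x"

text \<open>For \<open>gs = [(t\<^sub>1, g\<^sub>1), \<dots>, (t\<^sub>n, g\<^sub>n)]\<close> this is the nested expression
  \<open>S (t\<^sub>1 - t\<^sub>0) (g\<^sub>1 \<cdot> S (t\<^sub>2 - t\<^sub>1) (g\<^sub>2 \<cdot> \<dots> S (t\<^sub>n - t\<^sub>n\<^sub>-\<^sub>1) g\<^sub>n))\<close>.\<close>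

fun semigroup_chain ::
    "(real \<Rightarrow> ('a \<Rightarrow> real) \<Rightarrow> 'a \<Rightarrow> real) \<Rightarrow> real \<Rightarrow> (real \<times> ('a \<Rightarrow> real)) list \<Rightarrow> 'a \<Rightarrow> real" where
  "semigroup_chain S t0 [] = (\<lambda>x. 1)"
| "semigroup_chain S t0 ((t, g) # gs) = S (t - t0) (\<lambda>x. g x * semigroup_chain S t gs x)"

text \<open>\<open>Y\<close> is, under \<open>N\<close>, the cadlag process whose finite-dimensional distributions are those of the
  stationary Markov process with semigroup \<open>S\<close> and invariant measure \<open>\<phi>\<^sup>2 dx\<close>; so \<open>N\<close> plays the
  role of the path measure.\<close>

definition gst_process ::
    "'v measure \<Rightarrow> (real \<Rightarrow> 'v \<Rightarrow> 'a::euclidean_space) \<Rightarrow>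
     (real \<Rightarrow> ('a \<Rightarrow> real) \<Rightarrow> 'a \<Rightarrow> real) \<Rightarrow> ('a \<Rightarrow> real) \<Rightarrow> bool" where
  "gst_process N Y S \<phi> \<longleftrightarrow>
     prob_space N \<and> (\<forall>t. Y t \<in> borel_measurable N) \<and>
     (\<forall>\<omega>\<in>space N. cadlag_on UNIV (\<lambda>t. Y t \<omega>)) \<and>
     (\<forall>t0 g0 gs. sorted (t0 # map fst gs) \<and>
        (\<forall>g\<in>insert g0 (snd ` set gs). g \<in> borel_measurable borel \<and> bounded (range g)) \<longrightarrow>
        (\<integral>\<omega>. g0 (Y t0 \<omega>) * prod_list (map (\<lambda>(t, g). g (Y t \<omega>)) gs) \<partial>N) =
        (\<integral>x. g0 x * semigroup_chain S t0 gs x * (\<phi> x)\<^sup>2 \<partial>lborel))"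

end

theory Submission
  imports Defs "HOL-Real_Asymp.Real_Asymp"
begin

text \<open>The process \<open>Y\<close> is stationary with one-point law \<open>\<phi>0\<^sup>2 dx\<close>, so \<open>\<bar>Y\<^sub>n\<bar> > r\<close> has the probability
  \<open>tail r\<close>, the integral of \<open>\<phi>0\<^sup>2\<close> over \<open>\<bar>x\<bar> > r\<close>, for every \<open>n\<close>. If these probabilities are
  summable along radii \<open>r n\<close>, then almost surely \<open>\<bar>Y\<^sub>n\<bar> \<le> r n\<close> for all large \<open>n\<close>. The limit laws
  follow once divergence of the sum also forces \<open>\<bar>Y\<^sub>n\<bar> > r n\<close> infinitely often, although the events
  are dependent. Lemma \<open>borel_cantelli_correlated\<close> derives this from correlations that decay
  exponentially in the time difference: the variance of the number of events is then at most a
  multiple of its mean.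

  The decay of correlations (\<open>covariance_decay\<close>) is a spectral gap. The semigroup
  \<open>Tt t = exp (lam0 t) T\<^sub>t\<close> of the Schroedinger operator, shifted by the ground state energy, fixes
  \<open>\<phi>0\<close>, and two-point expectations of \<open>Y\<close> are its matrix elements between multiples of \<open>\<phi>0\<close>. Since
  \<open>lam0\<close> is isolated in the spectrum, \<open>Tt t\<close> should contract the complement of \<open>\<phi>0\<close> at the rate
  given by the distance to the rest of the spectrum. Lemma \<open>spectral_gap_decay\<close> proves this for an
  abstract semigroup of symmetric contractions from the resolvent set of its generator. The norm
  of the resolvent at the midpoint of the gap is bounded because the norm of a symmetric operator
  or its negative belongs to its approximate point spectrum; this yields an inequality between
  generator and quadratic form, and with it exponential decay of the derivative of \<open>(w, Tt t w)\<close>.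

  The abstract theorem asks for four properties of \<open>Tt\<close>. The semigroup law and the invariance of
  \<open>\<phi>0\<close> are read off from the finite-dimensional distributions of \<open>Y\<close>. Contractivity is a Schur
  test with \<open>\<phi>0\<close> as test function. Symmetry (\<open>fk_symmetric\<close>) comes from time reversal: started
  from Lebesgue measure, a symmetric Levy process on a finite time interval has the law of its
  reversed path, and the potential integral does not see the direction of time. That the Levy
  process is symmetric follows from its real characteristic exponent, by uniqueness of
  characteristic functions in Euclidean space. Finally, all fixed vectors are multiples of \<open>\<phi>0\<close>
  because the quotient of a fixed vector by \<open>\<phi>0\<close> has vanishing Dirichlet form and the transition
  density at one time is positive (\<open>fixed_vector_multiple\<close>).

  What remains is the size of the tail. In the first limit law, \<open>\<phi>0\<close> is comparable with \<open>f\<close> at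
  large radii, and the tail lies between a multiple of \<open>f\<^sup>2\<close> at a slightly larger radius and a
  multiple of a power of \<open>f\<close> with exponent just below 2 (\<open>tail_upper\<close>, \<open>tail_lower\<close>). At the
  radius \<open>c * R\<^sup>*(ln n)\<close> the logarithm of \<open>f\<close> is asymptotic to \<open>- A c\<^sup>\<alpha> ln n\<close>, since
  \<open>R (c * R\<^sup>*(u)) / u\<close> tends to \<open>c\<^sup>\<alpha>\<close> (\<open>R_Rs\<close>); so the sum over \<open>n\<close> changes from divergence to
  convergence at \<open>2 A c\<^sup>\<alpha> = 1\<close>. In the second limit law the exponential lower bound for \<open>\<phi>0\<close> gives
  divergence along \<open>c ln n\<close> for every \<open>c\<close> below the stated constant.\<close>

section \<open>Spectral gap of symmetric contraction semigroups\<close>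

lemma norm_diff_square:
  fixes x y :: "'a::real_inner"
  shows "(norm (x - y))\<^sup>2 = (norm x)\<^sup>2 - 2 * inner x y + (norm y)\<^sup>2"
  using inner_commute[of x y]
  by (simp add: power2_norm_eq_inner inner_diff_left inner_diff_right)

text \<open>Let \<open>b\<close> be the norm of \<open>B\<close>. By symmetry the square of the norm of \<open>B (B x) - b\<^sup>2 x\<close> is at
  most \<open>2 b\<^sup>2\<close> times the difference of the squared norms of \<open>b x\<close> and \<open>B x\<close>, and this difference
  can be made arbitrarily small relative to \<open>x\<close>. Hence \<open>B\<^sup>2 - b\<^sup>2 = (B - b) (B + b)\<close> is not bounded
  below, so one of the factors is not, which forces \<open>b \<le> c0\<close>.\<close>

lemma symmetric_norm_le_spectral_bound:
  fixes B :: "'h::real_inner \<Rightarrow> 'h"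
  assumes B_bl: "bounded_linear B" and B_sym: "\<And>x y. inner (B x) y = inner x (B y)" and c0: "0 < c0"
    and below: "\<And>a. c0 < \<bar>a\<bar> \<Longrightarrow> \<exists>c>0. \<forall>k. c * norm k \<le> norm (B k - a *\<^sub>R k)"
  shows "norm (B k) \<le> c0 * norm k"
proof -
  interpret B: bounded_linear B by fact
  have "onorm B \<le> c0"
  proof (rule ccontr)
    assume big: "\<not> onorm B \<le> c0"
    define b where "b = onorm B"
    have b: "c0 < b" using big by (simp add: b_def)
    have b0: "0 < b" using b c0 by linarith
    obtain c1 where c1: "0 < c1" "\<And>k. c1 * norm k \<le> norm (B k - b *\<^sub>R k)"
      using below[of b] b b0 by auto
    obtain c2 where c2: "0 < c2" "\<And>k. c2 * norm k \<le> norm (B k - (- b) *\<^sub>R k)"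
      using below[of "- b"] b b0 by auto
    have le: "norm (B x) \<le> b * norm x" for x using onorm[OF B_bl] by (simp add: b_def)
    define q where "q = c1 * c2"
    have q: "0 < q" using c1 c2 by (simp add: q_def)
    have sq: "q\<^sup>2 * (norm x)\<^sup>2 \<le> 2 * b\<^sup>2 * (b\<^sup>2 * (norm x)\<^sup>2 - (norm (B x))\<^sup>2)" for x
    proof -
      have "q * norm x \<le> c1 * norm (B x + b *\<^sub>R x)"
        using c2(2)[of x] c1 by (simp add: q_def mult_left_mono mult.assoc)
      also have "\<dots> \<le> norm (B (B x + b *\<^sub>R x) - b *\<^sub>R (B x + b *\<^sub>R x))" by (rule c1)
      also have "B (B x + b *\<^sub>R x) - b *\<^sub>R (B x + b *\<^sub>R x) = B (B x) - b\<^sup>2 *\<^sub>R x"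
        by (simp add: B.add B.scaleR algebra_simps power2_eq_square)
      finally have "(q * norm x)\<^sup>2 \<le> (norm (B (B x) - b\<^sup>2 *\<^sub>R x))\<^sup>2"
        using q by (intro power_mono) auto
      also have "\<dots> = (norm (B (B x)))\<^sup>2 - 2 * b\<^sup>2 * (norm (B x))\<^sup>2 + b^4 * (norm x)\<^sup>2"
        unfolding norm_diff_square using B_sym[of "B x" x]
        by (simp add: power2_norm_eq_inner power_mult_distrib)
      also have "(norm (B (B x)))\<^sup>2 \<le> (b * (b * norm x))\<^sup>2"
        using le[of "B x"] le[of x] b0
        by (intro power_mono) (auto intro: order_trans mult_left_mono)
      also have "(b * (b * norm x))\<^sup>2 = b^4 * (norm x)\<^sup>2"
        by (simp add: power_mult_distrib power4_eq_xxxx power2_eq_square)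
      finally show ?thesis
        by (simp add: algebra_simps power_mult_distrib power4_eq_xxxx power2_eq_square)
    qed
    \<comment> \<open>Lower bounds for both factors would give \<open>B\<close> a norm \<open>b'\<close> smaller than \<open>b\<close>.\<close>
    define b' where "b' = sqrt (max 0 (b\<^sup>2 - q\<^sup>2 / (2 * b\<^sup>2)))"
    have "norm (B x) \<le> b' * norm x" for x
    proof -
      have "(norm (B x))\<^sup>2 \<le> (b\<^sup>2 - q\<^sup>2 / (2 * b\<^sup>2)) * (norm x)\<^sup>2"
        using sq[of x] b0 by (simp add: field_simps)
      also have "\<dots> \<le> max 0 (b\<^sup>2 - q\<^sup>2 / (2 * b\<^sup>2)) * (norm x)\<^sup>2"
        by (intro mult_right_mono) auto
      finally have "sqrt ((norm (B x))\<^sup>2) \<le> sqrt (max 0 (b\<^sup>2 - q\<^sup>2 / (2 * b\<^sup>2)) * (norm x)\<^sup>2)"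
        by (rule real_sqrt_le_mono)
      then show ?thesis by (simp add: b'_def real_sqrt_mult)
    qed
    then have "b \<le> b'" unfolding b_def by (intro onorm_bound) (auto simp: b'_def)
    moreover have "b' < sqrt (b\<^sup>2)" unfolding b'_def using b0 q by (intro real_sqrt_less_mono) simp
    ultimately show False using b0 by simp
  qed
  then show ?thesis
    using onorm[OF B_bl, of k] by (meson mult_right_mono norm_ge_zero order_trans)
qed

text \<open>With \<open>D x = x - c B (B x)\<close>, the differences \<open>v - D\<^sup>n v\<close> lie in the range of \<open>B\<^sup>2\<close>, so the
  convergence proves that this range is dense. The operator \<open>D\<close> is symmetric with \<open>0 \<le> D \<le> 1\<close>,
  which makes \<open>h n = (v, D\<^sup>n v)\<close> decreasing; the squared distance of \<open>D\<^sup>i v\<close> and \<open>D\<^sup>j v\<close> is the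
  second difference \<open>h (2 i) - 2 h (i + j) + h (2 j)\<close>, so the iterates form a Cauchy sequence. Its
  limit is fixed by \<open>D\<close>, hence in the kernel of \<open>B\<^sup>2\<close>.\<close>

lemma landweber_iteration_tendsto_zero:
  fixes B :: "'h::{real_inner, complete_space} \<Rightarrow> 'h"
  assumes B_bl: "bounded_linear B" and B_sym: "\<And>x y. inner (B x) y = inner x (B y)"
    and B_inj: "\<And>x. B x = 0 \<Longrightarrow> x = 0"
    and c0: "0 < c" and B_norm: "\<And>x. c * (norm (B x))\<^sup>2 \<le> (norm x)\<^sup>2"
  shows "(\<lambda>n. ((\<lambda>x. x - c *\<^sub>R B (B x)) ^^ n) v) \<longlonglongrightarrow> 0"
proof -
  interpret B: bounded_linear B by fact
  define D where "D x = x - c *\<^sub>R B (B x)" for x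
  have D_sym: "inner (D x) y = inner x (D y)" for x y
    by (simp add: D_def inner_diff_left inner_diff_right B_sym)
  have D_bl: "bounded_linear D"
    unfolding D_def[abs_def]
    by (intro bounded_linear_sub bounded_linear_ident bounded_linear_const_scaleR
              bounded_linear_compose[OF B_bl] B_bl)
  interpret D: bounded_linear D by fact
  have D_pos: "0 \<le> inner x (D x)" and D_le: "inner x (D x) \<le> (norm x)\<^sup>2" for x
  proof -
    have eq: "inner x (D x) = (norm x)\<^sup>2 - c * (norm (B x))\<^sup>2"
      by (simp add: D_def inner_diff_right power2_norm_eq_inner B_sym)
    with B_norm[of x] show "0 \<le> inner x (D x)" "inner x (D x) \<le> (norm x)\<^sup>2" using eq c0 by auto
  qed
  have Dn_sym: "inner ((D ^^ n) x) y = inner x ((D ^^ n) y)" for n x y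
    by (induction n arbitrary: x y) (simp_all add: D_sym funpow_swap1)
  define h where "h n = inner v ((D ^^ n) v)" for n
  have h_even: "h (2 * n) = inner ((D ^^ n) v) ((D ^^ n) v)" for n
    by (simp add: h_def Dn_sym mult_2 funpow_add)
  have h_odd: "h (Suc (2 * n)) = inner ((D ^^ n) v) (D ((D ^^ n) v))" for n
    by (simp add: h_def Dn_sym mult_2 funpow_add D_sym funpow_swap1)
  have h0: "0 \<le> h n" for n
    by (cases "even n") (auto elim!: evenE oddE simp: h_even h_odd D_pos)
  have h_dec: "h (Suc n) \<le> h n" for n
  proof (cases "even n")
    case True
    then obtain k where "n = 2 * k" by (auto elim: evenE)
    then show ?thesis using D_le[of "(D ^^ k) v"] by (simp add: h_even h_odd power2_norm_eq_inner)
  next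
    case False
    then obtain k where k: "n = Suc (2 * k)" by (auto elim: oddE)
    define x where "x = (D ^^ k) v"
    have "h (Suc n) = inner (D x) (D x)"
      using h_even[of "Suc k"] by (simp add: k x_def)
    moreover have "h n = inner x (D x)" by (simp add: k h_odd x_def)
    moreover have "inner (D x) (D x) \<le> inner x (D x)"
    proof -
      have "inner x (D x) - inner (D x) (D x) = c * inner (B (B x)) (D x)"
        by (simp add: D_def[of x] inner_diff_left algebra_simps)
      also have "inner (B (B x)) (D x) = inner (B x) (D (B x))"
        by (simp add: D_def B.diff B.scaleR B_sym)
      finally show ?thesis using D_pos[of "B x"] c0 by (smt (verit) mult_nonneg_nonneg)
    qed
    ultimately show ?thesis by simp
  qed
  have "convergent h"
  proof (rule Bseq_monoseq_convergent)
    show "monoseq h" using h_dec by (simp add: decseq_imp_monoseq decseq_Suc_iff)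
    have "norm (h n) \<le> h 0" for n
      using h0[of n] decseqD[of h 0 n] h_dec by (simp add: decseq_Suc_iff)
    then show "Bseq h" by (rule BseqI')
  qed
  then have hC: "Cauchy h" by (rule convergent_Cauchy)
  have "Cauchy (\<lambda>n. (D ^^ n) v)"
  proof (rule metric_CauchyI)
    fix d :: real assume d: "0 < d"
    obtain M where M: "\<And>i j. M \<le> i \<Longrightarrow> M \<le> j \<Longrightarrow> dist (h i) (h j) < d\<^sup>2"
      using metric_CauchyD[OF hC, of "d\<^sup>2"] d by auto
    have "dist ((D ^^ i) v) ((D ^^ j) v) < d" if "M \<le> i" "i \<le> j" for i j
    proof -
      have cross: "inner ((D ^^ i) v) ((D ^^ j) v) = h (i + j)"
        by (simp add: h_def Dn_sym funpow_add)
      have "(norm ((D ^^ i) v - (D ^^ j) v))\<^sup>2 = h (2 * i) - 2 * h (i + j) + h (2 * j)"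
        unfolding norm_diff_square by (simp add: power2_norm_eq_inner h_even cross)
      also have "\<dots> \<le> h (2 * i) - h (i + j)"
        using decseqD[of h "i + j" "2 * j"] h_dec that by (simp add: decseq_Suc_iff)
      also have "\<dots> < d\<^sup>2" using M[of "2 * i" "i + j"] that by (simp add: dist_real_def)
      finally show ?thesis using d by (simp add: dist_norm power_less_imp_less_base)
    qed
    then show "\<exists>M. \<forall>i\<ge>M. \<forall>j\<ge>M. dist ((D ^^ i) v) ((D ^^ j) v) < d"
      by (metis dist_commute nle_le)
  qed
  then obtain l where l: "(\<lambda>n. (D ^^ n) v) \<longlonglongrightarrow> l"
    using Cauchy_convergent convergentD by blast
  have "D l = l"
    using D.tendsto[OF l] LIMSEQ_Suc[OF l] by (auto intro: LIMSEQ_unique)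
  then have "B (B l) = 0" using c0 by (simp add: D_def)
  then have "l = 0" using B_inj by blast
  with l show ?thesis by (simp add: D_def[abs_def])
qed

locale symmetric_contraction_semigroup =
  fixes T :: "real \<Rightarrow> 'h::{real_inner, complete_space} \<Rightarrow> 'h"
  assumes T_linear: "0 < t \<Longrightarrow> linear (T t)"
    and T_contraction: "0 < t \<Longrightarrow> norm (T t x) \<le> norm x"
    and T_symmetric: "0 < t \<Longrightarrow> inner (T t x) y = inner x (T t y)"
    and T_semigroup: "0 < s \<Longrightarrow> 0 < t \<Longrightarrow> T s (T t x) = T (s + t) x"
begin

text \<open>The graph of the operator \<open>H\<close> with \<open>T t = exp (- t H)\<close>; a relation, because \<open>H\<close> need not be
  defined everywhere.\<close>

definition gen :: "'h \<Rightarrow> 'h \<Rightarrow> bool" where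
  "gen x y \<longleftrightarrow> ((\<lambda>t. (1 / t) *\<^sub>R (x - T t x)) \<longlongrightarrow> y) (at_right 0)"

lemma ev_pos: "eventually (\<lambda>t::real. 0 < t) (at_right 0)"
  by (simp add: eventually_at_right_less)

lemma gen_unique: "gen x y \<Longrightarrow> gen x z \<Longrightarrow> y = z"
  unfolding gen_def by (rule tendsto_unique[rotated]) auto

lemma gen_combination:
  assumes "gen x y" "gen x' y'"
  shows "gen (a *\<^sub>R x + b *\<^sub>R x') (a *\<^sub>R y + b *\<^sub>R y')"
proof -
  have "((\<lambda>t. a *\<^sub>R ((1 / t) *\<^sub>R (x - T t x)) + b *\<^sub>R ((1 / t) *\<^sub>R (x' - T t x')))
          \<longlongrightarrow> a *\<^sub>R y + b *\<^sub>R y') (at_right 0)"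
    using assms unfolding gen_def by (intro tendsto_intros)
  then show ?thesis unfolding gen_def
  proof (rule Lim_transform_eventually)
    show "\<forall>\<^sub>F t in at_right 0. a *\<^sub>R ((1 / t) *\<^sub>R (x - T t x)) + b *\<^sub>R ((1 / t) *\<^sub>R (x' - T t x'))
       = (1 / t) *\<^sub>R (a *\<^sub>R x + b *\<^sub>R x' - T t (a *\<^sub>R x + b *\<^sub>R x'))"
      using ev_pos
    proof eventually_elim
      case (elim t)
      have "T t (a *\<^sub>R x + b *\<^sub>R x') = a *\<^sub>R T t x + b *\<^sub>R T t x'"
        using T_linear[OF elim] by (simp add: linear_add linear_scale)
      then show ?case by (simp add: algebra_simps)
    qed
  qed
qed

lemma gen_symmetric:
  assumes "gen x y" "gen x' y'"
  shows "inner y x' = inner x y'"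
proof -
  have "((\<lambda>t. inner ((1 / t) *\<^sub>R (x - T t x)) x') \<longlongrightarrow> inner y x') (at_right 0)"
    using assms unfolding gen_def by (intro tendsto_intros)
  moreover have "((\<lambda>t. inner ((1 / t) *\<^sub>R (x - T t x)) x') \<longlongrightarrow> inner x y') (at_right 0)"
  proof (rule Lim_transform_eventually)
    show "((\<lambda>t. inner x ((1 / t) *\<^sub>R (x' - T t x'))) \<longlongrightarrow> inner x y') (at_right 0)"
      using assms unfolding gen_def by (intro tendsto_intros)
    show "\<forall>\<^sub>F t in at_right 0. inner x ((1 / t) *\<^sub>R (x' - T t x')) = inner ((1 / t) *\<^sub>R (x - T t x)) x'"
      using ev_pos by eventually_elim (simp add: algebra_simps T_symmetric)
  qed
  ultimately show ?thesis by (rule tendsto_unique[rotated]) auto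
qed

lemma bounded_linear_T: "0 < t \<Longrightarrow> bounded_linear (T t)"
  using T_linear[of t] T_contraction[of t]
  by (intro bounded_linear_intro[where K = 1]) (auto simp: linear_add linear_scale)

lemma gen_T:
  assumes "gen x y" "0 < s"
  shows "gen (T s x) (T s y)"
proof -
  interpret bounded_linear "T s" by (rule bounded_linear_T) fact
  have "((\<lambda>t. T s ((1 / t) *\<^sub>R (x - T t x))) \<longlongrightarrow> T s y) (at_right 0)"
    using assms unfolding gen_def by (intro tendsto)
  then show ?thesis unfolding gen_def
  proof (rule Lim_transform_eventually)
    show "\<forall>\<^sub>F t in at_right 0. T s ((1 / t) *\<^sub>R (x - T t x)) = (1 / t) *\<^sub>R (T s x - T t (T s x))"
      using ev_pos by eventually_elim (simp add: scaleR diff T_semigroup assms add.commute)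
  qed
qed

text \<open>Cut the interval from 0 to \<open>t\<close> into equal steps: by contractivity no step moves the orbit
  further than the first one, and as the number of steps grows the first step is controlled by
  \<open>y\<close>.\<close>

lemma gen_difference_bound:
  assumes g: "gen x y" and t: "0 < t"
  shows "norm (x - T t x) \<le> t * norm y"
proof -
  have step: "norm (x - T (real (Suc n) * s) x) \<le> real (Suc n) * norm (x - T s x)" if s: "0 < s" for n s
  proof (induction n)
    case (Suc n)
    define r where "r = real (Suc n) * s"
    have r: "0 < r" using s by (simp add: r_def)
    interpret bounded_linear "T r" by (rule bounded_linear_T) fact
    have "x - T (r + s) x = (x - T r x) + T r (x - T s x)"
      using s r by (simp add: diff T_semigroup)
    then have "x - T (real (Suc (Suc n)) * s) x = (x - T (real (Suc n) * s) x) + T (real (Suc n) * s) (x - T s x)"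
      by (simp add: r_def algebra_simps)
    also have "norm \<dots> \<le> real (Suc n) * norm (x - T s x) + norm (x - T s x)"
      using Suc T_contraction[of "real (Suc n) * s" "x - T s x"] s
      by (intro norm_triangle_mono) auto
    finally show ?case by (simp add: algebra_simps)
  qed simp
  have lim: "filterlim (\<lambda>n. t / real (Suc n)) (at_right 0) sequentially"
    using t unfolding filterlim_at
    by (auto intro!: always_eventually simp: lim_const_over_n[THEN LIMSEQ_Suc] simp del: of_nat_Suc)
  have "(\<lambda>n. norm ((1 / (t / real (Suc n))) *\<^sub>R (x - T (t / real (Suc n)) x))) \<longlonglongrightarrow> norm y"
    using filterlim_compose[OF g[unfolded gen_def] lim] by (intro tendsto_norm)
  then have "(\<lambda>n. t * norm ((1 / (t / real (Suc n))) *\<^sub>R (x - T (t / real (Suc n)) x))) \<longlonglongrightarrow> t * norm y"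
    by (rule tendsto_mult_left)
  moreover have "norm (x - T t x) \<le> t * norm ((1 / (t / real (Suc n))) *\<^sub>R (x - T (t / real (Suc n)) x))" for n
    using step[of "t / real (Suc n)" n] t
    unfolding norm_scaleR by (simp add: field_simps del: of_nat_Suc)
  ultimately show ?thesis by (intro LIMSEQ_le_const[of _ "t * norm y"] exI[of _ 0] allI impI)
qed

text \<open>Strong continuity is not part of the locale; on the domain of the generator the Lipschitz
  bound above takes its place.\<close>

lemma T_orbit_continuous:
  assumes "gen z y" "0 < t"
  shows "((\<lambda>s. T s z) \<longlongrightarrow> T t z) (at t)"
proof (rule tendstoI)
  fix e :: real assume e: "0 < e"
  define d where "d = min t (e / (norm y + 1))"
  have d: "0 < d" using e assms by (simp add: d_def add_nonneg_pos)
  have dy: "u * norm y < e" if "0 < u" "u < d" for u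
  proof -
    have "u * (norm y + 1) < e"
      using that by (simp add: d_def pos_less_divide_eq add_nonneg_pos)
    then show ?thesis using that by (simp add: algebra_simps)
  qed
  have "dist (T s z) (T t z) < e" if "s \<noteq> t" "dist s t < d" for s
  proof (cases "s < t")
    case True
    have s: "0 < s" using that True by (simp add: d_def dist_real_def)
    interpret bounded_linear "T s" by (rule bounded_linear_T) fact
    have "T s z - T t z = T s (z - T (t - s) z)"
      using s True by (simp add: diff T_semigroup)
    then have "dist (T s z) (T t z) \<le> norm (z - T (t - s) z)"
      using T_contraction[OF s] by (simp add: dist_norm)
    also have "\<dots> \<le> (t - s) * norm y" using gen_difference_bound assms True by simp
    also have "\<dots> < e" using dy[of "t - s"] that True by (simp add: dist_real_def)
    finally show ?thesis .
  next
    case False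
    then have st: "t < s" using that by simp
    interpret bounded_linear "T t" by (rule bounded_linear_T) fact
    have "T s z - T t z = - T t (z - T (s - t) z)"
      using assms st by (simp add: diff T_semigroup)
    then have "dist (T s z) (T t z) \<le> norm (z - T (s - t) z)"
      using T_contraction[OF assms(2)] by (simp add: dist_norm)
    also have "\<dots> \<le> (s - t) * norm y" using gen_difference_bound assms st by simp
    also have "\<dots> < e" using dy[of "s - t"] that st by (simp add: dist_real_def)
    finally show ?thesis .
  qed
  then show "\<forall>\<^sub>F s in at t. dist (T s z) (T t z) < e"
    using d unfolding eventually_at by (intro exI[of _ d]) auto
qed

text \<open>The right difference quotient is evaluated by moving \<open>T t\<close> to \<open>z\<close>. In the left one it is
  \<open>T s\<close> with \<open>s < t\<close> that moves to \<open>z\<close>, and here continuity of the orbit of \<open>z\<close> is used.\<close>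

lemma T_inner_derivative:
  assumes z: "gen z z'" and x: "gen x y" and t: "0 < t"
  shows "((\<lambda>t. inner z (T t x)) has_real_derivative - inner z (T t y)) (at t)"
proof -
  have right: "((\<lambda>s. (inner z (T s x) - inner z (T t x)) / (s - t)) \<longlongrightarrow> - inner z (T t y)) (at_right t)"
  proof -
    have "((\<lambda>h. inner (T t z) (- ((1 / h) *\<^sub>R (x - T h x)))) \<longlongrightarrow> inner (T t z) (- y)) (at_right 0)"
      using x unfolding gen_def by (intro tendsto_intros)
    then have "((\<lambda>s. inner (T t z) (- ((1 / (s - t)) *\<^sub>R (x - T (s - t) x)))) \<longlongrightarrow> inner (T t z) (- y)) (at_right t)"
      unfolding at_right_to_0[of t] filterlim_filtermap by simp
    moreover have "\<forall>\<^sub>F s in at_right t. inner (T t z) (- ((1 / (s - t)) *\<^sub>R (x - T (s - t) x)))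
           = (inner z (T s x) - inner z (T t x)) / (s - t)"
      unfolding eventually_at_right_field
    proof (intro exI[of _ "t + 1"] conjI allI impI)
      fix s assume "t < s" "s < t + 1"
      have "inner (T t z) (T (s - t) x) = inner z (T s x)"
        using \<open>t < s\<close> t by (simp add: T_symmetric T_semigroup)
      then show "inner (T t z) (- ((1 / (s - t)) *\<^sub>R (x - T (s - t) x)))
           = (inner z (T s x) - inner z (T t x)) / (s - t)"
        using \<open>t < s\<close> t by (simp add: inner_diff_right T_symmetric divide_simps)
    qed simp
    ultimately have "((\<lambda>s. (inner z (T s x) - inner z (T t x)) / (s - t)) \<longlongrightarrow> inner (T t z) (- y)) (at_right t)"
      by (rule Lim_transform_eventually)
    then show ?thesis using t by (simp add: T_symmetric)
  qed
  have left: "((\<lambda>s. (inner z (T s x) - inner z (T t x)) / (s - t)) \<longlongrightarrow> - inner z (T t y)) (at_left t)"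
  proof -
    have "((\<lambda>s. - ((1 / (t - s)) *\<^sub>R (x - T (t - s) x))) \<longlongrightarrow> - y) (at_left t)"
      using x unfolding gen_def at_left_minus[of t] filterlim_filtermap at_right_to_0[of "- t"]
      by (intro tendsto_minus) (simp add: algebra_simps)
    moreover have "((\<lambda>s. T s z) \<longlongrightarrow> T t z) (at_left t)"
      using T_orbit_continuous[OF z t] by (rule tendsto_mono[rotated]) (simp add: at_le)
    ultimately have "((\<lambda>s. inner (T s z) (- ((1 / (t - s)) *\<^sub>R (x - T (t - s) x)))) \<longlongrightarrow> inner (T t z) (- y)) (at_left t)"
      by (intro tendsto_inner)
    moreover have "\<forall>\<^sub>F s in at_left t. inner (T s z) (- ((1 / (t - s)) *\<^sub>R (x - T (t - s) x)))
           = (inner z (T s x) - inner z (T t x)) / (s - t)"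
      unfolding eventually_at_left_field
    proof (intro exI[of _ 0] conjI allI impI)
      fix s :: real assume "0 < s" "s < t"
      have "inner (T s z) (T (t - s) x) = inner z (T t x)"
        using \<open>0 < s\<close> \<open>s < t\<close> by (simp add: T_symmetric T_semigroup)
      then show "inner (T s z) (- ((1 / (t - s)) *\<^sub>R (x - T (t - s) x)))
           = (inner z (T s x) - inner z (T t x)) / (s - t)"
        using \<open>0 < s\<close> \<open>s < t\<close> by (simp add: inner_diff_right T_symmetric divide_simps) (simp add: algebra_simps)
    qed (use t in simp)
    ultimately have "((\<lambda>s. (inner z (T s x) - inner z (T t x)) / (s - t)) \<longlongrightarrow> inner (T t z) (- y)) (at_left t)"
      by (rule Lim_transform_eventually)
    then show ?thesis using t by (simp add: T_symmetric)
  qed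
  show ?thesis
    unfolding has_field_derivative_iff
    using filterlim_split_at[OF left right] by simp
qed

lemma T_half:
  assumes "0 < s"
  shows "inner x (T s x) = (norm (T (s / 2) x))\<^sup>2"
  using T_symmetric[of "s / 2" x "T (s / 2) x"] T_semigroup[of "s / 2" "s / 2" x] assms
  by (simp add: power2_norm_eq_inner)

text \<open>The norm of an orbit is log-convex. If \<open>a\<close> denotes the quotient of the two sides at time
  \<open>t\<close>, the quotient at time \<open>2 ^ n * t\<close> is at least \<open>a ^ (2 ^ n)\<close>, whereas by hypothesis it is at
  most \<open>K / norm w\<close> for large \<open>n\<close>; hence \<open>a \<le> 1\<close>.\<close>

lemma orbit_decay_constant_free:
  assumes t: "0 < t" and bd: "\<And>t. 1 \<le> t \<Longrightarrow> norm (T t w) \<le> K * exp (- \<epsilon> * t)"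
  shows "norm (T t w) \<le> exp (- \<epsilon> * t) * norm w"
proof (cases "w = 0")
  case True
  then show ?thesis using T_contraction[OF t, of w] by simp
next
  case False
  define a where "a = norm (T t w) / (norm w * exp (- \<epsilon> * t))"
  have a0: "0 \<le> a" by (simp add: a_def)
  have it: "a ^ (2 ^ n) \<le> norm (T (2 ^ n * t) w) / (norm w * exp (- \<epsilon> * (2 ^ n * t)))" for n
  proof (induction n)
    case (Suc n)
    define r where "r = 2 ^ n * t"
    have r: "0 < r" using t by (simp add: r_def)
    have lc: "(norm (T r w))\<^sup>2 \<le> norm w * norm (T (2 * r) w)"
      using T_half[of "2 * r" w] r norm_cauchy_schwarz[of w "T (2 * r) w"] by simp
    have "a ^ (2 ^ Suc n) = (a ^ (2 ^ n))\<^sup>2" by (simp add: power_mult[symmetric] mult.commute)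
    also have "\<dots> \<le> (norm (T r w) / (norm w * exp (- \<epsilon> * r)))\<^sup>2"
      using Suc a0 by (intro power_mono) (auto simp: r_def)
    also have "\<dots> = (norm (T r w))\<^sup>2 / ((norm w)\<^sup>2 * exp (- \<epsilon> * (2 * r)))"
      by (simp add: power_divide power_mult_distrib) (simp add: power2_eq_square mult_exp_exp)
    also have "\<dots> \<le> norm w * norm (T (2 * r) w) / ((norm w)\<^sup>2 * exp (- \<epsilon> * (2 * r)))"
      by (rule divide_right_mono[OF lc]) simp
    also have "\<dots> = norm (T (2 * r) w) / (norm w * exp (- \<epsilon> * (2 * r)))"
      using False by (simp add: power2_eq_square)
    finally show ?case by (simp add: r_def mult.assoc)
  qed (simp add: a_def)
  obtain n0 where n0: "1 / t < real n0" using reals_Archimedean2 by blast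
  have bnd: "a ^ (2 ^ n) \<le> K / norm w" if "n0 \<le> n" for n
  proof -
    have "real n < 2 ^ n" by (rule of_nat_less_two_power)
    then have "1 / t < 2 ^ n" using n0 that by linarith
    then have "1 \<le> 2 ^ n * t" using t by (simp add: field_simps)
    then have "norm (T (2 ^ n * t) w) / (norm w * exp (- \<epsilon> * (2 ^ n * t))) \<le> K * exp (- \<epsilon> * (2 ^ n * t)) / (norm w * exp (- \<epsilon> * (2 ^ n * t)))"
      by (intro divide_right_mono bd) auto
    then show ?thesis using it[of n] by simp
  qed
  have "a \<le> 1"
  proof (rule ccontr)
    assume "\<not> a \<le> 1"
    then have a1: "1 < a" by simp
    obtain k where k: "K / norm w < a ^ k" using real_arch_pow[OF a1] by blast
    define n where "n = max n0 k"
    have "k \<le> n" by (simp add: n_def)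
    then have "k \<le> 2 ^ n" using less_exp[of n] by linarith
    then have "a ^ k \<le> a ^ (2 ^ n)" using a1 by (intro power_increasing) auto
    then show False using bnd[of n] k by (simp add: n_def)
  qed
  then show ?thesis using False by (simp add: a_def field_simps)
qed

text \<open>Write \<open>F s = (H w, T s w)\<close> and \<open>G s = (w, T s w)\<close>, so that \<open>G\<close> has derivative \<open>- F\<close>. The gap
  inequality, applied to \<open>T (s / 2) w\<close>, says that the derivative of \<open>F\<close> is at most \<open>- 2 m F\<close>; thus
  \<open>F\<close> decays like \<open>exp (- 2 m s)\<close>. The squared distance of \<open>T r w\<close> and \<open>T s w\<close> is
  \<open>G (2 r) - 2 G (r + s) + G (2 s)\<close>, at most a constant times \<open>exp (- 4 m r)\<close>, so the orbit is
  Cauchy with rate \<open>exp (- 2 m r)\<close>.\<close>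

lemma orbit_exponential_limit:
  assumes m: "0 < m" and gap: "\<And>w y. gen w y \<Longrightarrow> 2 * m * inner w y \<le> (norm y)\<^sup>2"
    and wy: "gen w y" and yz: "gen y z"
  obtains l J where "\<And>r. 1 \<le> r \<Longrightarrow> norm (T r w - l) \<le> J * exp (- (2 * m) * r)"
    and "\<And>s. 0 < s \<Longrightarrow> T s l = l" and "(\<lambda>n. T (real (Suc n)) w) \<longlonglongrightarrow> l"
proof -
  define F where "F s = inner y (T s w)" for s
  define G where "G s = inner w (T s w)" for s
  have F': "(F has_real_derivative - inner y (T s y)) (at s)" if "0 < s" for s
    unfolding F_def using T_inner_derivative[OF yz wy that] .
  have G': "(G has_real_derivative - F s) (at s)" if "0 < s" for s
    using T_inner_derivative[OF wy wy that] gen_symmetric[OF wy gen_T[OF wy that]]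
    unfolding G_def F_def by simp
  have half: "F s = inner (T (s / 2) w) (T (s / 2) y)" if "0 < s" for s
    using that gen_symmetric[OF wy gen_T[OF wy that]] T_semigroup[of "s/2" "s/2" y]
    by (simp add: F_def T_symmetric)
  have F0: "0 \<le> F s" if "0 < s" for s
  proof -
    have wy': "gen (T (s / 2) w) (T (s / 2) y)" using gen_T[OF wy, of "s/2"] that by simp
    have "0 \<le> inner (T (s / 2) w) (T (s / 2) y)"
    proof (rule tendsto_lowerbound)
      show "((\<lambda>t. inner (T (s / 2) w) ((1 / t) *\<^sub>R (T (s / 2) w - T t (T (s / 2) w)))) \<longlongrightarrow>
             inner (T (s / 2) w) (T (s / 2) y)) (at_right 0)"
        using wy' unfolding gen_def by (intro tendsto_intros)
      show "\<forall>\<^sub>F t in at_right 0. 0 \<le> inner (T (s / 2) w) ((1 / t) *\<^sub>R (T (s / 2) w - T t (T (s / 2) w)))"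
        using ev_pos
      proof eventually_elim
        case (elim t)
        define u where "u = T (s / 2) w"
        have "inner u (T t u) \<le> norm u * norm u"
          using norm_cauchy_schwarz[of u "T t u"] T_contraction[OF elim, of u]
          by (meson mult_left_mono norm_ge_zero order_trans)
        then show ?case using elim unfolding u_def[symmetric]
          by (simp add: inner_diff_right power2_norm_eq_inner[symmetric] power2_eq_square)
      qed
    qed auto
    then show ?thesis using half[OF that] by simp
  qed
  have F_mono: "F s * exp (2 * m * s) \<le> F 1 * exp (2 * m)" if "1 \<le> s" for s
  proof -
    have "F s * exp (2 * m * s) \<le> F 1 * exp (2 * m * 1)"
    proof (rule DERIV_nonpos_imp_nonincreasing[OF that])
      fix r :: real assume r: "1 \<le> r" "r \<le> s"
      have "2 * m * F r \<le> inner y (T r y)"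
        using gap[OF gen_T[OF wy, of "r / 2"]] T_half[of r y] half[of r] r by simp
      then have "(- inner y (T r y) + 2 * m * F r) * exp (2 * m * r) \<le> 0"
        by (intro mult_nonpos_nonneg) auto
      moreover have "((\<lambda>r. F r * exp (2 * m * r)) has_real_derivative
          (- inner y (T r y) + 2 * m * F r) * exp (2 * m * r)) (at r)"
        using r by (auto intro!: derivative_eq_intros F' simp: algebra_simps)
      ultimately show "\<exists>d. ((\<lambda>r. F r * exp (2 * m * r)) has_real_derivative d) (at r) \<and> d \<le> 0"
        by blast
    qed
    then show ?thesis by simp
  qed
  define K where "K = F 1 * exp (2 * m)"
  have K0: "0 \<le> K" using F0[of 1] by (simp add: K_def)
  have FK: "F s \<le> K * exp (- (2 * m * s))" if "1 \<le> s" for s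
    using F_mono[OF that] by (simp add: K_def exp_minus field_simps)
  have G_dec: "G s \<le> G r" if "0 < r" "r \<le> s" for r s
  proof (rule DERIV_nonpos_imp_nonincreasing[OF that(2)])
    fix u assume "r \<le> u" "u \<le> s"
    then show "\<exists>d. (G has_real_derivative d) (at u) \<and> d \<le> 0"
      using that F0[of u] G'[of u] by (intro exI[of _ "- F u"]) auto
  qed
  have G_inc: "G r - G s \<le> K / (2 * m) * exp (- (2 * m * r))" if "1 \<le> r" "r \<le> s" for r s
  proof -
    have "G r - K / (2 * m) * exp (- (2 * m * r)) \<le> G s - K / (2 * m) * exp (- (2 * m * s))"
    proof (rule DERIV_nonneg_imp_nondecreasing[OF that(2)])
      fix u assume u: "r \<le> u" "u \<le> s"
      have "((\<lambda>r. G r - K / (2 * m) * exp (- (2 * m * r))) has_real_derivative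
             - F u + K * exp (- (2 * m * u))) (at u)"
        using u that m by (auto intro!: derivative_eq_intros G' simp: field_simps)
      then show "\<exists>d. ((\<lambda>r. G r - K / (2 * m) * exp (- (2 * m * r))) has_real_derivative d) (at u) \<and> 0 \<le> d"
        using FK[of u] u that by (intro exI conjI) auto
    qed
    moreover have "0 \<le> K / (2 * m) * exp (- (2 * m * s))" using K0 m by simp
    ultimately show ?thesis by linarith
  qed
  have dist2: "(norm (T r w - T s w))\<^sup>2 \<le> K / (2 * m) * exp (- (2 * m * (2 * r)))" if "1 \<le> r" "r \<le> s" for r s
  proof -
    have "(norm (T r w - T s w))\<^sup>2 = G (2 * r) - 2 * G (r + s) + G (2 * s)"
      using that unfolding G_def
      unfolding norm_diff_square
      by (simp add: power2_norm_eq_inner T_symmetric T_semigroup)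
    also have "\<dots> \<le> G (2 * r) - G (r + s)" using G_dec[of "r + s" "2 * s"] that by simp
    also have "\<dots> \<le> K / (2 * m) * exp (- (2 * m * (2 * r)))" using that by (intro G_inc) auto
    finally show ?thesis .
  qed
  define J where "J = sqrt (K / (2 * m))"
  have J0: "0 \<le> J" using K0 m by (simp add: J_def)
  have dist1: "norm (T r w - T s w) \<le> J * exp (- (2 * m) * r)" if "1 \<le> r" "r \<le> s" for r s
  proof -
    have "exp (- (2 * m * (2 * r))) = (exp (- (2 * m) * r))\<^sup>2"
      by (simp add: power2_eq_square mult_exp_exp)
    then have "(norm (T r w - T s w))\<^sup>2 \<le> (J * exp (- (2 * m) * r))\<^sup>2"
      using dist2[OF that] K0 m by (simp add: J_def power_mult_distrib)
    then show ?thesis by (rule power2_le_imp_le) (simp add: J0)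
  qed
  have small: "((\<lambda>r. J * exp (- (2 * m) * r)) \<longlongrightarrow> 0) at_top"
    using m by real_asymp
  have "Cauchy (\<lambda>n. T (real (Suc n)) w)"
  proof (rule metric_CauchyI)
    fix d :: real assume d: "0 < d"
    have "(\<lambda>n. J * exp (- (2 * m) * real (Suc n))) \<longlonglongrightarrow> 0"
      using filterlim_compose[OF small filterlim_compose[OF filterlim_real_sequentially filterlim_Suc]] .
    from order_tendstoD(2)[OF this d] obtain M
      where M: "\<And>n. M \<le> n \<Longrightarrow> J * exp (- (2 * m) * real (Suc n)) < d"
      unfolding eventually_sequentially by blast
    have "dist (T (real (Suc i)) w) (T (real (Suc j)) w) < d" if "M \<le> i" "i \<le> j" for i j
      using dist1[of "real (Suc i)" "real (Suc j)"] M[of i] that by (simp add: dist_norm)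
    then show "\<exists>M. \<forall>i\<ge>M. \<forall>j\<ge>M. dist (T (real (Suc i)) w) (T (real (Suc j)) w) < d"
      by (metis dist_commute nle_le)
  qed
  then obtain l where l: "(\<lambda>n. T (real (Suc n)) w) \<longlonglongrightarrow> l"
    using Cauchy_convergent convergentD by blast
  have near: "norm (T r w - l) \<le> J * exp (- (2 * m) * r)" if "1 \<le> r" for r
  proof (rule tendsto_upperbound)
    show "(\<lambda>n. norm (T r w - T (real (Suc n)) w)) \<longlonglongrightarrow> norm (T r w - l)"
      using l by (intro tendsto_intros)
    show "\<forall>\<^sub>F n in sequentially. norm (T r w - T (real (Suc n)) w) \<le> J * exp (- (2 * m) * r)"
      using eventually_ge_at_top[of "nat \<lceil>r\<rceil>"] by eventually_elim (rule dist1[OF that], linarith)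
  qed simp
  have "T s l = l" if s: "0 < s" for s
  proof (rule tendsto_unique[OF sequentially_bot])
    interpret Ts: bounded_linear "T s" by (rule bounded_linear_T) fact
    show "(\<lambda>n. T s (T (real (Suc n)) w)) \<longlonglongrightarrow> T s l" by (rule Ts.tendsto[OF l])
    have "(\<lambda>n. T (s + real (Suc n)) w - l) \<longlonglongrightarrow> 0"
    proof (rule Lim_null_comparison)
      show "\<forall>\<^sub>F n in sequentially. norm (T (s + real (Suc n)) w - l) \<le> J * exp (- (2 * m) * (s + real (Suc n)))"
        using s by (intro always_eventually allI near) simp
      show "(\<lambda>n. J * exp (- (2 * m) * (s + real (Suc n)))) \<longlonglongrightarrow> 0"
        using m by real_asymp
    qed
    then show "(\<lambda>n. T s (T (real (Suc n)) w)) \<longlonglongrightarrow> l"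
      using s by (simp add: T_semigroup LIM_zero_iff)
  qed
  then show thesis using near l that by blast
qed

text \<open>Take the midpoint \<open>m = \<epsilon> / 2\<close> and the resolvent \<open>B\<close> of the generator \<open>H\<close> at \<open>m\<close>. A number
  \<open>a\<close> with \<open>\<bar>a\<bar> > 1 / m\<close> corresponds to the resolvent point \<open>m + 1 / a\<close> strictly between 0 and
  \<open>\<epsilon>\<close>, so \<open>B - a\<close> is bounded below and the norm of \<open>B\<close> is at most \<open>1 / m\<close>. In terms of \<open>H\<close> this is
  the gap inequality \<open>2 m (H w, w) \<le> \<parallel>H w\<parallel>\<^sup>2\<close>, which makes orbits starting in the range of \<open>B\<^sup>2\<close>
  converge exponentially to fixed vectors. On the complement of \<open>e\<close> these vanish, the constant is
  removed by log-convexity, and density of the range extends the bound to all of the complement.\<close>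

lemma spectral_gap_decay:
  assumes eps: "0 < \<epsilon>"
    and lower: "\<And>\<mu>. 0 < \<bar>\<mu>\<bar> \<Longrightarrow> \<bar>\<mu>\<bar> < \<epsilon> \<Longrightarrow> \<exists>C. \<forall>x y. gen x y \<longrightarrow> norm x \<le> C * norm (y - \<mu> *\<^sub>R x)"
    and onto: "\<And>\<mu> k. 0 < \<bar>\<mu>\<bar> \<Longrightarrow> \<bar>\<mu>\<bar> < \<epsilon> \<Longrightarrow> \<exists>x y. gen x y \<and> y - \<mu> *\<^sub>R x = k"
    and e_fixed: "\<And>t. 0 < t \<Longrightarrow> T t e = e"
    and fixed: "\<And>x. (\<And>t. 0 < t \<Longrightarrow> T t x = x) \<Longrightarrow> \<exists>c. x = c *\<^sub>R e"
    and orth: "inner v e = 0" and t: "0 < t"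
  shows "norm (T t v) \<le> exp (- \<epsilon> * t) * norm v"
proof -
  define m where "m = \<epsilon> / 2"
  have m: "0 < m" "m < \<epsilon>" "\<epsilon> = 2 * m" using eps by (auto simp: m_def)
  obtain C0 where C0: "\<And>x y. gen x y \<Longrightarrow> norm x \<le> C0 * norm (y - m *\<^sub>R x)"
    using lower[of m] m by auto
  define B where "B k = (SOME x. \<exists>y. gen x y \<and> y - m *\<^sub>R x = k)" for k
  have B: "gen (B k) (k + m *\<^sub>R B k)" for k
  proof -
    obtain y where "gen (B k) y" "y - m *\<^sub>R B k = k"
      using someI_ex[OF onto[of m k]] m unfolding B_def by auto
    then have "y = k + m *\<^sub>R B k" by (simp add: algebra_simps)
    with \<open>gen (B k) y\<close> show ?thesis by simp
  qed
  have B_eq: "B k = x" if "gen x y" "y - m *\<^sub>R x = k" for x y k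
  proof -
    have "gen (1 *\<^sub>R B k + (-1) *\<^sub>R x) (1 *\<^sub>R (k + m *\<^sub>R B k) + (-1) *\<^sub>R y)"
      by (rule gen_combination) (use that B in auto)
    from C0[OF this] have "norm (B k - x) \<le> C0 * norm (0::'h)"
      using that(2) by (simp add: algebra_simps)
    then show ?thesis by simp
  qed
  have B_bound: "norm (B k) \<le> C0 * norm k" for k
    using C0[OF B[of k]] by simp
  have B_bl: "bounded_linear B"
  proof (rule bounded_linear_intro[where K = C0])
    show "B (x + y) = B x + B y" for x y
      using gen_combination[OF B[of x] B[of y], of 1 1] by (intro B_eq) (auto simp: algebra_simps)
    show "B (r *\<^sub>R x) = r *\<^sub>R B x" for r x
      using gen_combination[OF B[of x] B[of x], of r 0] by (intro B_eq) (auto simp: algebra_simps)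
  qed (use B_bound in \<open>simp add: mult.commute\<close>)
  interpret B: bounded_linear B by fact
  have B_sym: "inner (B x) y = inner x (B y)" for x y
    using gen_symmetric[OF B[of x] B[of y]] by (simp add: inner_add_left inner_add_right)
  have B_inj: "x = 0" if "B x = 0" for x
  proof -
    have "gen 0 (0::'h)" using gen_combination[OF B[of 0] B[of 0], of 0 0] by simp
    then show ?thesis using B[of x] that gen_unique by fastforce
  qed
  have below: "\<exists>c>0. \<forall>k. c * norm k \<le> norm (B k - a *\<^sub>R k)" if a: "1 / m < \<bar>a\<bar>" for a
  proof -
    have a0: "a \<noteq> 0" using a m by (auto simp: field_simps)
    have "\<bar>1 / a\<bar> < m" using a m a0 by (simp add: field_simps)
    then have rng: "0 < \<bar>m + 1 / a\<bar>" "\<bar>m + 1 / a\<bar> < \<epsilon>" using m by linarith+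
    obtain C where C: "\<And>x y. gen x y \<Longrightarrow> norm x \<le> C * norm (y - (m + 1 / a) *\<^sub>R x)"
      using lower[OF rng] by auto
    define C1 where "C1 = max C 0"
    have est: "\<bar>a\<bar> * norm k \<le> (C1 / \<bar>a\<bar> + 1) * norm (B k - a *\<^sub>R k)" for k
    proof -
      have eq: "k + m *\<^sub>R B k - (m + 1 / a) *\<^sub>R B k = - (1 / a) *\<^sub>R (B k - a *\<^sub>R k)"
        using a0 by (simp add: algebra_simps)
      have "norm (B k) \<le> C * norm (k + m *\<^sub>R B k - (m + 1 / a) *\<^sub>R B k)"
        by (rule C[OF B])
      also have "\<dots> = C * (norm (B k - a *\<^sub>R k) / \<bar>a\<bar>)"
        unfolding eq by simp
      also have "\<dots> \<le> C1 * (norm (B k - a *\<^sub>R k) / \<bar>a\<bar>)"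
        by (intro mult_right_mono) (auto simp: C1_def)
      finally have "norm (B k) \<le> C1 / \<bar>a\<bar> * norm (B k - a *\<^sub>R k)" by simp
      moreover have "norm (a *\<^sub>R k) \<le> norm (B k) + norm (B k - a *\<^sub>R k)"
        using norm_triangle_ineq4[of "B k" "B k - a *\<^sub>R k"] by simp
      ultimately show ?thesis by (simp add: algebra_simps)
    qed
    have D: "0 < C1 / \<bar>a\<bar> + 1" by (intro add_nonneg_pos) (auto simp: C1_def)
    show ?thesis
    proof (intro exI[of _ "\<bar>a\<bar> / (C1 / \<bar>a\<bar> + 1)"] conjI allI)
      show "0 < \<bar>a\<bar> / (C1 / \<bar>a\<bar> + 1)" using D a0 by simp
      show "\<bar>a\<bar> / (C1 / \<bar>a\<bar> + 1) * norm k \<le> norm (B k - a *\<^sub>R k)" for k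
        using est[of k] D by (simp add: pos_divide_le_eq mult.commute)
    qed
  qed
  have B_norm: "norm (B k) \<le> (1 / m) * norm k" for k
    by (rule symmetric_norm_le_spectral_bound[OF B_bl B_sym _ below]) (use m in simp)
  have gap: "2 * m * inner w y \<le> (norm y)\<^sup>2" if "gen w y" for w y
  proof -
    have "norm w \<le> (1 / m) * norm (y - m *\<^sub>R w)"
      using B_norm[of "y - m *\<^sub>R w"] B_eq[OF that] by simp
    then have "m * norm w \<le> norm (y - m *\<^sub>R w)" using m by (simp add: field_simps)
    then have "(m * norm w)\<^sup>2 \<le> (norm (y - m *\<^sub>R w))\<^sup>2" using m by (intro power_mono) auto
    also have "\<dots> = (norm y)\<^sup>2 - 2 * m * inner w y + (m * norm w)\<^sup>2"
      unfolding norm_diff_square by (simp add: inner_commute power_mult_distrib)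
    finally show ?thesis by simp
  qed
  \<comment> \<open>Exponential decay without control of the constant, on the range of the squared resolvent.\<close>
  have decay: "\<exists>K. \<forall>t\<ge>1. norm (T t w) \<le> K * exp (- \<epsilon> * t)" if w: "w = B (B k)" and we: "inner w e = 0" for w k
  proof -
    define y where "y = B k + m *\<^sub>R w"
    define z where "z = (k + m *\<^sub>R B k) + m *\<^sub>R y"
    have wy: "gen w y" using B[of "B k"] by (simp add: w y_def)
    have yz: "gen y z" using gen_combination[OF B[of k] wy, of 1 m] by (simp add: y_def z_def)
    obtain l J where near: "\<And>r. 1 \<le> r \<Longrightarrow> norm (T r w - l) \<le> J * exp (- (2 * m) * r)"
      and inv: "\<And>s. 0 < s \<Longrightarrow> T s l = l" and l: "(\<lambda>n. T (real (Suc n)) w) \<longlonglongrightarrow> l"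
      using orbit_exponential_limit[OF m(1) gap wy yz] by blast
    obtain c where c: "l = c *\<^sub>R e" using fixed inv by blast
    have "inner l e = 0"
    proof (rule tendsto_unique[OF sequentially_bot])
      show "(\<lambda>n. inner (T (real (Suc n)) w) e) \<longlonglongrightarrow> inner l e" using l by (intro tendsto_intros)
      show "(\<lambda>n. inner (T (real (Suc n)) w) e) \<longlonglongrightarrow> 0" by (simp add: T_symmetric e_fixed we)
    qed
    then have "l = 0" using c by (simp add: inner_scaleR_left)
    then show ?thesis using near m(3) by auto
  qed
  \<comment> \<open>The range of the squared resolvent is dense: \<open>v - (1 - c B\<^sup>2)\<^sup>n v\<close> lies in it and converges to \<open>v\<close>.\<close>
  define c where "c = m\<^sup>2"
  define D where "D = (\<lambda>x. x - c *\<^sub>R B (B x))"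
  have c0: "0 < c" using m by (simp add: c_def)
  have D_lim: "(\<lambda>n. (D ^^ n) v) \<longlonglongrightarrow> 0"
    unfolding D_def
  proof (rule landweber_iteration_tendsto_zero[OF B_bl B_sym B_inj c0])
    fix x
    have "(norm (B x))\<^sup>2 \<le> ((1 / m) * norm x)\<^sup>2" using B_norm by (intro power_mono) auto
    then show "c * (norm (B x))\<^sup>2 \<le> (norm x)\<^sup>2" using m by (simp add: c_def power_mult_distrib field_simps)
  qed
  have D_sym: "inner (D x) y = inner x (D y)" for x y
    by (simp add: D_def inner_diff_left inner_diff_right B_sym)
  have De: "D e = (1 - c / m\<^sup>2) *\<^sub>R e" if "B e = (- 1 / m) *\<^sub>R e"
    by (simp add: D_def that B.scaleR B.neg power2_eq_square algebra_simps)
  have "gen e 0" unfolding gen_def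
    by (rule Lim_transform_eventually[OF tendsto_const])
       (use ev_pos in \<open>eventually_elim, simp add: e_fixed\<close>)
  then have "gen ((- 1 / m) *\<^sub>R e) 0"
    using gen_combination[of e 0 e 0 "- 1 / m" 0] by simp
  then have Be: "B e = (- 1 / m) *\<^sub>R e"
    using m by (intro B_eq[of _ 0]) auto
  have Dn_e: "inner ((D ^^ n) v) e = 0" for n
  proof (induction n)
    case (Suc n)
    then show ?case by (simp add: D_sym De[OF Be])
  qed (simp add: orth)
  have range: "\<exists>k. v - (D ^^ n) v = B (B k)" for n
  proof (induction n)
    case 0
    show ?case by (auto intro: exI[of _ 0])
  next
    case (Suc n)
    then obtain k where k: "v - (D ^^ n) v = B (B k)" by blast
    have "v - (D ^^ Suc n) v = B (B (k + c *\<^sub>R (D ^^ n) v))"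
      using k by (simp add: D_def B.add B.scaleR algebra_simps)
    then show ?case by blast
  qed
  have approx: "norm (T t (v - (D ^^ n) v)) \<le> exp (- \<epsilon> * t) * norm (v - (D ^^ n) v)" for n
  proof -
    obtain k where k: "v - (D ^^ n) v = B (B k)" using range by blast
    have "inner (v - (D ^^ n) v) e = 0" by (simp add: inner_diff_left orth Dn_e)
    from decay[OF k this] obtain K where "\<And>t. 1 \<le> t \<Longrightarrow> norm (T t (v - (D ^^ n) v)) \<le> K * exp (- \<epsilon> * t)"
      by blast
    then show ?thesis by (rule orbit_decay_constant_free[OF t])
  qed
  interpret Tt: bounded_linear "T t" by (rule bounded_linear_T) fact
  have lim: "(\<lambda>n. v - (D ^^ n) v) \<longlonglongrightarrow> v"
    using tendsto_diff[OF tendsto_const[of v] D_lim] by simp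
  show ?thesis
  proof (rule LIMSEQ_le)
    show "(\<lambda>n. norm (T t (v - (D ^^ n) v))) \<longlonglongrightarrow> norm (T t v)"
      by (intro tendsto_norm Tt.tendsto lim)
    show "(\<lambda>n. exp (- \<epsilon> * t) * norm (v - (D ^^ n) v)) \<longlonglongrightarrow> exp (- \<epsilon> * t) * norm v"
      by (intro tendsto_intros lim)
    show "\<exists>N. \<forall>n\<ge>N. norm (T t (v - (D ^^ n) v)) \<le> exp (- \<epsilon> * t) * norm (v - (D ^^ n) v)"
      using approx by blast
  qed
qed

end

section \<open>The Hilbert space of square-integrable functions\<close>

lemma L2_funD: "L2_fun g \<Longrightarrow> g \<in> borel_measurable borel" "L2_fun g \<Longrightarrow> integrable lborel (\<lambda>x. (g x)\<^sup>2)"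
  by (auto simp: L2_fun_def)

lemma L2_fun_mult_integrable:
  assumes "L2_fun g" "L2_fun h"
  shows "integrable lborel (\<lambda>x. g x * h x)"
proof (rule Bochner_Integration.integrable_bound)
  show "integrable lborel (\<lambda>x. (g x)\<^sup>2 + (h x)\<^sup>2)"
    using assms by (auto simp: L2_fun_def)
  show "(\<lambda>x. g x * h x) \<in> borel_measurable lborel"
    using assms by (auto simp: L2_fun_def)
  show "AE x in lborel. norm (g x * h x) \<le> norm ((g x)\<^sup>2 + (h x)\<^sup>2)"
  proof (intro AE_I2)
    fix x
    have "2 * (\<bar>g x\<bar> * \<bar>h x\<bar>) \<le> (g x)\<^sup>2 + (h x)\<^sup>2"
      using sum_squares_bound[of "\<bar>g x\<bar>" "\<bar>h x\<bar>"] by simp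
    moreover have "0 \<le> \<bar>g x\<bar> * \<bar>h x\<bar>" by simp
    ultimately show "norm (g x * h x) \<le> norm ((g x)\<^sup>2 + (h x)\<^sup>2)"
      unfolding real_norm_def abs_mult by linarith
  qed
qed

lemma L2_fun_combination:
  assumes "L2_fun g" "L2_fun h"
  shows "L2_fun (\<lambda>x. a * g x + b * h x)"
proof -
  have "integrable lborel (\<lambda>x. a\<^sup>2 * (g x)\<^sup>2 + 2 * a * b * (g x * h x) + b\<^sup>2 * (h x)\<^sup>2)"
    using assms L2_fun_mult_integrable[OF assms] by (auto simp: L2_fun_def)
  then have "integrable lborel (\<lambda>x. (a * g x + b * h x)\<^sup>2)"
    by (simp add: power2_eq_square algebra_simps)
  then show ?thesis using assms by (auto simp: L2_fun_def)
qed

lemma L2_fun_add: "L2_fun g \<Longrightarrow> L2_fun h \<Longrightarrow> L2_fun (\<lambda>x. g x + h x)"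
  using L2_fun_combination[of g h 1 1] by simp

lemma L2_fun_diff: "L2_fun g \<Longrightarrow> L2_fun h \<Longrightarrow> L2_fun (\<lambda>x. g x - h x)"
  using L2_fun_combination[of g h 1 "-1"] by simp

lemma L2_fun_cmult: "L2_fun g \<Longrightarrow> L2_fun (\<lambda>x. c * g x)"
  using L2_fun_combination[of g g c 0] by simp

lemma L2_fun_zero: "L2_fun (\<lambda>x. 0)"
  by (simp add: L2_fun_def)

text \<open>Only square-integrable functions have a class, so the underlying relation is a partial
  equivalence.\<close>

quotient_type (overloaded) 'a L2 = "'a::euclidean_space \<Rightarrow> real" / partial: "\<lambda>g h. L2_fun g \<and> L2_fun h \<and> (AE x in lborel. g x = h x)"
  morphisms rep_L2 abs_L2
proof (rule part_equivpI)
  show "\<exists>g::'a \<Rightarrow> real. L2_fun g \<and> L2_fun g \<and> (AE x in lborel. g x = g x)"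
    using L2_fun_zero by auto
  show "symp (\<lambda>g h::'a \<Rightarrow> real. L2_fun g \<and> L2_fun h \<and> (AE x in lborel. g x = h x))"
    by (auto intro!: sympI elim: AE_mp)
  show "transp (\<lambda>g h::'a \<Rightarrow> real. L2_fun g \<and> L2_fun h \<and> (AE x in lborel. g x = h x))"
  proof (rule transpI, elim conjE, intro conjI)
    fix f g h :: "'a \<Rightarrow> real"
    assume "AE x in lborel. f x = g x" "AE x in lborel. g x = h x"
    then show "AE x in lborel. f x = h x" by eventually_elim simp
  qed
qed

instantiation L2 :: (euclidean_space) real_inner
begin

lift_definition zero_L2 :: "'a L2" is "\<lambda>x. 0" by (simp add: L2_fun_zero)

lift_definition plus_L2 :: "'a L2 \<Rightarrow> 'a L2 \<Rightarrow> 'a L2" is "\<lambda>g h x. g x + h x"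
proof (elim conjE, intro conjI)
  fix f g h k :: "'a \<Rightarrow> real"
  assume "AE x in lborel. f x = g x" "AE x in lborel. h x = k x"
  then show "AE x in lborel. f x + h x = g x + k x" by eventually_elim simp
qed (auto intro: L2_fun_add)

lift_definition minus_L2 :: "'a L2 \<Rightarrow> 'a L2 \<Rightarrow> 'a L2" is "\<lambda>g h x. g x - h x"
proof (elim conjE, intro conjI)
  fix f g h k :: "'a \<Rightarrow> real"
  assume "AE x in lborel. f x = g x" "AE x in lborel. h x = k x"
  then show "AE x in lborel. f x - h x = g x - k x" by eventually_elim simp
qed (auto intro: L2_fun_diff)

lift_definition scaleR_L2 :: "real \<Rightarrow> 'a L2 \<Rightarrow> 'a L2" is "\<lambda>c g x. c * g x"
  by (auto intro: L2_fun_cmult)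

definition uminus_L2 :: "'a L2 \<Rightarrow> 'a L2" where "uminus_L2 g = (-1) *\<^sub>R g"

lift_definition inner_L2 :: "'a L2 \<Rightarrow> 'a L2 \<Rightarrow> real" is "\<lambda>g h. (\<integral>x. g x * h x \<partial>lborel)"
proof (elim conjE)
  fix f g h k :: "'a \<Rightarrow> real"
  assume "L2_fun f" "L2_fun g" "L2_fun h" "L2_fun k"
  assume "AE x in lborel. f x = g x" "AE x in lborel. h x = k x"
  then have "AE x in lborel. f x * h x = g x * k x" by eventually_elim simp
  then show "(\<integral>x. f x * h x \<partial>lborel) = (\<integral>x. g x * k x \<partial>lborel)"
    using \<open>L2_fun f\<close> \<open>L2_fun g\<close> \<open>L2_fun h\<close> \<open>L2_fun k\<close>
    by (intro integral_cong_AE) (auto dest!: L2_funD(1))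
qed

definition norm_L2 :: "'a L2 \<Rightarrow> real" where "norm_L2 g = sqrt (inner g g)"
definition dist_L2 :: "'a L2 \<Rightarrow> 'a L2 \<Rightarrow> real" where "dist_L2 g h = norm (g - h)"
definition sgn_L2 :: "'a L2 \<Rightarrow> 'a L2" where "sgn_L2 g = inverse (norm g) *\<^sub>R g"
definition uniformity_L2 :: "('a L2 \<times> 'a L2) filter" where
  "uniformity_L2 = (INF e\<in>{0<..}. principal {(x, y). dist x y < e})"
definition open_L2 :: "'a L2 set \<Rightarrow> bool" where
  "open_L2 U \<longleftrightarrow> (\<forall>x\<in>U. \<forall>\<^sub>F (x', y) in uniformity. x' = x \<longrightarrow> y \<in> U)"

instance
proof
  fix x y z :: "'a L2" and a b r :: real and U
  show "dist x y = norm (x - y)" by (rule dist_L2_def)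
  show "x + y + z = x + (y + z)" by transfer (auto intro!: L2_fun_add simp: add.assoc)
  show "x + y = y + x" by transfer (auto intro!: L2_fun_add simp: add.commute)
  show "0 + x = x" by transfer simp
  show "- x + x = 0" unfolding uminus_L2_def
    by transfer (auto intro!: L2_fun_add L2_fun_cmult L2_fun_zero)
  show "x - y = x + - y" unfolding uminus_L2_def
    by transfer (auto intro!: L2_fun_add L2_fun_diff L2_fun_combination)
  show "r *\<^sub>R (x + y) = r *\<^sub>R x + r *\<^sub>R y"
    by transfer (auto intro!: L2_fun_add L2_fun_cmult simp: algebra_simps)
  show "(a + b) *\<^sub>R x = a *\<^sub>R x + b *\<^sub>R x"
    by transfer (auto intro!: L2_fun_add L2_fun_cmult simp: algebra_simps)
  show "a *\<^sub>R b *\<^sub>R x = (a * b) *\<^sub>R x"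
    by transfer (auto intro!: L2_fun_add L2_fun_cmult simp: algebra_simps)
  show "1 *\<^sub>R x = x" by transfer simp
  show "sgn x = inverse (norm x) *\<^sub>R x" by (rule sgn_L2_def)
  show "uniformity = (INF e\<in>{0<..}. principal {(x::'a L2, y). dist x y < e})" by (rule uniformity_L2_def)
  show "open U \<longleftrightarrow> (\<forall>x\<in>U. \<forall>\<^sub>F (x'::'a L2, y) in uniformity. x' = x \<longrightarrow> y \<in> U)" by (rule open_L2_def)
  show "inner x y = inner y x" by transfer (simp add: mult.commute)
  show "inner (x + y) z = inner x z + inner y z"
    by transfer (auto simp: algebra_simps intro!: Bochner_Integration.integral_add L2_fun_mult_integrable)
  show "inner (r *\<^sub>R x) y = r * inner x y"
    by transfer (simp add: mult.assoc)
  show "0 \<le> inner x x" by transfer simp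
  show "inner x x = 0 \<longleftrightarrow> x = 0"
  proof transfer
    fix g :: "'a \<Rightarrow> real" assume g: "L2_fun g \<and> L2_fun g \<and> (AE x in lborel. g x = g x)"
    then have "(\<integral>x. g x * g x \<partial>lborel) = 0 \<longleftrightarrow> (AE x in lborel. g x * g x = 0)"
      by (intro integral_nonneg_eq_0_iff_AE) (auto intro: L2_fun_mult_integrable)
    then show "(\<integral>x. g x * g x \<partial>lborel) = 0 \<longleftrightarrow> L2_fun g \<and> L2_fun (\<lambda>x::'a. 0::real) \<and> (AE x in lborel. g x = 0)"
      using g L2_fun_zero[where 'a = 'a] by simp
  qed
  show "norm x = sqrt (inner x x)" by (rule norm_L2_def)
qed

end

lemma abs_L2_eq_iff: "L2_fun g \<Longrightarrow> L2_fun h \<Longrightarrow> abs_L2 g = abs_L2 h \<longleftrightarrow> (AE x in lborel. g x = h x)"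
  using Quotient3_rel[OF Quotient3_L2, of g h] by auto

lemma abs_rep_L2 [simp]: "abs_L2 (rep_L2 u) = u"
  by (rule Quotient3_abs_rep[OF Quotient3_L2])

lemma L2_fun_rep [simp]: "L2_fun (rep_L2 u)"
  using Quotient3_rep_reflp[OF Quotient3_L2, of u] by simp

lemma rep_abs_L2: "L2_fun g \<Longrightarrow> AE x in lborel. rep_L2 (abs_L2 g) x = g x"
  using abs_L2_eq_iff[of "rep_L2 (abs_L2 g)" g] by simp

lemma L2_cases: obtains g where "L2_fun g" "u = abs_L2 g"
  using L2_fun_rep abs_rep_L2 by metis

lemma inner_abs_L2: "L2_fun g \<Longrightarrow> L2_fun h \<Longrightarrow> inner (abs_L2 g) (abs_L2 h) = (\<integral>x. g x * h x \<partial>lborel)"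
  by (simp add: inner_L2.abs_eq)

lemma norm_abs_L2: "L2_fun g \<Longrightarrow> norm (abs_L2 g) = L2_norm g"
  by (simp add: norm_L2_def inner_abs_L2 L2_norm_def power2_eq_square)

lemma add_abs_L2: "L2_fun g \<Longrightarrow> L2_fun h \<Longrightarrow> abs_L2 g + abs_L2 h = abs_L2 (\<lambda>x. g x + h x)"
  by (simp add: plus_L2.abs_eq)

lemma diff_abs_L2: "L2_fun g \<Longrightarrow> L2_fun h \<Longrightarrow> abs_L2 g - abs_L2 h = abs_L2 (\<lambda>x. g x - h x)"
  by (simp add: minus_L2.abs_eq)

lemma scaleR_abs_L2: "L2_fun g \<Longrightarrow> c *\<^sub>R abs_L2 g = abs_L2 (\<lambda>x. c * g x)"
  by (simp add: scaleR_L2.abs_eq)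

lemma nn_integral_square_L2:
  assumes "L2_fun g"
  shows "(\<integral>\<^sup>+x. ennreal ((g x)\<^sup>2) \<partial>lborel) = ennreal ((norm (abs_L2 g))\<^sup>2)"
  using assms
  by (simp add: norm_abs_L2 L2_norm_def nn_integral_eq_integral L2_fun_def)

lemma L2_fun_iff_nn_integral:
  "L2_fun g \<longleftrightarrow> g \<in> borel_measurable borel \<and> (\<integral>\<^sup>+x. ennreal ((g x)\<^sup>2) \<partial>lborel) < \<infinity>"
  by (auto simp: L2_fun_def integrable_iff_bounded)

lemma Cauchy_fast_subseq:
  fixes X :: "nat \<Rightarrow> 'a::metric_space"
  assumes "Cauchy X" "\<And>n. 0 < e n"
  obtains r where "strict_mono r" "\<And>n. dist (X (r n)) (X (r (Suc n))) < e n"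
proof -
  have "\<exists>M. \<forall>i\<ge>M. \<forall>j\<ge>M. dist (X i) (X j) < e n" for n
    using metric_CauchyD[OF assms(1) assms(2)[of n]] by blast
  then obtain M where M: "\<And>n i j. M n \<le> i \<Longrightarrow> M n \<le> j \<Longrightarrow> dist (X i) (X j) < e n"
    by metis
  define r where "r = rec_nat (M 0) (\<lambda>n k. max (Suc k) (M (Suc n)))"
  have r0: "r 0 = M 0" and rS: "r (Suc n) = max (Suc (r n)) (M (Suc n))" for n
    by (auto simp: r_def)
  have "M n \<le> r n" for n by (cases n) (auto simp: r0 rS)
  moreover have sm: "strict_mono r" by (rule strict_monoI_Suc) (auto simp: rS)
  ultimately have "dist (X (r n)) (X (r (Suc n))) < e n" for n
    by (intro M) (auto simp: rS intro: order_trans[OF _ less_imp_le[OF lessI]] le_SucI max.coboundedI1)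
  with sm show ?thesis by (rule that)
qed

text \<open>The Riesz-Fischer argument. Along a fast subsequence the sum of \<open>2 ^ n * (g n - g (Suc n))\<^sup>2\<close>
  is integrable, hence finite almost everywhere, and \<open>\<bar>a\<bar> \<le> 1 / 2 ^ n + 2 ^ n * a\<^sup>2\<close> turns this
  into convergence of \<open>g n x\<close>. Fatou's lemma shows that the pointwise limit is the limit in norm.\<close>

instance L2 :: (euclidean_space) complete_space
proof
  fix U :: "nat \<Rightarrow> 'a L2" assume C: "Cauchy U"
  obtain r where r: "strict_mono r" "\<And>n. dist (U (r n)) (U (r (Suc n))) < (1 / 2) ^ n"
    by (rule Cauchy_fast_subseq[OF C, of "\<lambda>n. (1 / 2) ^ n"]) auto
  define g where "g n = rep_L2 (U (r n))" for n
  have gL [simp]: "L2_fun (g n)" for n by (simp add: g_def)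
  have [measurable]: "g n \<in> borel_measurable borel" for n using L2_funD(1)[OF gL] .
  have Ug: "U (r n) = abs_L2 (g n)" for n by (simp add: g_def)
  define q where "q n x = 2 ^ n * (g n x - g (Suc n) x)\<^sup>2" for n x
  have [measurable]: "q n \<in> borel_measurable borel" for n unfolding q_def by measurable
  have q0: "0 \<le> q n x" for n x by (simp add: q_def)
  have "(\<integral>\<^sup>+x. ennreal (q n x) \<partial>lborel) \<le> ennreal ((1 / 2) ^ n)" for n
  proof -
    have "(\<integral>\<^sup>+x. ennreal (q n x) \<partial>lborel) = ennreal (2 ^ n) * (\<integral>\<^sup>+x. ennreal ((g n x - g (Suc n) x)\<^sup>2) \<partial>lborel)"
      unfolding q_def by (subst nn_integral_cmult[symmetric]) (auto simp: ennreal_mult)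
    also have "\<dots> = ennreal (2 ^ n * (dist (U (r n)) (U (r (Suc n))))\<^sup>2)"
      by (subst nn_integral_square_L2[OF L2_fun_diff]) (auto simp: dist_L2_def Ug diff_abs_L2 ennreal_mult)
    also have "\<dots> \<le> ennreal (2 ^ n * ((1 / 2) ^ n)\<^sup>2)"
      using r(2)[of n] by (intro ennreal_leI mult_left_mono power_mono) auto
    also have "2 ^ n * ((1 / 2) ^ n)\<^sup>2 = ((1 / 2) ^ n :: real)"
      by (simp add: power2_eq_square power_mult_distrib[symmetric] mult.assoc[symmetric])
    finally show ?thesis .
  qed
  then have "(\<integral>\<^sup>+x. (\<Sum>n. ennreal (q n x)) \<partial>lborel) \<le> (\<Sum>n. ennreal ((1 / 2) ^ n))"
    by (subst nn_integral_suminf) (auto intro!: suminf_le)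
  also have "\<dots> = ennreal (\<Sum>n. (1 / 2) ^ n)"
    by (rule suminf_ennreal2) (auto intro: summable_geometric)
  finally have "(\<integral>\<^sup>+x. (\<Sum>n. ennreal (q n x)) \<partial>lborel) \<noteq> \<infinity>"
    by (auto simp: top_unique)
  then have "AE x in lborel. (\<Sum>n. ennreal (q n x)) \<noteq> \<infinity>"
    by (intro nn_integral_noteq_infinite) auto
  then have conv: "AE x in lborel. (\<lambda>n. g n x) \<longlonglongrightarrow> lim (\<lambda>n. g n x)"
  proof eventually_elim
    case (elim x)
    then have sq: "summable (\<lambda>n. q n x)"
      by (intro summable_suminf_not_top) (auto simp: q0 top_unique)
    have "summable (\<lambda>n. g n x - g (Suc n) x)"
    proof (rule summable_comparison_test)
      show "summable (\<lambda>n. (1 / 2) ^ n + q n x)"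
        by (intro summable_add sq summable_geometric) simp
      have "\<bar>a\<bar> \<le> (1 / 2) ^ n + 2 ^ n * a\<^sup>2" for a :: real and n
      proof -
        define p :: real where "p = 2 ^ n"
        have p: "0 < p" "(1 / 2) ^ n = 1 / p" by (simp_all add: p_def power_one_over)
        have "2 * (p * \<bar>a\<bar>) \<le> 1 + (p * \<bar>a\<bar>)\<^sup>2"
          using sum_squares_bound[of 1 "p * \<bar>a\<bar>"] by simp
        then have "2 * (p * \<bar>a\<bar>) / p \<le> (1 + (p * \<bar>a\<bar>)\<^sup>2) / p"
          using p by (intro divide_right_mono) auto
        then have "2 * \<bar>a\<bar> \<le> 1 / p + p * a\<^sup>2"
          using p(1) by (simp add: add_divide_distrib power_mult_distrib power2_eq_square[of p])
        then have "\<bar>a\<bar> \<le> 1 / p + p * a\<^sup>2" by linarith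
        then show ?thesis unfolding p(2) unfolding p_def .
      qed
      then show "\<exists>N. \<forall>n\<ge>N. norm (g n x - g (Suc n) x) \<le> (1 / 2) ^ n + q n x"
        by (auto simp: q_def)
    qed
    then have "convergent (\<lambda>n. \<Sum>k<n. g k x - g (Suc k) x)"
      by (simp add: summable_iff_convergent)
    then have "convergent (\<lambda>n. g 0 x - (\<Sum>k<n. g k x - g (Suc k) x))"
      by (intro convergent_diff convergent_const)
    then have "convergent (\<lambda>n. g n x)" by (subst (asm) sum_lessThan_telescope') simp
    then show ?case by (simp add: convergent_LIMSEQ_iff)
  qed
  define l where "l x = lim (\<lambda>n. g n x)" for x
  have [measurable]: "l \<in> borel_measurable borel" unfolding l_def by measurable
  have fatou: "(\<integral>\<^sup>+x. ennreal ((g n x - l x)\<^sup>2) \<partial>lborel) \<le> ennreal (e\<^sup>2)"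
    if N: "\<And>m. N \<le> m \<Longrightarrow> norm (U (r n) - U (r m)) \<le> e" for n e N
  proof -
    have "(\<integral>\<^sup>+x. ennreal ((g n x - l x)\<^sup>2) \<partial>lborel) = (\<integral>\<^sup>+x. liminf (\<lambda>m. ennreal ((g n x - g m x)\<^sup>2)) \<partial>lborel)"
    proof (rule nn_integral_cong_AE)
      show "AE x in lborel. ennreal ((g n x - l x)\<^sup>2) = liminf (\<lambda>m. ennreal ((g n x - g m x)\<^sup>2))"
        using conv
      proof eventually_elim
        case (elim x)
        then have "(\<lambda>m. ennreal ((g n x - g m x)\<^sup>2)) \<longlonglongrightarrow> ennreal ((g n x - l x)\<^sup>2)"
          unfolding l_def by (intro tendsto_intros)
        from lim_imp_Liminf[OF sequentially_bot this] show ?case by (rule sym)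
      qed
    qed
    also have "\<dots> \<le> liminf (\<lambda>m. \<integral>\<^sup>+x. ennreal ((g n x - g m x)\<^sup>2) \<partial>lborel)"
      by (intro nn_integral_liminf) auto
    also have "\<dots> \<le> limsup (\<lambda>m. \<integral>\<^sup>+x. ennreal ((g n x - g m x)\<^sup>2) \<partial>lborel)"
      by (rule Liminf_le_Limsup) simp
    also have "\<dots> \<le> ennreal (e\<^sup>2)"
    proof (rule Limsup_bounded)
      show "\<forall>\<^sub>F m in sequentially. (\<integral>\<^sup>+x. ennreal ((g n x - g m x)\<^sup>2) \<partial>lborel) \<le> ennreal (e\<^sup>2)"
        using eventually_ge_at_top[of N]
      proof eventually_elim
        case (elim m)
        have "(\<integral>\<^sup>+x. ennreal ((g n x - g m x)\<^sup>2) \<partial>lborel) = ennreal ((norm (U (r n) - U (r m)))\<^sup>2)"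
          by (subst nn_integral_square_L2[OF L2_fun_diff]) (auto simp: Ug diff_abs_L2)
        also have "\<dots> \<le> ennreal (e\<^sup>2)"
          using N[OF elim] by (intro ennreal_leI power_mono) auto
        finally show ?case .
      qed
    qed
    finally show ?thesis .
  qed
  have sub: "Cauchy (\<lambda>n. U (r n))" using Cauchy_subseq_Cauchy[OF C r(1)] by (simp add: o_def)
  obtain N1 where N1: "\<And>m. N1 \<le> m \<Longrightarrow> norm (U (r N1) - U (r m)) \<le> 1"
  proof -
    obtain M where "\<forall>m\<ge>M. \<forall>n\<ge>M. dist (U (r m)) (U (r n)) < 1"
      using metric_CauchyD[OF sub, of 1] by auto
    then show ?thesis by (intro that[of M]) (auto simp: dist_L2_def intro: less_imp_le)
  qed
  have "L2_fun (\<lambda>x. g N1 x - l x)"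
    using fatou[of N1 N1 1] N1 by (auto simp: L2_fun_iff_nn_integral intro: le_less_trans)
  from L2_fun_diff[OF gL[of N1] this] have lL: "L2_fun l" by simp
  have "(\<lambda>n. U (r n)) \<longlonglongrightarrow> abs_L2 l"
  proof (rule LIMSEQ_I)
    fix e :: real assume e: "0 < e"
    obtain N where N: "\<And>n m. N \<le> n \<Longrightarrow> N \<le> m \<Longrightarrow> norm (U (r n) - U (r m)) < e / 2"
      using metric_CauchyD[OF sub, of "e / 2"] e by (auto simp: dist_L2_def)
    have "norm (U (r n) - abs_L2 l) < e" if "N \<le> n" for n
    proof -
      have "ennreal ((norm (U (r n) - abs_L2 l))\<^sup>2) = (\<integral>\<^sup>+x. ennreal ((g n x - l x)\<^sup>2) \<partial>lborel)"
        using lL by (subst nn_integral_square_L2[OF L2_fun_diff]) (auto simp: Ug diff_abs_L2)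
      also have "\<dots> \<le> ennreal ((e / 2)\<^sup>2)"
        using N[OF that] by (intro fatou[of N]) (auto intro: less_imp_le)
      finally have "ennreal ((norm (U (r n) - abs_L2 l))\<^sup>2) \<le> ennreal ((e / 2)\<^sup>2)" .
      then have "norm (U (r n) - abs_L2 l) \<le> e / 2"
        using e by (simp add: abs_le_square_iff[symmetric])
      then show ?thesis using e by simp
    qed
    then show "\<exists>N. \<forall>n\<ge>N. norm (U (r n) - abs_L2 l) < e" by blast
  qed
  then have "U \<longlonglongrightarrow> abs_L2 l"
    using C r(1) Cauchy_converges_subseq[of U r] by (simp add: o_def)
  then show "convergent U" by (rule convergentI)
qed

section \<open>Uniqueness of characteristic functions in Euclidean spaces\<close>

definition gauss :: "'a::euclidean_space measure" where
  "gauss = distr (\<Pi>\<^sub>M b\<in>(Basis::'a set). std_normal_distribution) borel (\<lambda>f. \<Sum>b\<in>Basis. f b *\<^sub>R b)"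

interpretation std_normal_prod: product_prob_space "\<lambda>_. std_normal_distribution" I for I
  by (intro product_prob_spaceI prob_space_normal_density) simp

lemma sets_gauss [measurable_cong, simp]: "sets gauss = sets borel"
  by (simp add: gauss_def)

lemma measurable_basis_sum [measurable]:
  "(\<lambda>f. \<Sum>b\<in>(Basis::'a::euclidean_space set). f b *\<^sub>R b) \<in> borel_measurable (\<Pi>\<^sub>M b\<in>(Basis::'a set). std_normal_distribution)"
  by measurable

lemma prob_space_gauss: "prob_space (gauss :: 'a::euclidean_space measure)"
  unfolding gauss_def
  by (intro prob_space.prob_space_distr prob_space_PiM prob_space_normal_density measurable_basis_sum) simp

lemma gauss_characteristic:
  fixes x :: "'a::euclidean_space"
  shows "(\<integral>z. exp (\<i> * complex_of_real (inner z x)) \<partial>gauss) = complex_of_real (exp (- (norm x)\<^sup>2 / 2))"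
proof -
  have "(\<integral>z. exp (\<i> * complex_of_real (inner z x)) \<partial>gauss) =
      (\<integral>f. exp (\<i> * complex_of_real (inner (\<Sum>b\<in>Basis. f b *\<^sub>R b) x)) \<partial>(\<Pi>\<^sub>M b\<in>(Basis::'a set). std_normal_distribution))"
    unfolding gauss_def by (subst integral_distr) (auto intro!: measurable_basis_sum)
  also have "\<dots> = (\<integral>f. (\<Prod>b\<in>Basis. iexp ((inner b x) * f b)) \<partial>(\<Pi>\<^sub>M b\<in>(Basis::'a set). std_normal_distribution))"
    by (simp add: inner_sum_left exp_sum[symmetric] sum_distrib_left mult.commute mult.left_commute)
  also have "\<dots> = (\<Prod>b\<in>Basis. (\<integral>s. iexp ((inner b x) * s) \<partial>std_normal_distribution))"
  proof (rule std_normal_prod.product_integral_prod)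
    fix b :: 'a
    have "finite_measure std_normal_distribution"
      by (intro prob_space.finite_measure prob_space_normal_density) simp
    then show "integrable std_normal_distribution (\<lambda>s. iexp ((inner b x) * s))"
      by (rule finite_measure.integrable_const_bound[of _ _ 1]) auto
  qed simp
  also have "\<dots> = (\<Prod>b\<in>Basis. complex_of_real (exp (- ((inner b x)^2) / 2)))"
    using char_std_normal_distribution unfolding char_def fun_eq_iff by simp
  also have "\<dots> = complex_of_real (exp (\<Sum>b\<in>Basis. - ((inner b x)^2) / 2))"
    by (simp add: exp_sum)
  also have "(\<Sum>b\<in>Basis. - ((inner b x)^2) / 2) = - (norm x)\<^sup>2 / 2"
    unfolding power2_norm_eq_inner euclidean_inner[of x x]
    by (simp add: sum_negf sum_divide_distrib power2_eq_square inner_commute)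
  finally show ?thesis .
qed

text \<open>A Gaussian function is itself a superposition of characters with a Gaussian weight.
  Integrating it against \<open>M\<close> and exchanging the integrals leaves only the characteristic function
  of \<open>M\<close>.\<close>

lemma gauss_average_determined:
  fixes M1 M2 :: "'a::euclidean_space measure"
  assumes "prob_space M1" "prob_space M2" and [measurable_cong]: "sets M1 = sets borel" "sets M2 = sets borel"
    and char: "\<And>\<xi>. (\<integral>x. exp (\<i> * complex_of_real (inner \<xi> x)) \<partial>M1) = (\<integral>x. exp (\<i> * complex_of_real (inner \<xi> x)) \<partial>M2)"
  shows "(\<integral>x. exp (- (norm (s *\<^sub>R (x - y)))\<^sup>2 / 2) \<partial>M1) = (\<integral>x. exp (- (norm (s *\<^sub>R (x - y)))\<^sup>2 / 2) \<partial>M2)"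
proof -
  have key: "complex_of_real (\<integral>x. exp (- (norm (s *\<^sub>R (x - y)))\<^sup>2 / 2) \<partial>M) =
      (\<integral>z. exp (- \<i> * complex_of_real (inner (s *\<^sub>R z) y)) * (\<integral>x. exp (\<i> * complex_of_real (inner (s *\<^sub>R z) x)) \<partial>M) \<partial>gauss)"
    if "prob_space M" and [measurable_cong]: "sets M = sets borel" for M :: "'a measure"
  proof -
    interpret M: prob_space M by fact
    interpret g: prob_space "gauss :: 'a measure" by (rule prob_space_gauss)
    interpret P: pair_prob_space M "gauss :: 'a measure" ..
    have int: "integrable (M \<Otimes>\<^sub>M gauss) (\<lambda>(x, z). exp (\<i> * complex_of_real (inner z (s *\<^sub>R (x - y)))))"
      by (rule P.integrable_const_bound[of _ 1]) (auto simp: split_beta')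
    have "complex_of_real (\<integral>x. exp (- (norm (s *\<^sub>R (x - y)))\<^sup>2 / 2) \<partial>M) =
        (\<integral>x. complex_of_real (exp (- (norm (s *\<^sub>R (x - y)))\<^sup>2 / 2)) \<partial>M)"
      by simp
    also have "\<dots> = (\<integral>x. (\<integral>z. exp (\<i> * complex_of_real (inner z (s *\<^sub>R (x - y)))) \<partial>gauss) \<partial>M)"
      unfolding gauss_characteristic ..
    also have "\<dots> = (\<integral>z. (\<integral>x. exp (\<i> * complex_of_real (inner z (s *\<^sub>R (x - y)))) \<partial>M) \<partial>gauss)"
      using P.Fubini_integral[OF int] by simp
    also have "\<dots> = (\<integral>z. (\<integral>x. exp (- \<i> * complex_of_real (inner (s *\<^sub>R z) y)) * exp (\<i> * complex_of_real (inner (s *\<^sub>R z) x)) \<partial>M) \<partial>gauss)"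
      by (simp add: inner_diff_right mult_exp_exp algebra_simps)
    finally show ?thesis by simp
  qed
  have "complex_of_real (\<integral>x. exp (- (norm (s *\<^sub>R (x - y)))\<^sup>2 / 2) \<partial>M1) =
        complex_of_real (\<integral>x. exp (- (norm (s *\<^sub>R (x - y)))\<^sup>2 / 2) \<partial>M2)"
    unfolding key[OF assms(1,3)] key[OF assms(2,4)] char ..
  then show ?thesis by simp
qed

definition gauss_kernel :: "'a::euclidean_space \<Rightarrow> ennreal" where
  "gauss_kernel u = (\<Prod>b\<in>Basis. ennreal (std_normal_density (inner u b)))"

lemma gauss_kernel_measurable [measurable]: "gauss_kernel \<in> borel_measurable borel"
  unfolding gauss_kernel_def by measurable

lemma nn_integral_gauss_kernel: "(\<integral>\<^sup>+u. gauss_kernel u \<partial>(lborel::'a::euclidean_space measure)) = 1"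
proof -
  have "(\<integral>\<^sup>+x. ennreal (std_normal_density x) \<partial>lborel) = 1"
    using prob_space.emeasure_space_1[OF prob_space_normal_density[of 1 0]]
    by (simp add: emeasure_density)
  then show ?thesis
    unfolding gauss_kernel_def by (subst nn_integral_lborel_prod) auto
qed

lemma gauss_kernel_eq:
  "gauss_kernel (u::'a::euclidean_space) = ennreal ((1 / sqrt (2 * pi)) ^ DIM('a)) * ennreal (exp (- (norm u)\<^sup>2 / 2))"
proof -
  have "gauss_kernel u = ennreal (\<Prod>b\<in>Basis. (1 / sqrt (2 * pi)) * exp (- (inner u b)\<^sup>2 / 2))"
    unfolding gauss_kernel_def by (subst prod_ennreal) (auto simp: std_normal_density_def)
  also have "(\<Prod>b\<in>Basis. (1 / sqrt (2 * pi)) * exp (- (inner u b)\<^sup>2 / 2)) =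
      (1 / sqrt (2 * pi)) ^ DIM('a) * exp (\<Sum>b\<in>Basis. - (inner u b)\<^sup>2 / 2)"
    by (simp add: prod_dividef power_divide exp_sum)
  also have "(\<Sum>b\<in>Basis. - (inner u b)\<^sup>2 / 2) = - (norm u)\<^sup>2 / 2"
    unfolding power2_norm_eq_inner euclidean_inner[of u u]
    by (simp add: sum_negf sum_divide_distrib power2_eq_square)
  finally show ?thesis by (simp add: ennreal_mult)
qed

text \<open>Smoothing with a small independent Gaussian vector turns the integral of \<open>F\<close> into an
  integral of Gaussian averages of the measure, which the characteristic function determines. When
  the Gaussian shrinks, the smoothed integrals of a bounded continuous function converge to the
  integral itself, and truncated multiples of the distance to the complement approximate the
  indicator of an open set.\<close>

theorem characteristic_function_unique:
  fixes M1 M2 :: "'a::euclidean_space measure"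
  assumes P1: "prob_space M1" and P2: "prob_space M2"
    and S1: "sets M1 = sets borel" and S2: "sets M2 = sets borel"
    and char: "\<And>\<xi>. (\<integral>x. exp (\<i> * complex_of_real (inner \<xi> x)) \<partial>M1) = (\<integral>x. exp (\<i> * complex_of_real (inner \<xi> x)) \<partial>M2)"
  shows "M1 = M2"
proof -
  note [measurable_cong] = S1 S2
  \<comment> \<open>The expectation of \<open>F (x + u / (n + 1))\<close> for \<open>x\<close> with law \<open>M\<close> and an independent standard
    Gaussian \<open>u\<close>.\<close>
  define sm where "sm M F n = (\<integral>\<^sup>+x. (\<integral>\<^sup>+u. F (x + u /\<^sub>R real (Suc n)) * gauss_kernel u \<partial>lborel) \<partial>M)"
    for M and F :: "'a \<Rightarrow> ennreal" and n
  have smooth: "sm M F n = (\<integral>\<^sup>+y. ennreal (real (Suc n) ^ DIM('a)) * ennreal ((1 / sqrt (2 * pi)) ^ DIM('a)) * F y *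
       ennreal (\<integral>x. exp (- (norm (real (Suc n) *\<^sub>R (x - y)))\<^sup>2 / 2) \<partial>M) \<partial>lborel)"
    if M: "prob_space M" "sets M = sets borel" and [measurable]: "F \<in> borel_measurable borel" for M F n
  proof -
    note [measurable_cong] = M(2)
    interpret M: prob_space M by fact
    interpret pair_sigma_finite M lborel ..
    define s where "s = real (Suc n)"
    have s: "0 < s" "s \<noteq> 0" by (simp_all add: s_def)
    have "(\<integral>\<^sup>+u. F (x + u /\<^sub>R s) * gauss_kernel u \<partial>lborel) =
        (\<integral>\<^sup>+y. ennreal (s ^ DIM('a)) * (F y * gauss_kernel (s *\<^sub>R (x - y))) \<partial>lborel)" for x
    proof -
      have sym: "gauss_kernel (- u) = gauss_kernel u" for u :: 'a by (simp add: gauss_kernel_eq)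
      have "(\<integral>\<^sup>+u. F (x + u /\<^sub>R s) * gauss_kernel u \<partial>lborel) =
        (\<integral>\<^sup>+y. ennreal (s ^ DIM('a)) * (F y * gauss_kernel ((- s *\<^sub>R x) + s *\<^sub>R y)) \<partial>lborel)"
        using s
        by (subst lborel_affine[of s "- s *\<^sub>R x"])
           (auto simp: nn_integral_density nn_integral_distr scaleR_add_right scaleR_diff_right)
      also have "\<dots> = (\<integral>\<^sup>+y. ennreal (s ^ DIM('a)) * (F y * gauss_kernel (s *\<^sub>R (x - y))) \<partial>lborel)"
        using sym[of "s *\<^sub>R (x - _)"] by (simp add: algebra_simps)
      finally show ?thesis .
    qed
    then have "sm M F n = (\<integral>\<^sup>+x. (\<integral>\<^sup>+y. ennreal (s ^ DIM('a)) * (F y * gauss_kernel (s *\<^sub>R (x - y))) \<partial>lborel) \<partial>M)"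
      by (simp add: sm_def s_def)
    also have "\<dots> = (\<integral>\<^sup>+y. (\<integral>\<^sup>+x. ennreal (s ^ DIM('a)) * (F y * gauss_kernel (s *\<^sub>R (x - y))) \<partial>M) \<partial>lborel)"
      by (intro Fubini'[symmetric]) (simp add: split_beta')
    also have "\<dots> = (\<integral>\<^sup>+y. (\<integral>\<^sup>+x. (ennreal (s ^ DIM('a)) * ennreal ((1 / sqrt (2 * pi)) ^ DIM('a)) * F y) *
         ennreal (exp (- (norm (s *\<^sub>R (x - y)))\<^sup>2 / 2)) \<partial>M) \<partial>lborel)"
      unfolding gauss_kernel_eq by (simp add: ac_simps)
    also have "\<dots> = (\<integral>\<^sup>+y. (ennreal (s ^ DIM('a)) * ennreal ((1 / sqrt (2 * pi)) ^ DIM('a)) * F y) *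
         (\<integral>\<^sup>+x. ennreal (exp (- (norm (s *\<^sub>R (x - y)))\<^sup>2 / 2)) \<partial>M) \<partial>lborel)"
      by (intro nn_integral_cong nn_integral_cmult) auto
    also have "\<dots> = (\<integral>\<^sup>+y. (ennreal (s ^ DIM('a)) * ennreal ((1 / sqrt (2 * pi)) ^ DIM('a)) * F y) *
         ennreal (\<integral>x. exp (- (norm (s *\<^sub>R (x - y)))\<^sup>2 / 2) \<partial>M) \<partial>lborel)"
    proof -
      have "(\<integral>\<^sup>+x. ennreal (exp (- (norm (s *\<^sub>R (x - y)))\<^sup>2 / 2)) \<partial>M) =
         ennreal (\<integral>x. exp (- (norm (s *\<^sub>R (x - y)))\<^sup>2 / 2) \<partial>M)" for y
        by (intro nn_integral_eq_integral M.integrable_const_bound[of _ 1]) auto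
      then show ?thesis by simp
    qed
    finally show ?thesis by (simp add: s_def)
  qed
  have sm_eq: "sm M1 F n = sm M2 F n" if "F \<in> borel_measurable borel" for F n
    using smooth[OF P1 S1 that] smooth[OF P2 S2 that]
    by (simp only: gauss_average_determined[OF P1 P2 S1 S2 char])
  have lim: "(\<lambda>n. sm M (\<lambda>x. ennreal (F x)) n) \<longlonglongrightarrow> (\<integral>\<^sup>+x. ennreal (F x) \<partial>M)"
    if M: "prob_space M" "sets M = sets borel" and F: "continuous_on UNIV F" "\<And>x. F x \<le> 1" for M and F :: "'a \<Rightarrow> real"
  proof -
    note [measurable_cong] = M(2)
    interpret M: prob_space M by fact
    have [measurable]: "F \<in> borel_measurable borel" by (rule borel_measurable_continuous_onI) fact
    have inner: "(\<lambda>n. \<integral>\<^sup>+u. ennreal (F (x + u /\<^sub>R real (Suc n))) * gauss_kernel u \<partial>lborel) \<longlonglongrightarrow>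
       (\<integral>\<^sup>+u. ennreal (F x) * gauss_kernel u \<partial>(lborel::'a measure))" for x
    proof (rule nn_integral_dominated_convergence[where w = "gauss_kernel :: 'a \<Rightarrow> ennreal"])
      show "AE u in lborel. ennreal (F (x + u /\<^sub>R real (Suc n))) * gauss_kernel u \<le> gauss_kernel u" for n
        using F(2) mult_right_mono[of "ennreal (F _)" 1 "gauss_kernel _"] by (intro AE_I2) (simp add: ennreal_le_1)
      show "(\<integral>\<^sup>+u. gauss_kernel u \<partial>lborel) < \<infinity>" by (simp add: nn_integral_gauss_kernel)
      have "(\<lambda>n. x + u /\<^sub>R real (Suc n)) \<longlonglongrightarrow> x + 0 *\<^sub>R u" for u
        using LIMSEQ_inverse_real_of_nat by (intro tendsto_intros)
      then have "(\<lambda>n. F (x + u /\<^sub>R real (Suc n))) \<longlonglongrightarrow> F x" for u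
        using F(1) by (intro isCont_tendsto_compose[of x F]) (auto simp: continuous_on_eq_continuous_at)
      then show "AE u in lborel. (\<lambda>n. ennreal (F (x + u /\<^sub>R real (Suc n))) * gauss_kernel u) \<longlonglongrightarrow> ennreal (F x) * gauss_kernel u"
        unfolding mult.commute[of _ "gauss_kernel _"]
        by (intro AE_I2 ennreal_tendsto_cmult tendsto_ennrealI) (auto simp: gauss_kernel_eq ennreal_mult_less_top)
    qed auto
    have one: "(\<integral>\<^sup>+u. ennreal (F x) * gauss_kernel u \<partial>(lborel::'a measure)) = ennreal (F x)" for x
      by (subst nn_integral_cmult) (auto simp: nn_integral_gauss_kernel)
    show ?thesis unfolding sm_def
    proof (rule nn_integral_dominated_convergence[where w = "\<lambda>_. 1"])
      show "AE x in M. (\<integral>\<^sup>+u. ennreal (F (x + u /\<^sub>R real (Suc n))) * gauss_kernel u \<partial>lborel) \<le> 1" for n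
      proof (intro AE_I2)
        fix x
        have "(\<integral>\<^sup>+u. ennreal (F (x + u /\<^sub>R real (Suc n))) * gauss_kernel u \<partial>lborel) \<le> (\<integral>\<^sup>+u. gauss_kernel u \<partial>(lborel::'a measure))"
          using F(2) mult_right_mono[of "ennreal (F _)" 1 "gauss_kernel _"] by (intro nn_integral_mono) (simp add: ennreal_le_1)
        then show "(\<integral>\<^sup>+u. ennreal (F (x + u /\<^sub>R real (Suc n))) * gauss_kernel u \<partial>lborel) \<le> 1"
          by (simp add: nn_integral_gauss_kernel)
      qed
    qed (use inner one in \<open>auto simp: M.emeasure_space_1\<close>)
  qed
  have cont: "(\<integral>\<^sup>+x. ennreal (F x) \<partial>M1) = (\<integral>\<^sup>+x. ennreal (F x) \<partial>M2)"
    if "continuous_on UNIV F" "\<And>x. F x \<le> 1" for F :: "'a \<Rightarrow> real"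
  proof -
    have "F \<in> borel_measurable borel" by (rule borel_measurable_continuous_onI) fact
    then show ?thesis
      using lim[OF P1 S1 that] lim[OF P2 S2 that] sm_eq by (auto intro: LIMSEQ_unique)
  qed
  have open_lim: "(\<lambda>n. \<integral>\<^sup>+x. ennreal (min 1 (real n * infdist x (- U))) \<partial>M) \<longlonglongrightarrow> emeasure M U"
    if M: "prob_space M" "sets M = sets borel" and U: "open U" "- U \<noteq> {}" for M and U :: "'a set"
  proof -
    note [measurable_cong] = M(2)
    interpret M: prob_space M by fact
    have [measurable]: "U \<in> sets borel" using U by auto
    have [measurable]: "(\<lambda>x. infdist x (- U)) \<in> borel_measurable borel"
      by (intro borel_measurable_continuous_onI continuous_intros)
    have "(\<lambda>n. \<integral>\<^sup>+x. ennreal (min 1 (real n * infdist x (- U))) \<partial>M) \<longlonglongrightarrow> (\<integral>\<^sup>+x. indicator U x \<partial>M)"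
    proof (rule nn_integral_dominated_convergence[where w = "\<lambda>_. 1"])
      show "AE x in M. (\<lambda>n. ennreal (min 1 (real n * infdist x (- U)))) \<longlonglongrightarrow> indicator U x"
      proof (intro AE_I2)
        fix x
        show "(\<lambda>n. ennreal (min 1 (real n * infdist x (- U)))) \<longlonglongrightarrow> indicator U x"
        proof (cases "x \<in> U")
          case True
          then have d: "0 < infdist x (- U)"
            using U by (intro infdist_pos_not_in_closed) auto
          obtain N where N: "1 < real N * infdist x (- U)" using reals_Archimedean3[OF d] by blast
          have "\<forall>\<^sub>F n in sequentially. ennreal (min 1 (real n * infdist x (- U))) = 1"
            using eventually_ge_at_top[of N]
          proof eventually_elim
            case (elim n)
            then have "real N * infdist x (- U) \<le> real n * infdist x (- U)"
              using d by (intro mult_right_mono) auto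
            then show ?case using N by (simp add: min_absorb1)
          qed
          then show ?thesis using True by (simp add: tendsto_eventually)
        qed (simp add: min_absorb2)
      qed
    qed (auto simp: M.emeasure_space_1 ennreal_le_1)
    then show ?thesis using M(2) by simp
  qed
  show ?thesis
  proof (rule measure_eqI_generator_eq[where E = "{S. open S}" and \<Omega> = UNIV and A = "\<lambda>_. UNIV"])
    show "Int_stable {S::'a set. open S}" by (auto simp: Int_stable_def)
    fix U :: "'a set" assume "U \<in> {S. open S}"
    then have U: "open U" by simp
    show "emeasure M1 U = emeasure M2 U"
    proof (cases "- U = {}")
      case True
      then have "U = UNIV" by auto
      moreover have "space M1 = UNIV" "space M2 = UNIV" using S1 S2 by (auto dest: sets_eq_imp_space_eq)
      ultimately show ?thesis
        using prob_space.emeasure_space_1[OF P1] prob_space.emeasure_space_1[OF P2] by simp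
    next
      case False
      have "(\<integral>\<^sup>+x. ennreal (min 1 (real n * infdist x (- U))) \<partial>M1) = (\<integral>\<^sup>+x. ennreal (min 1 (real n * infdist x (- U))) \<partial>M2)" for n
        by (rule cont) (auto intro!: continuous_intros)
      then show ?thesis
        using open_lim[OF P1 S1 U False] open_lim[OF P2 S2 U False] by (auto intro: LIMSEQ_unique)
    qed
  next
    show "emeasure M1 UNIV \<noteq> \<infinity>" for i :: nat
      using prob_space.emeasure_le_1[OF P1, of UNIV] by (auto simp: top_unique)
    show "sets M1 = sigma_sets UNIV {S. open S}" by (simp add: S1 borel_def)
    show "sets M2 = sigma_sets UNIV {S. open S}" by (simp add: S2 borel_def)
  qed auto
qed

section \<open>Time reversal of symmetric Levy processes\<close>

locale sym_levy = prob_space M for M :: "'w measure" +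
  fixes X :: "real \<Rightarrow> 'w \<Rightarrow> 'a::euclidean_space"
  assumes X_measurable: "0 \<le> t \<Longrightarrow> X t \<in> borel_measurable M"
    and X_0: "AE \<omega> in M. X 0 \<omega> = 0"
    and X_indep: "0 \<le> \<tau> (0::nat) \<Longrightarrow> mono \<tau> \<Longrightarrow> indep_vars (\<lambda>_. borel) (\<lambda>i \<omega>. X (\<tau> (Suc i)) \<omega> - X (\<tau> i) \<omega>) {..<n}"
    and X_stationary: "0 \<le> s \<Longrightarrow> 0 \<le> t \<Longrightarrow> distr M borel (\<lambda>\<omega>. X (s + t) \<omega> - X s \<omega>) = distr M borel (X t)"
    and X_cadlag: "\<omega> \<in> space M \<Longrightarrow> cadlag_on {0..} (\<lambda>t. X t \<omega>)"
    and X_symmetric: "0 \<le> t \<Longrightarrow> distr M borel (\<lambda>\<omega>. - X t \<omega>) = distr M borel (X t)"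
begin

definition law :: "real \<Rightarrow> 'a measure" where "law d = distr M borel (X d)"

lemma prob_space_law: "0 \<le> d \<Longrightarrow> prob_space (law d)"
  unfolding law_def by (intro prob_space_distr X_measurable)

lemma increment_law:
  assumes "0 \<le> s" "s \<le> t"
  shows "distr M borel (\<lambda>\<omega>. X t \<omega> - X s \<omega>) = law (t - s)"
    and "distr M borel (\<lambda>\<omega>. - (X t \<omega> - X s \<omega>)) = law (t - s)"
proof -
  show *: "distr M borel (\<lambda>\<omega>. X t \<omega> - X s \<omega>) = law (t - s)"
    using X_stationary[of s "t - s"] assms by (simp add: law_def)
  have [measurable]: "X t \<in> borel_measurable M" "X s \<in> borel_measurable M" "X (t - s) \<in> borel_measurable M"
    using assms by (auto intro: X_measurable)
  have "distr M borel (\<lambda>\<omega>. - (X t \<omega> - X s \<omega>)) = distr (distr M borel (\<lambda>\<omega>. X t \<omega> - X s \<omega>)) borel uminus"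
    by (subst distr_distr) (auto simp: o_def)
  also have "\<dots> = distr M borel (\<lambda>\<omega>. - X (t - s) \<omega>)"
    unfolding * law_def by (subst distr_distr) (auto simp: o_def)
  finally show "distr M borel (\<lambda>\<omega>. - (X t \<omega> - X s \<omega>)) = law (t - s)"
    using X_symmetric[of "t - s"] assms by (simp add: law_def)
qed

text \<open>Symmetry gives every reflected increment the law of the increment itself, and independence
  is preserved by reflection.\<close>

lemma increments_joint_law:
  fixes t :: "nat \<Rightarrow> real"
  assumes t: "0 \<le> t 0" "mono t" and n: "0 < n"
  shows "distr M (\<Pi>\<^sub>M j\<in>{..<n}. borel) (\<lambda>\<omega>. \<lambda>j\<in>{..<n}. X (t (Suc j)) \<omega> - X (t j) \<omega>)
           = (\<Pi>\<^sub>M j\<in>{..<n}. law (t (Suc j) - t j))"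
    and "distr M (\<Pi>\<^sub>M j\<in>{..<n}. borel) (\<lambda>\<omega>. \<lambda>j\<in>{..<n}. - (X (t (Suc j)) \<omega> - X (t j) \<omega>))
           = (\<Pi>\<^sub>M j\<in>{..<n}. law (t (Suc j) - t j))"
proof -
  have t0: "0 \<le> t i" for i using t monoD[OF t(2), of 0 i] by simp
  have ts: "t i \<le> t (Suc i)" for i using monoD[OF t(2), of i "Suc i"] by simp
  have [measurable]: "X (t i) \<in> borel_measurable M" for i by (rule X_measurable[OF t0])
  have ne: "{..<n} \<noteq> {}" using n by auto
  have ind: "indep_vars (\<lambda>_. borel) (\<lambda>i \<omega>. X (t (Suc i)) \<omega> - X (t i) \<omega>) {..<n}"
    by (rule X_indep[OF t])
  show "distr M (\<Pi>\<^sub>M j\<in>{..<n}. borel) (\<lambda>\<omega>. \<lambda>j\<in>{..<n}. X (t (Suc j)) \<omega> - X (t j) \<omega>)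
           = (\<Pi>\<^sub>M j\<in>{..<n}. law (t (Suc j) - t j))"
    using indep_vars_iff_distr_eq_PiM[THEN iffD1, OF ne _ ind]
    by (simp add: increment_law[OF t0 ts])
  have ind': "indep_vars (\<lambda>_. borel) (\<lambda>i \<omega>. - (X (t (Suc i)) \<omega> - X (t i) \<omega>)) {..<n}"
    by (rule indep_vars_compose2[OF ind]) auto
  have "distr M (\<Pi>\<^sub>M j\<in>{..<n}. borel) (\<lambda>\<omega>. \<lambda>j\<in>{..<n}. - (X (t (Suc j)) \<omega> - X (t j) \<omega>))
      = (\<Pi>\<^sub>M j\<in>{..<n}. distr M borel (\<lambda>\<omega>. - (X (t (Suc j)) \<omega> - X (t j) \<omega>)))"
    by (rule indep_vars_iff_distr_eq_PiM[THEN iffD1, OF ne _ ind']) measurable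
  then show "distr M (\<Pi>\<^sub>M j\<in>{..<n}. borel) (\<lambda>\<omega>. \<lambda>j\<in>{..<n}. - (X (t (Suc j)) \<omega> - X (t j) \<omega>))
           = (\<Pi>\<^sub>M j\<in>{..<n}. law (t (Suc j) - t j))"
    unfolding increment_law(2)[OF t0 ts] .
qed

lemma nn_integral_lborel_shift:
  fixes F :: "'a \<Rightarrow> ennreal"
  assumes [measurable]: "F \<in> borel_measurable borel"
  shows "(\<integral>\<^sup>+x. F (x + c) \<partial>lborel) = (\<integral>\<^sup>+x. F x \<partial>lborel)"
proof -
  have "(\<integral>\<^sup>+x. F x \<partial>lborel) = (\<integral>\<^sup>+x. F x \<partial>(distr lborel borel (\<lambda>x. c + 1 *\<^sub>R x)))"
    using lborel_affine[of 1 c] by (simp add: density_1)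
  then show ?thesis by (simp add: nn_integral_distr add.commute)
qed

lemma sum_increments:
  fixes t :: "nat \<Rightarrow> real"
  assumes "i \<le> n"
  shows "(\<Sum>j<i. X (t (Suc j)) \<omega> - X (t j) \<omega>) = X (t i) \<omega> - X (t 0) \<omega>"
    and "(\<Sum>j\<in>{i..<n}. X (t (Suc j)) \<omega> - X (t j) \<omega>) = X (t n) \<omega> - X (t i) \<omega>"
  using sum_lessThan_telescope[of "\<lambda>j. X (t j) \<omega>" i] sum_Suc_diff'[of i n "\<lambda>j. X (t j) \<omega>"] assms by auto

text \<open>When the starting point is distributed by Lebesgue measure, a translation by \<open>-X\<^bsub>t\<^sub>0\<^esub>\<close> or by
  \<open>-X\<^bsub>t\<^sub>n\<^esub>\<close> does not change the integral. It leaves the increments after the first time, or the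
  reflected increments before the last time.\<close>

lemma finite_dimensional_increments:
  fixes t :: "nat \<Rightarrow> real" and G :: "nat \<Rightarrow> 'a \<Rightarrow> ennreal"
  assumes t: "0 \<le> t 0" "mono t" and n: "0 < n" and [measurable]: "\<And>i. G i \<in> borel_measurable borel"
  shows "(\<integral>\<^sup>+x. (\<integral>\<^sup>+\<omega>. (\<Prod>i\<le>n. G i (x + X (t i) \<omega>)) \<partial>M) \<partial>lborel) =
         (\<integral>\<^sup>+x. (\<integral>\<^sup>+\<rho>. (\<Prod>i\<le>n. G i (x + (\<Sum>j<i. \<rho> j))) \<partial>(\<Pi>\<^sub>M j\<in>{..<n}. law (t (Suc j) - t j))) \<partial>lborel)" (is ?first)
    and "(\<integral>\<^sup>+x. (\<integral>\<^sup>+\<omega>. (\<Prod>i\<le>n. G i (x + X (t i) \<omega>)) \<partial>M) \<partial>lborel) =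
         (\<integral>\<^sup>+x. (\<integral>\<^sup>+\<rho>. (\<Prod>i\<le>n. G i (x + (\<Sum>j\<in>{i..<n}. \<rho> j))) \<partial>(\<Pi>\<^sub>M j\<in>{..<n}. law (t (Suc j) - t j))) \<partial>lborel)" (is ?last)
proof -
  have t0: "0 \<le> t i" for i using t monoD[OF t(2), of 0 i] by simp
  have [measurable]: "X (t i) \<in> borel_measurable M" for i by (rule X_measurable[OF t0])
  interpret L: pair_sigma_finite lborel M ..
  have shift: "(\<integral>\<^sup>+x. (\<integral>\<^sup>+\<omega>. (\<Prod>i\<le>n. G i (x + X (t i) \<omega>)) \<partial>M) \<partial>lborel) =
     (\<integral>\<^sup>+x. (\<integral>\<^sup>+\<omega>. (\<Prod>i\<le>n. G i (x + (X (t i) \<omega> - X (t k) \<omega>))) \<partial>M) \<partial>lborel)" for k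
  proof -
    have "(\<integral>\<^sup>+x. (\<integral>\<^sup>+\<omega>. (\<Prod>i\<le>n. G i (x + X (t i) \<omega>)) \<partial>M) \<partial>lborel) =
      (\<integral>\<^sup>+\<omega>. (\<integral>\<^sup>+x. (\<Prod>i\<le>n. G i (x + X (t i) \<omega>)) \<partial>lborel) \<partial>M)"
      by (rule L.Fubini'[symmetric]) measurable
    also have "\<dots> = (\<integral>\<^sup>+\<omega>. (\<integral>\<^sup>+x. (\<Prod>i\<le>n. G i ((x + - X (t k) \<omega>) + X (t i) \<omega>)) \<partial>lborel) \<partial>M)"
      by (intro nn_integral_cong nn_integral_lborel_shift[symmetric]) measurable
    also have "\<dots> = (\<integral>\<^sup>+\<omega>. (\<integral>\<^sup>+x. (\<Prod>i\<le>n. G i (x + (X (t i) \<omega> - X (t k) \<omega>))) \<partial>lborel) \<partial>M)"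
      by (simp add: algebra_simps)
    also have "\<dots> = (\<integral>\<^sup>+x. (\<integral>\<^sup>+\<omega>. (\<Prod>i\<le>n. G i (x + (X (t i) \<omega> - X (t k) \<omega>))) \<partial>M) \<partial>lborel)"
      by (rule L.Fubini') measurable
    finally show ?thesis .
  qed
  have meas: "(\<lambda>\<rho>. \<Prod>i\<le>n. G i (x + (\<Sum>j\<in>I i. \<rho> j))) \<in> borel_measurable (\<Pi>\<^sub>M j\<in>{..<n}. borel)"
    if "\<And>i. i \<le> n \<Longrightarrow> I i \<subseteq> {..<n}" for x and I :: "nat \<Rightarrow> nat set"
  proof (rule borel_measurable_prod_ennreal)
    fix i assume "i \<in> {..n}"
    then have "(\<lambda>\<rho>. \<Sum>j\<in>I i. \<rho> j :: 'a) \<in> borel_measurable (\<Pi>\<^sub>M j\<in>{..<n}. borel)"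
      using that[of i] by (intro borel_measurable_sum measurable_component_singleton) auto
    then show "(\<lambda>\<rho>. G i (x + (\<Sum>j\<in>I i. \<rho> j))) \<in> borel_measurable (\<Pi>\<^sub>M j\<in>{..<n}. borel)"
      by measurable
  qed
  have "(\<integral>\<^sup>+\<rho>. (\<Prod>i\<le>n. G i (x + (\<Sum>j<i. \<rho> j))) \<partial>(\<Pi>\<^sub>M j\<in>{..<n}. law (t (Suc j) - t j))) =
        (\<integral>\<^sup>+\<omega>. (\<Prod>i\<le>n. G i (x + (X (t i) \<omega> - X (t 0) \<omega>))) \<partial>M)" for x
  proof -
    have "(\<integral>\<^sup>+\<rho>. (\<Prod>i\<le>n. G i (x + (\<Sum>j<i. \<rho> j))) \<partial>(\<Pi>\<^sub>M j\<in>{..<n}. law (t (Suc j) - t j))) =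
       (\<integral>\<^sup>+\<omega>. (\<Prod>i\<le>n. G i (x + (\<Sum>j<i. (\<lambda>j\<in>{..<n}. X (t (Suc j)) \<omega> - X (t j) \<omega>) j))) \<partial>M)"
      unfolding increments_joint_law(1)[OF t n, symmetric]
    proof (rule nn_integral_distr)
      show "(\<lambda>\<omega>. \<lambda>j\<in>{..<n}. X (t (Suc j)) \<omega> - X (t j) \<omega>) \<in> M \<rightarrow>\<^sub>M (\<Pi>\<^sub>M j\<in>{..<n}. borel)"
        by measurable
    qed (auto intro!: meas)
    also have "\<dots> = (\<integral>\<^sup>+\<omega>. (\<Prod>i\<le>n. G i (x + (X (t i) \<omega> - X (t 0) \<omega>))) \<partial>M)"
    proof (intro nn_integral_cong prod.cong refl)
      fix i \<omega> assume i: "i \<in> {..n}"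
      have "(\<Sum>j<i. (\<lambda>j\<in>{..<n}. X (t (Suc j)) \<omega> - X (t j) \<omega>) j) = (\<Sum>j<i. X (t (Suc j)) \<omega> - X (t j) \<omega>)"
        using i by (intro sum.cong) auto
      also have "\<dots> = X (t i) \<omega> - X (t 0) \<omega>" using i by (intro sum_increments) auto
      finally show "G i (x + (\<Sum>j<i. (\<lambda>j\<in>{..<n}. X (t (Suc j)) \<omega> - X (t j) \<omega>) j)) = G i (x + (X (t i) \<omega> - X (t 0) \<omega>))"
        by simp
    qed
    finally show ?thesis .
  qed
  then show ?first using shift[of 0] by simp
  have "(\<integral>\<^sup>+\<rho>. (\<Prod>i\<le>n. G i (x + (\<Sum>j\<in>{i..<n}. \<rho> j))) \<partial>(\<Pi>\<^sub>M j\<in>{..<n}. law (t (Suc j) - t j))) =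
        (\<integral>\<^sup>+\<omega>. (\<Prod>i\<le>n. G i (x + (X (t i) \<omega> - X (t n) \<omega>))) \<partial>M)" for x
  proof -
    have "(\<integral>\<^sup>+\<rho>. (\<Prod>i\<le>n. G i (x + (\<Sum>j\<in>{i..<n}. \<rho> j))) \<partial>(\<Pi>\<^sub>M j\<in>{..<n}. law (t (Suc j) - t j))) =
       (\<integral>\<^sup>+\<omega>. (\<Prod>i\<le>n. G i (x + (\<Sum>j\<in>{i..<n}. (\<lambda>j\<in>{..<n}. - (X (t (Suc j)) \<omega> - X (t j) \<omega>)) j))) \<partial>M)"
      unfolding increments_joint_law(2)[OF t n, symmetric]
    proof (rule nn_integral_distr)
      show "(\<lambda>\<omega>. \<lambda>j\<in>{..<n}. - (X (t (Suc j)) \<omega> - X (t j) \<omega>)) \<in> M \<rightarrow>\<^sub>M (\<Pi>\<^sub>M j\<in>{..<n}. borel)"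
        by measurable
    qed (auto intro!: meas)
    also have "\<dots> = (\<integral>\<^sup>+\<omega>. (\<Prod>i\<le>n. G i (x + (X (t i) \<omega> - X (t n) \<omega>))) \<partial>M)"
    proof (intro nn_integral_cong prod.cong refl)
      fix i \<omega> assume i: "i \<in> {..n}"
      have "(\<Sum>j\<in>{i..<n}. (\<lambda>j\<in>{..<n}. - (X (t (Suc j)) \<omega> - X (t j) \<omega>)) j) = (\<Sum>j\<in>{i..<n}. - (X (t (Suc j)) \<omega> - X (t j) \<omega>))"
        by (intro sum.cong) auto
      also have "\<dots> = - (X (t n) \<omega> - X (t i) \<omega>)"
        unfolding sum_negf using i by (subst sum_increments(2)) auto
      finally show "G i (x + (\<Sum>j\<in>{i..<n}. (\<lambda>j\<in>{..<n}. - (X (t (Suc j)) \<omega> - X (t j) \<omega>)) j)) = G i (x + (X (t i) \<omega> - X (t n) \<omega>))"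
        by simp
    qed
    finally show ?thesis .
  qed
  then show ?last using shift[of n] by simp
qed

text \<open>Reading the times backwards reverses the order of the independent increments. The
  description from the last time of the reversed process then coincides with the description from
  the first time of the original one.\<close>

lemma finite_dimensional_reversal_sequence:
  fixes t :: "nat \<Rightarrow> real" and G :: "nat \<Rightarrow> 'a \<Rightarrow> ennreal"
  assumes t: "0 \<le> t 0" "mono t" and T: "\<And>i. t i \<le> T" and n: "0 < n"
    and G: "\<And>i. G i \<in> borel_measurable borel"
  shows "(\<integral>\<^sup>+x. (\<integral>\<^sup>+\<omega>. (\<Prod>i\<le>n. G i (x + X (t i) \<omega>)) \<partial>M) \<partial>lborel) =
         (\<integral>\<^sup>+x. (\<integral>\<^sup>+\<omega>. (\<Prod>i\<le>n. G i (x + X (T - t i) \<omega>)) \<partial>M) \<partial>lborel)"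
proof -
  note [measurable] = G
  define t' where "t' k = T - t (n - k)" for k
  define d where "d j = t (Suc j) - t j" for j
  have t': "0 \<le> t' 0" "mono t'"
    using T[of n] t(2) by (auto simp: t'_def mono_def)
  have d': "t' (Suc j) - t' j = d (n - Suc j)" if "j < n" for j
    using that by (simp add: t'_def d_def Suc_diff_Suc)
  have d0: "0 \<le> d j" for j using monoD[OF t(2), of j "Suc j"] by (simp add: d_def)
  have Pi: "(\<Pi>\<^sub>M j\<in>{..<n}. law (t' (Suc j) - t' j)) = (\<Pi>\<^sub>M j\<in>{..<n}. law (d (n - Suc j)))"
    by (intro PiM_cong) (auto simp: d')
  have reorder: "distr (\<Pi>\<^sub>M j\<in>{..<n}. law (d j)) (\<Pi>\<^sub>M j\<in>{..<n}. law (d (n - Suc j))) (\<lambda>\<rho>. \<lambda>j\<in>{..<n}. \<rho> (n - Suc j))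
      = (\<Pi>\<^sub>M j\<in>{..<n}. law (d (n - Suc j)))"
    by (rule distr_PiM_reindex) (auto intro!: prob_space_law d0 inj_onI)
  have [simp]: "sets (law d) = sets borel" for d by (simp add: law_def)
  have setsP: "sets (\<Pi>\<^sub>M j\<in>{..<n}. law (f j)) = sets (\<Pi>\<^sub>M j\<in>{..<n}. (borel :: 'a measure))" for f
    by (intro sets_PiM_cong) auto
  note [measurable_cong] = setsP
  have "(\<integral>\<^sup>+x. (\<integral>\<^sup>+\<omega>. (\<Prod>i\<le>n. G i (x + X (T - t i) \<omega>)) \<partial>M) \<partial>lborel) =
        (\<integral>\<^sup>+x. (\<integral>\<^sup>+\<omega>. (\<Prod>k\<le>n. G (n - k) (x + X (t' k) \<omega>)) \<partial>M) \<partial>lborel)"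
    by (intro nn_integral_cong prod.reindex_bij_witness[where i = "\<lambda>i. n - i" and j = "\<lambda>i. n - i"])
       (auto simp: t'_def)
  also have "\<dots> = (\<integral>\<^sup>+x. (\<integral>\<^sup>+\<rho>. (\<Prod>k\<le>n. G (n - k) (x + (\<Sum>j\<in>{k..<n}. \<rho> j))) \<partial>(\<Pi>\<^sub>M j\<in>{..<n}. law (d (n - Suc j)))) \<partial>lborel)"
    unfolding Pi[symmetric] by (rule finite_dimensional_increments(2)[OF t' n]) (rule G)
  also have "\<dots> = (\<integral>\<^sup>+x. (\<integral>\<^sup>+\<rho>. (\<Prod>k\<le>n. G (n - k) (x + (\<Sum>j\<in>{k..<n}. \<rho> (n - Suc j)))) \<partial>(\<Pi>\<^sub>M j\<in>{..<n}. law (d j))) \<partial>lborel)"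
    by (subst reorder[symmetric], subst nn_integral_distr)
       (auto intro!: nn_integral_cong prod.cong measurable_restrict arg_cong[where f = "G _"] sum.cong)
  also have "\<dots> = (\<integral>\<^sup>+x. (\<integral>\<^sup>+\<rho>. (\<Prod>i\<le>n. G i (x + (\<Sum>j<i. \<rho> j))) \<partial>(\<Pi>\<^sub>M j\<in>{..<n}. law (d j))) \<partial>lborel)"
  proof (intro nn_integral_cong prod.reindex_bij_witness[where i = "\<lambda>i. n - i" and j = "\<lambda>i. n - i"])
    fix x :: 'a and \<rho> :: "nat \<Rightarrow> 'a" and k assume k: "k \<in> {..n}"
    have "(\<Sum>j\<in>{k..<n}. \<rho> (n - Suc j)) = (\<Sum>j<n - k. \<rho> j)"
      by (rule sum.reindex_bij_witness[where i = "\<lambda>j. n - Suc j" and j = "\<lambda>j. n - Suc j"]) (use k in auto)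
    then show "G (n - k) (x + (\<Sum>j<n - k. \<rho> j)) = G (n - k) (x + (\<Sum>j\<in>{k..<n}. \<rho> (n - Suc j)))" by simp
  qed auto
  also have "\<dots> = (\<integral>\<^sup>+x. (\<integral>\<^sup>+\<omega>. (\<Prod>i\<le>n. G i (x + X (t i) \<omega>)) \<partial>M) \<partial>lborel)"
    unfolding d_def by (rule finite_dimensional_increments(1)[OF t n, symmetric]) (rule G)
  finally show ?thesis ..
qed

lemma finite_dimensional_reversal:
  fixes G :: "real \<Rightarrow> 'a \<Rightarrow> ennreal"
  assumes S: "finite S" "S \<subseteq> {0..T}" "0 \<in> S" "T \<in> S" and T: "0 < T"
    and G: "\<And>s. G s \<in> borel_measurable borel"
  shows "(\<integral>\<^sup>+x. (\<integral>\<^sup>+\<omega>. (\<Prod>s\<in>S. G s (x + X s \<omega>)) \<partial>M) \<partial>lborel) =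
         (\<integral>\<^sup>+x. (\<integral>\<^sup>+\<omega>. (\<Prod>s\<in>S. G s (x + X (T - s) \<omega>)) \<partial>M) \<partial>lborel)"
proof -
  define xs where "xs = sorted_list_of_set S"
  have xs: "sorted xs" "distinct xs" "set xs = S" using S by (auto simp: xs_def)
  define n where "n = length xs - 1"
  have "card {0, T} \<le> card S" using S by (intro card_mono) auto
  then have len: "2 \<le> length xs" using T xs distinct_card[of xs] by simp
  then have n: "0 < n" "length xs = Suc n" by (auto simp: n_def)
  define t where "t i = xs ! min i n" for i
  have tS: "t i \<in> S" for i using xs n by (auto simp: t_def)
  have tI: "t i \<in> {0..T}" for i using tS S(2) by blast
  have t: "0 \<le> t 0" "mono t" "\<And>i. t i \<le> T"
  proof -
    show "0 \<le> t 0" "\<And>i. t i \<le> T" using tI by auto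
    show "mono t" unfolding t_def
      by (intro monoI sorted_nth_mono xs(1)) (use n in auto)
  qed
  have bij: "bij_betw t {..n} S"
  proof (rule bij_betw_imageI)
    show "inj_on t {..n}" using xs(2) n by (auto simp: inj_on_def t_def nth_eq_iff_index_eq)
    have "t ` {..n} = set xs" using n by (force simp: t_def in_set_conv_nth image_iff less_Suc_eq_le)
    then show "t ` {..n} = S" using xs by simp
  qed
  have re: "(\<Prod>s\<in>S. F s) = (\<Prod>i\<le>n. F (t i))" for F :: "real \<Rightarrow> ennreal"
    using prod.reindex_bij_betw[OF bij] by metis
  show ?thesis unfolding re
    by (rule finite_dimensional_reversal_sequence[OF t n(1)]) (rule G)
qed

end

section \<open>Reversal of Feynman-Kac weights\<close>

definition fk_weight :: "(real \<Rightarrow> 'w \<Rightarrow> 'a::euclidean_space) \<Rightarrow> ('a \<Rightarrow> real) \<Rightarrow> real \<Rightarrow> 'a \<Rightarrow> 'w \<Rightarrow> real" where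
  "fk_weight X V T x \<omega> = exp (- (LBINT s:{0..T}. V (x + X s \<omega>)))"

text \<open>The next point strictly after \<open>s\<close> of the grid with mesh \<open>1 / (n + 1)\<close>. As a function of \<open>s\<close>
  it takes countably many values, and because it exceeds \<open>s\<close>, the times \<open>T - grid_time n s\<close>
  approach \<open>T - s\<close> strictly from the left.\<close>

definition grid_time :: "nat \<Rightarrow> real \<Rightarrow> real" where
  "grid_time n s = (of_int \<lfloor>real (Suc n) * s\<rfloor> + 1) / real (Suc n)"

lemma grid_time_bounds: "s < grid_time n s" "grid_time n s \<le> s + 1 / real (Suc n)"
proof -
  have "real (Suc n) * s < of_int \<lfloor>real (Suc n) * s\<rfloor> + 1" "of_int \<lfloor>real (Suc n) * s\<rfloor> \<le> real (Suc n) * s"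
    by linarith+
  then show "s < grid_time n s" "grid_time n s \<le> s + 1 / real (Suc n)"
    unfolding grid_time_def by (simp_all add: pos_less_divide_eq pos_divide_le_eq distrib_left mult.commute del: of_nat_Suc)
qed

lemma grid_time_tendsto: "(\<lambda>n. grid_time n s) \<longlonglongrightarrow> s"
proof (rule tendsto_sandwich)
  show "\<forall>\<^sub>F n in sequentially. s \<le> grid_time n s" using grid_time_bounds(1) by (auto intro: less_imp_le always_eventually)
  show "\<forall>\<^sub>F n in sequentially. grid_time n s \<le> s + inverse (real (Suc n))"
    using grid_time_bounds(2)[of _ s] by (auto simp: inverse_eq_divide intro!: always_eventually)
  show "(\<lambda>n. s + inverse (real (Suc n))) \<longlonglongrightarrow> s"
    using tendsto_add[OF tendsto_const[of s] LIMSEQ_inverse_real_of_nat] by simp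
qed simp

lemma grid_time_measurable [measurable]: "grid_time n \<in> borel_measurable borel"
  unfolding grid_time_def by measurable

context sym_levy
begin

lemma right_continuous_sequence:
  assumes "\<omega> \<in> space M" "0 \<le> s" "\<And>n. s \<le> u n" "u \<longlonglongrightarrow> s"
  shows "(\<lambda>n. X (u n) \<omega>) \<longlonglongrightarrow> X s \<omega>"
proof -
  have "continuous (at s within {0..} \<inter> {s..}) (\<lambda>t. X t \<omega>)"
    using X_cadlag[OF assms(1)] assms(2) by (simp add: cadlag_on_def)
  moreover have "\<forall>n. u n \<in> {0..} \<inter> {s..}" using assms(2,3) by (auto intro: order_trans)
  ultimately show ?thesis
    using assms(4) unfolding continuous_within_sequentially by (auto simp: o_def)
qed

lemma left_limit_sequence:
  assumes "\<omega> \<in> space M" "0 \<le> s"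
  obtains l where "\<And>u. (\<And>n. 0 \<le> u n) \<Longrightarrow> (\<And>n. u n < s) \<Longrightarrow> u \<longlonglongrightarrow> s \<Longrightarrow> (\<lambda>n. X (u n) \<omega>) \<longlonglongrightarrow> l"
proof -
  obtain l where l: "((\<lambda>t. X t \<omega>) \<longlongrightarrow> l) (at s within {0..} \<inter> {..<s})"
    using X_cadlag[OF assms(1)] assms(2) by (auto simp: cadlag_on_def)
  show ?thesis
  proof (rule that)
    fix u :: "nat \<Rightarrow> real" assume u: "\<And>n. 0 \<le> u n" "\<And>n. u n < s" "u \<longlonglongrightarrow> s"
    have "filterlim u (at s within {0..} \<inter> {..<s}) sequentially"
      unfolding filterlim_at using u by (auto intro!: always_eventually simp: less_imp_neq)
    then show "(\<lambda>n. X (u n) \<omega>) \<longlonglongrightarrow> l" by (rule filterlim_compose[OF l])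
  qed
qed

text \<open>Constant continuation to negative times, so that joint measurability concerns the whole real line.\<close>

definition Xp :: "real \<Rightarrow> 'w \<Rightarrow> 'a" where "Xp s = X (max 0 s)"

lemma Xp_measurable [measurable]: "Xp s \<in> borel_measurable M"
  unfolding Xp_def by (rule X_measurable) simp

text \<open>By right continuity the process is the limit of its values at the next grid point, each a
  countable gluing of random variables.\<close>

lemma Xp_jointly_measurable [measurable]:
  "(\<lambda>(s, \<omega>). Xp s \<omega>) \<in> borel_measurable (borel \<Otimes>\<^sub>M M)"
proof (rule borel_measurable_LIMSEQ_metric)
  fix n
  have "(\<lambda>p. (\<lambda>i p. Xp ((of_int i + 1) / real (Suc n)) (snd p)) \<lfloor>real (Suc n) * fst p\<rfloor> p) \<in> borel_measurable (borel \<Otimes>\<^sub>M M)"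
    by (rule measurable_compose_countable) measurable
  then show "(\<lambda>(s, \<omega>). Xp (grid_time n s) \<omega>) \<in> borel_measurable (borel \<Otimes>\<^sub>M M)"
    by (simp add: grid_time_def split_beta')
next
  fix p :: "real \<times> 'w" assume p: "p \<in> space (borel \<Otimes>\<^sub>M M)"
  have "(\<lambda>n. Xp (grid_time n (fst p)) (snd p)) \<longlonglongrightarrow> Xp (fst p) (snd p)"
    unfolding Xp_def
  proof (rule right_continuous_sequence)
    show "(\<lambda>n. max 0 (grid_time n (fst p))) \<longlonglongrightarrow> max 0 (fst p)"
      by (intro tendsto_intros grid_time_tendsto)
    show "max 0 (fst p) \<le> max 0 (grid_time n (fst p))" for n
      using grid_time_bounds(1)[of "fst p" n] by simp
  qed (use p in \<open>auto simp: space_pair_measure\<close>)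
  then show "(\<lambda>i. case p of (s, \<omega>) \<Rightarrow> Xp (grid_time i s) \<omega>) \<longlonglongrightarrow> (case p of (s, \<omega>) \<Rightarrow> Xp s \<omega>)"
    by (simp add: split_beta')
qed

lemma fk_weight_Xp: "fk_weight X V T x \<omega> = exp (- (LBINT s:{0..T}. V (x + Xp s \<omega>)))"
  unfolding fk_weight_def
  by (subst set_lebesgue_integral_cong[where g = "\<lambda>s. V (x + Xp s \<omega>)"]) (auto simp: Xp_def)

lemma fk_weight_measurable [measurable]:
  assumes [measurable]: "V \<in> borel_measurable borel"
  shows "(\<lambda>(x, \<omega>). fk_weight X V T x \<omega>) \<in> borel_measurable (borel \<Otimes>\<^sub>M M)"
  unfolding fk_weight_Xp set_lebesgue_integral_def by measurable

text \<open>The increment of the process over the interval from \<open>u - h\<close> to \<open>u\<close> has the law of \<open>X\<^sub>h\<close>,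
  which tends to 0 by right continuity at time 0. So the left limit at the fixed time \<open>u\<close> agrees
  almost surely with the value.\<close>

lemma no_fixed_jump:
  assumes u: "0 < u"
  shows "AE \<omega> in M. \<forall>v. (\<forall>n. 0 \<le> v n) \<longrightarrow> (\<forall>n. v n < u) \<longrightarrow> v \<longlonglongrightarrow> u \<longrightarrow> (\<lambda>n. X (v n) \<omega>) \<longlonglongrightarrow> X u \<omega>"
proof -
  define h where "h k = u / real (Suc (Suc k))" for k
  have h: "0 < h k" "h k < u" for k using u by (auto simp: h_def field_simps add_pos_nonneg)
  have h0: "h \<longlonglongrightarrow> 0"
    unfolding h_def by (rule LIMSEQ_Suc[OF LIMSEQ_Suc[OF lim_const_over_n]])
  define D where "D k \<omega> = min 1 (norm (X u \<omega> - X (u - h k) \<omega>))" for k \<omega>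
  have [measurable]: "X u \<in> borel_measurable M" "X (u - h k) \<in> borel_measurable M" "X (h k) \<in> borel_measurable M"  "X 0 \<in> borel_measurable M" for k
    using u h[of k] by (auto intro!: X_measurable)
  have Dm [measurable]: "D k \<in> borel_measurable M" for k unfolding D_def by measurable
  have Dconv: "\<exists>l. (\<lambda>k. D k \<omega>) \<longlonglongrightarrow> min 1 (norm (X u \<omega> - l)) \<and>
      (\<forall>v. (\<forall>n. 0 \<le> v n) \<longrightarrow> (\<forall>n. v n < u) \<longrightarrow> v \<longlonglongrightarrow> u \<longrightarrow> (\<lambda>n. X (v n) \<omega>) \<longlonglongrightarrow> l)"
    if \<omega>: "\<omega> \<in> space M" for \<omega>
  proof -
    obtain l where l: "\<And>v. (\<And>n. 0 \<le> v n) \<Longrightarrow> (\<And>n. v n < u) \<Longrightarrow> v \<longlonglongrightarrow> u \<Longrightarrow> (\<lambda>n. X (v n) \<omega>) \<longlonglongrightarrow> l"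
      using left_limit_sequence[OF \<omega>, of u] u by auto
    have "(\<lambda>k. u - h k) \<longlonglongrightarrow> u - 0" by (intro tendsto_intros h0)
    then have "(\<lambda>k. X (u - h k) \<omega>) \<longlonglongrightarrow> l" by (intro l) (use h in \<open>auto simp: less_imp_le\<close>)
    then have "(\<lambda>k. D k \<omega>) \<longlonglongrightarrow> min 1 (norm (X u \<omega> - l))" unfolding D_def by (intro tendsto_intros)
    with l show ?thesis by blast
  qed
  define L where "L \<omega> = lim (\<lambda>k. D k \<omega>)" for \<omega>
  have [measurable]: "L \<in> borel_measurable M" unfolding L_def by measurable
  have DL: "(\<lambda>k. D k \<omega>) \<longlonglongrightarrow> L \<omega>" if "\<omega> \<in> space M" for \<omega>
    using Dconv[OF that] unfolding L_def by (metis convergentI convergent_LIMSEQ_iff)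
  have law_D: "(\<integral>\<omega>. D k \<omega> \<partial>M) = (\<integral>\<omega>. min 1 (norm (X (h k) \<omega>)) \<partial>M)" for k
  proof -
    have "(\<integral>\<omega>. D k \<omega> \<partial>M) = (\<integral>x. min 1 (norm x) \<partial>(distr M borel (\<lambda>\<omega>. X u \<omega> - X (u - h k) \<omega>)))"
      unfolding D_def by (subst integral_distr) auto
    also have "distr M borel (\<lambda>\<omega>. X u \<omega> - X (u - h k) \<omega>) = distr M borel (X (h k))"
      using X_stationary[of "u - h k" "h k"] h[of k] by simp
    also have "(\<integral>x. min 1 (norm x) \<partial>(distr M borel (X (h k)))) = (\<integral>\<omega>. min 1 (norm (X (h k) \<omega>)) \<partial>M)"
      by (subst integral_distr) auto
    finally show ?thesis .
  qed
  have "(\<lambda>k. \<integral>\<omega>. min 1 (norm (X (h k) \<omega>)) \<partial>M) \<longlonglongrightarrow> (\<integral>\<omega>. min 1 (norm (X 0 \<omega>)) \<partial>M)"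
  proof (rule integral_dominated_convergence[where w = "\<lambda>_. 1"])
    show "AE \<omega> in M. (\<lambda>k. min 1 (norm (X (h k) \<omega>))) \<longlonglongrightarrow> min 1 (norm (X 0 \<omega>))"
    proof (rule AE_I2)
      fix \<omega> assume "\<omega> \<in> space M"
      then have "(\<lambda>k. X (h k) \<omega>) \<longlonglongrightarrow> X 0 \<omega>"
        by (rule right_continuous_sequence) (use h h0 in \<open>auto simp: less_imp_le\<close>)
      then show "(\<lambda>k. min 1 (norm (X (h k) \<omega>))) \<longlonglongrightarrow> min 1 (norm (X 0 \<omega>))" by (intro tendsto_intros)
    qed
  qed auto
  also have "(\<integral>\<omega>. min 1 (norm (X 0 \<omega>)) \<partial>M) = (\<integral>\<omega>. 0 \<partial>M)"
    by (rule integral_cong_AE) (use X_0 in auto)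
  finally have "(\<lambda>k. \<integral>\<omega>. D k \<omega> \<partial>M) \<longlonglongrightarrow> 0" by (simp add: law_D)
  moreover have "(\<lambda>k. \<integral>\<omega>. D k \<omega> \<partial>M) \<longlonglongrightarrow> (\<integral>\<omega>. L \<omega> \<partial>M)"
  proof (rule integral_dominated_convergence[where w = "\<lambda>_. 1"])
    show "AE \<omega> in M. (\<lambda>k. D k \<omega>) \<longlonglongrightarrow> L \<omega>" using DL by (rule AE_I2)
  qed (auto simp: D_def)
  ultimately have L0: "(\<integral>\<omega>. L \<omega> \<partial>M) = 0" by (rule LIMSEQ_unique[symmetric])
  have Lb: "0 \<le> L \<omega>" "L \<omega> \<le> 1" if "\<omega> \<in> space M" for \<omega>
    using LIMSEQ_le_const[OF DL[OF that], of 0] LIMSEQ_le_const2[OF DL[OF that], of 1] by (auto simp: D_def)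
  have "AE \<omega> in M. L \<omega> = 0"
  proof (subst integral_nonneg_eq_0_iff_AE[symmetric])
    show "integrable M L" by (rule integrable_const_bound[of _ 1]) (use Lb in auto)
  qed (use Lb L0 in auto)
  then show ?thesis
  proof (rule AE_mp, intro AE_I2 impI)
    fix \<omega> assume \<omega>: "\<omega> \<in> space M" and z: "L \<omega> = 0"
    obtain l where l: "(\<lambda>k. D k \<omega>) \<longlonglongrightarrow> min 1 (norm (X u \<omega> - l))"
      "\<forall>v. (\<forall>n. 0 \<le> v n) \<longrightarrow> (\<forall>n. v n < u) \<longrightarrow> v \<longlonglongrightarrow> u \<longrightarrow> (\<lambda>n. X (v n) \<omega>) \<longlonglongrightarrow> l"
      using Dconv[OF \<omega>] by blast
    have "min 1 (norm (X u \<omega> - l)) = 0" using LIMSEQ_unique[OF l(1) DL[OF \<omega>]] z by simp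
    then have "l = X u \<omega>" by (auto simp: min_def split: if_splits)
    with l(2) show "\<forall>v. (\<forall>n. 0 \<le> v n) \<longrightarrow> (\<forall>n. v n < u) \<longrightarrow> v \<longlonglongrightarrow> u \<longrightarrow> (\<lambda>n. X (v n) \<omega>) \<longlonglongrightarrow> X u \<omega>"
      by simp
  qed
qed

definition clip :: "real \<Rightarrow> nat \<Rightarrow> real \<Rightarrow> real" where
  "clip T n s = max 0 (min T (grid_time n s))"

lemma clip_range: "0 \<le> T \<Longrightarrow> clip T n s \<in> {0..T}"
  by (auto simp: clip_def)

lemma clip_measurable [measurable]: "clip T n \<in> borel_measurable borel"
  unfolding clip_def by measurable

lemma clip_tendsto: "0 \<le> s \<Longrightarrow> s \<le> T \<Longrightarrow> (\<lambda>n. clip T n s) \<longlonglongrightarrow> s"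
proof -
  assume s: "0 \<le> s" "s \<le> T"
  have "(\<lambda>n. max 0 (min T (grid_time n s))) \<longlonglongrightarrow> max 0 (min T s)"
    by (intro tendsto_intros grid_time_tendsto)
  then show ?thesis using s by (simp add: clip_def min_absorb2 max_absorb2)
qed

lemma clip_ge: "0 \<le> s \<Longrightarrow> s \<le> T \<Longrightarrow> s \<le> clip T n s"
  and clip_gt: "0 \<le> s \<Longrightarrow> s < T \<Longrightarrow> s < clip T n s"
  using grid_time_bounds(1)[of s n] by (auto simp: clip_def)

text \<open>Evaluating a path at uncountably many times is not measurable for the product sigma-algebra.
  Replacing the value at \<open>s\<close> by the limit along the grid uses countably many coordinates and does
  not change the integral for a right continuous path.\<close>

definition path_weight :: "('a \<Rightarrow> real) \<Rightarrow> real \<Rightarrow> (real \<Rightarrow> 'a) \<Rightarrow> real" where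
  "path_weight V T p = exp (- (LBINT s:{0..T}. V (lim (\<lambda>n. p (clip T n s)))))"

lemma path_weight_measurable [measurable]:
  assumes [measurable]: "V \<in> borel_measurable borel" and T: "0 \<le> T"
  shows "path_weight V T \<in> borel_measurable (\<Pi>\<^sub>M s\<in>{0..T}. borel)"
proof -
  have "(\<lambda>z. fst z (max 0 (min T ((of_int \<lfloor>real (Suc n) * snd z\<rfloor> + 1) / real (Suc n)))))
      \<in> borel_measurable ((\<Pi>\<^sub>M s\<in>{0..T}. (borel::'a measure)) \<Otimes>\<^sub>M lborel)" for n
  proof (rule measurable_compose_countable[where g = "\<lambda>z. \<lfloor>real (Suc n) * snd z\<rfloor>" and
        f = "\<lambda>i z. fst z (max 0 (min T ((of_int i + 1) / real (Suc n))))"])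
    show "(\<lambda>z. fst z (max 0 (min T ((of_int i + 1) / real (Suc n)))))
      \<in> borel_measurable ((\<Pi>\<^sub>M s\<in>{0..T}. (borel::'a measure)) \<Otimes>\<^sub>M (lborel :: real measure))" for i
      by (rule measurable_compose[OF measurable_fst measurable_component_singleton]) (use T in auto)
  qed measurable
  then have [measurable]: "(\<lambda>(p, s). p (clip T n s)) \<in> borel_measurable ((\<Pi>\<^sub>M s\<in>{0..T}. (borel::'a measure)) \<Otimes>\<^sub>M lborel)" for n
    by (simp add: clip_def grid_time_def split_beta')
  have [measurable]: "(\<lambda>(p, s). lim (\<lambda>n. p (clip T n s))) \<in> borel_measurable ((\<Pi>\<^sub>M s\<in>{0..T}. (borel::'a measure)) \<Otimes>\<^sub>M lborel)"
    unfolding split_beta' by (rule borel_measurable_lim_metric) (simp add: split_beta'[symmetric])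
  show ?thesis
    unfolding path_weight_def set_lebesgue_integral_def by measurable
qed

lemma path_weight_forward:
  assumes T: "0 \<le> T" and \<omega>: "\<omega> \<in> space M"
  shows "path_weight V T (\<lambda>s\<in>{0..T}. x + X s \<omega>) = fk_weight X V T x \<omega>"
proof -
  have "lim (\<lambda>n. (\<lambda>s\<in>{0..T}. x + X s \<omega>) (clip T n s)) = x + X s \<omega>" if "s \<in> {0..T}" for s
  proof (rule limI)
    have "(\<lambda>n. X (clip T n s) \<omega>) \<longlonglongrightarrow> X s \<omega>"
      by (rule right_continuous_sequence[OF \<omega>]) (use that clip_ge clip_tendsto in auto)
    then have "(\<lambda>n. x + X (clip T n s) \<omega>) \<longlonglongrightarrow> x + X s \<omega>" by (intro tendsto_intros)
    then show "(\<lambda>n. (\<lambda>s\<in>{0..T}. x + X s \<omega>) (clip T n s)) \<longlonglongrightarrow> x + X s \<omega>"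
      using clip_range[OF T] by simp
  qed
  then show ?thesis
    unfolding path_weight_def fk_weight_def by (subst set_lebesgue_integral_cong) auto
qed

text \<open>Along the reversed path the grid limit at \<open>s\<close> is the left limit of \<open>X\<close> at \<open>T - s\<close>. By the
  absence of fixed jumps and Fubini, almost surely it equals the value at almost every \<open>s\<close>, which
  suffices for the integral; the substitution of \<open>T - s\<close> for \<open>s\<close> restores the forward integral.\<close>

lemma path_weight_backward:
  assumes T: "0 < T" and V: "V \<in> borel_measurable borel"
  shows "AE \<omega> in M. \<forall>x. path_weight V T (\<lambda>s\<in>{0..T}. x + X (T - s) \<omega>) = fk_weight X V T x \<omega>"
proof -
  interpret L: pair_sigma_finite lborel M ..
  define P where "P s \<omega> \<longleftrightarrow> 0 \<le> s \<and> s < T \<longrightarrow> lim (\<lambda>n. Xp (T - clip T n s) \<omega>) = Xp (T - s) \<omega>" for s \<omega>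
  have "AE \<omega> in M. P s \<omega>" for s
  proof (cases "0 \<le> s \<and> s < T")
    case True
    then have "0 < T - s" by simp
    from no_fixed_jump[OF this] show ?thesis
    proof (rule AE_mp, intro AE_I2 impI)
      fix \<omega> assume "\<forall>v. (\<forall>n. 0 \<le> v n) \<longrightarrow> (\<forall>n. v n < T - s) \<longrightarrow> v \<longlonglongrightarrow> T - s \<longrightarrow> (\<lambda>n. X (v n) \<omega>) \<longlonglongrightarrow> X (T - s) \<omega>"
      moreover have "0 \<le> T - clip T n s" "T - clip T n s < T - s" for n
        using clip_range[of T n s] clip_gt[of s T n] True by auto
      moreover have "(\<lambda>n. T - clip T n s) \<longlonglongrightarrow> T - s"
        using True by (intro tendsto_intros clip_tendsto) auto
      ultimately have "(\<lambda>n. X (T - clip T n s) \<omega>) \<longlonglongrightarrow> X (T - s) \<omega>" by auto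
      then show "P s \<omega>" using True clip_range[of T _ s] by (simp add: P_def Xp_def max_absorb2 limI)
    qed
  next
    case False
    then have "P s \<omega>" for \<omega> by (auto simp: P_def)
    then show ?thesis by simp
  qed
  then have "AE s in lborel. AE \<omega> in M. P s \<omega>" by simp
  moreover have "{z \<in> space (lborel \<Otimes>\<^sub>M M). P (fst z) (snd z)} \<in> sets (lborel \<Otimes>\<^sub>M M)"
  proof -
    have 1: "(\<lambda>z. lim (\<lambda>n. Xp (T - clip T n (fst z)) (snd z))) \<in> borel_measurable (lborel \<Otimes>\<^sub>M M)"
      by (rule borel_measurable_lim_metric) measurable
    have 2: "(\<lambda>z. Xp (T - fst z) (snd z)) \<in> borel_measurable (lborel \<Otimes>\<^sub>M M)" by measurable
    have "Measurable.pred (lborel \<Otimes>\<^sub>M M) (\<lambda>z. lim (\<lambda>n. Xp (T - clip T n (fst z)) (snd z)) = Xp (T - fst z) (snd z))"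
    proof -
      have "(\<lambda>z. dist (lim (\<lambda>n. Xp (T - clip T n (fst z)) (snd z))) (Xp (T - fst z) (snd z))) \<in> borel_measurable (lborel \<Otimes>\<^sub>M M)"
        using 1 2 by (rule borel_measurable_dist)
      then have "Measurable.pred (lborel \<Otimes>\<^sub>M M) (\<lambda>z. dist (lim (\<lambda>n. Xp (T - clip T n (fst z)) (snd z))) (Xp (T - fst z) (snd z)) = 0)"
        by measurable
      then show ?thesis by simp
    qed
    then show ?thesis unfolding P_def by measurable
  qed
  ultimately have "AE \<omega> in M. AE s in lborel. P s \<omega>"
    by (subst L.AE_commute[symmetric]) auto
  then show ?thesis
  proof (rule AE_mp, intro AE_I2 impI allI)
    fix \<omega> x assume \<omega>: "\<omega> \<in> space M" and P: "AE s in lborel. P s \<omega>"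
    have [measurable]: "(\<lambda>s. Xp s \<omega>) \<in> borel_measurable borel"
      using measurable_Pair1[OF Xp_jointly_measurable \<omega>] by simp
    note [measurable] = V
    have [measurable]: "(\<lambda>s. lim (\<lambda>n. x + Xp (T - clip T n s) \<omega>)) \<in> borel_measurable borel"
      by measurable
    have "(LBINT s:{0..T}. V (lim (\<lambda>n. (\<lambda>s\<in>{0..T}. x + X (T - s) \<omega>) (clip T n s)))) =
          (LBINT s:{0..T}. V (lim (\<lambda>n. x + Xp (T - clip T n s) \<omega>)))"
    proof (rule set_lebesgue_integral_cong)
      have "(\<lambda>s\<in>{0..T}. x + X (T - s) \<omega>) (clip T n s) = x + Xp (T - clip T n s) \<omega>" for n s
        using clip_range[of T n s] T by (simp add: Xp_def max_absorb2)
      then show "\<forall>s. s \<in> {0..T} \<longrightarrow> V (lim (\<lambda>n. (\<lambda>s\<in>{0..T}. x + X (T - s) \<omega>) (clip T n s))) = V (lim (\<lambda>n. x + Xp (T - clip T n s) \<omega>))"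
        by simp
    qed simp
    also have "\<dots> = (LBINT s:{0..T}. V (x + Xp (T - s) \<omega>))"
      unfolding set_lebesgue_integral_def
    proof (rule integral_cong_AE)
      have "AE s in lborel. s \<noteq> T" by (rule AE_lborel_singleton)
      with P show "AE s in lborel. indicator {0..T} s *\<^sub>R V (lim (\<lambda>n. x + Xp (T - clip T n s) \<omega>)) =
          indicator {0..T} s *\<^sub>R V (x + Xp (T - s) \<omega>)"
      proof eventually_elim
        case (elim s)
        show ?case
        proof (cases "0 \<le> s \<and> s < T")
          case True
          obtain l where l: "\<And>u. (\<And>n. 0 \<le> u n) \<Longrightarrow> (\<And>n. u n < T - s) \<Longrightarrow> u \<longlonglongrightarrow> T - s \<Longrightarrow> (\<lambda>n. X (u n) \<omega>) \<longlonglongrightarrow> l"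
            using left_limit_sequence[OF \<omega>, of "T - s"] True by auto
          have "(\<lambda>n. X (T - clip T n s) \<omega>) \<longlonglongrightarrow> l"
          proof (rule l)
            show "0 \<le> T - clip T n s" "T - clip T n s < T - s" for n
              using clip_range[of T n s] clip_gt[of s T n] True by auto
            show "(\<lambda>n. T - clip T n s) \<longlonglongrightarrow> T - s"
              using True by (intro tendsto_intros clip_tendsto) auto
          qed
          then have lX: "(\<lambda>n. Xp (T - clip T n s) \<omega>) \<longlonglongrightarrow> l"
            using clip_range[of T _ s] True by (simp add: Xp_def max_absorb2)
          with elim True have "l = Xp (T - s) \<omega>" by (auto simp: P_def limI)
          with lX have "(\<lambda>n. x + Xp (T - clip T n s) \<omega>) \<longlonglongrightarrow> x + Xp (T - s) \<omega>"
            by (intro tendsto_intros) auto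
          then show ?thesis by (simp add: limI)
        qed (use elim in \<open>auto simp: indicator_def\<close>)
      qed
    qed measurable
    also have "\<dots> = (\<integral>s. (indicator {0..T} s *\<^sub>R V (x + Xp s \<omega>)) \<partial>lborel)"
      unfolding set_lebesgue_integral_def
      by (subst lborel_integral_real_affine[of "-1" _ T]) (auto intro!: Bochner_Integration.integral_cong simp: indicator_def)
    finally show "path_weight V T (\<lambda>s\<in>{0..T}. x + X (T - s) \<omega>) = fk_weight X V T x \<omega>"
      unfolding path_weight_def fk_weight_Xp set_lebesgue_integral_def by simp
  qed
qed

lemma prod_indicator_all:
  assumes "finite J"
  shows "(\<Prod>s\<in>J. indicator (A s) (f s) :: ennreal) = (if \<forall>s\<in>J. f s \<in> A s then 1 else 0)"
  using assms by (induction J) (auto simp: indicator_def)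

text \<open>The map \<open>r\<close> is the identity or the reflection at \<open>T / 2\<close>. The densities \<open>g0\<close> and \<open>g1\<close> belong
  to the two ends of the path; for integrable \<open>g0\<close> and bounded \<open>g1\<close> the law is finite, although
  the starting point ranges over Lebesgue measure.\<close>

abbreviation path_law :: "real \<Rightarrow> ('a \<Rightarrow> ennreal) \<Rightarrow> ('a \<Rightarrow> ennreal) \<Rightarrow> (real \<Rightarrow> real) \<Rightarrow> (real \<Rightarrow> 'a) measure" where
  "path_law T g0 g1 r \<equiv> distr (density (lborel \<Otimes>\<^sub>M M) (\<lambda>(x, \<omega>). g0 (x + X (r 0) \<omega>) * g1 (x + X (r T) \<omega>))) (\<Pi>\<^sub>M s\<in>{0..T}. borel)
     (\<lambda>(x, \<omega>). \<lambda>s\<in>{0..T}. x + X (r s) \<omega>)"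

text \<open>Both measures are finite, so it is enough to compare them on cylinder sets, where this is
  reversal of finite-dimensional distributions.\<close>

lemma path_law_reversal:
  fixes g0 g1 :: "'a \<Rightarrow> ennreal"
  assumes T: "0 < T" and [measurable]: "g0 \<in> borel_measurable borel" "g1 \<in> borel_measurable borel"
    and g1: "\<And>y. g1 y \<le> 1" and g0: "(\<integral>\<^sup>+x. g0 x \<partial>lborel) < \<infinity>"
  shows "path_law T g0 g1 (\<lambda>s. s) =
         path_law T g0 g1 (\<lambda>s. T - s)"
    (is "?Q = ?Q'")
proof -
  interpret L: pair_sigma_finite lborel M ..
  have XT [measurable]: "X T \<in> borel_measurable M" "X 0 \<in> borel_measurable M"
    using T by (auto intro: X_measurable)
  have Xs: "(\<lambda>z. fst z + X s (snd z)) \<in> borel_measurable (lborel \<Otimes>\<^sub>M M)" if "0 \<le> s" for s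
    using X_measurable[OF that] by measurable
  have F [measurable]: "(\<lambda>(x, \<omega>). \<lambda>s\<in>{0..T}. x + X s \<omega>) \<in> (lborel \<Otimes>\<^sub>M M) \<rightarrow>\<^sub>M (\<Pi>\<^sub>M s\<in>{0..T}. borel)"
    unfolding split_beta' by (rule measurable_restrict) (use Xs in auto)
  have B [measurable]: "(\<lambda>(x, \<omega>). \<lambda>s\<in>{0..T}. x + X (T - s) \<omega>) \<in> (lborel \<Otimes>\<^sub>M M) \<rightarrow>\<^sub>M (\<Pi>\<^sub>M s\<in>{0..T}. borel)"
    unfolding split_beta' by (rule measurable_restrict) (use Xs in auto)
  \<comment> \<open>The indicator of a cylinder and the two densities as one product over the times in \<open>J\<close>, 0 and
    \<open>T\<close>; a time in \<open>J\<close> may coincide with one of the ends.\<close>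
  define W where "W J A s y = (if s \<in> J then indicator (A s) y else 1) * (if s = 0 then g0 y else 1) * (if s = T then g1 y else 1)"
    for J and A :: "real \<Rightarrow> 'a set" and s :: real and y :: 'a
  have cyl: "emeasure (path_law T g0 g1 r) (prod_emb {0..T} (\<lambda>_. borel) J (Pi\<^sub>E J A)) =
      (\<integral>\<^sup>+x. (\<integral>\<^sup>+\<omega>. (\<Prod>s\<in>insert 0 (insert T J). W J A s (x + X (r s) \<omega>)) \<partial>M) \<partial>lborel)"
    if J: "finite J" "J \<subseteq> {0..T}" "\<And>s. s \<in> J \<Longrightarrow> A s \<in> sets borel" and r: "\<And>s. s \<in> {0..T} \<Longrightarrow> r s \<in> {0..T}"
      and H [measurable]: "(\<lambda>(x, \<omega>). \<lambda>s\<in>{0..T}. x + X (r s) \<omega>) \<in> (lborel \<Otimes>\<^sub>M M) \<rightarrow>\<^sub>M (\<Pi>\<^sub>M s\<in>{0..T}. borel)"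
    for J A r
  proof -
    have r0: "0 \<le> r 0" "0 \<le> r T" using r[of 0] r[of T] T by auto
    note [measurable] = X_measurable[OF r0(1)] X_measurable[OF r0(2)]
    have C [measurable]: "prod_emb {0..T} (\<lambda>_. borel) J (Pi\<^sub>E J A) \<in> sets (\<Pi>\<^sub>M s\<in>{0..T}. borel)"
      using J by (intro sets_PiM_I) auto
    have "emeasure (path_law T g0 g1 r) (prod_emb {0..T} (\<lambda>_. borel) J (Pi\<^sub>E J A)) =
       (\<integral>\<^sup>+p. indicator (prod_emb {0..T} (\<lambda>_. borel) J (Pi\<^sub>E J A)) p
          \<partial>(path_law T g0 g1 r))"
      by simp
    also have "\<dots> = (\<integral>\<^sup>+z. (case z of (x, \<omega>) \<Rightarrow> g0 (x + X (r 0) \<omega>) * g1 (x + X (r T) \<omega>)) *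
         indicator (prod_emb {0..T} (\<lambda>_. borel) J (Pi\<^sub>E J A)) (case z of (x, \<omega>) \<Rightarrow> \<lambda>s\<in>{0..T}. x + X (r s) \<omega>) \<partial>(lborel \<Otimes>\<^sub>M M))"
      by (subst nn_integral_distr, measurable, subst nn_integral_density) auto
    also have "\<dots> = (\<integral>\<^sup>+z. (\<lambda>(x, \<omega>). (\<Prod>s\<in>insert 0 (insert T J). W J A s (x + X (r s) \<omega>))) z \<partial>(lborel \<Otimes>\<^sub>M M))"
    proof (intro nn_integral_cong)
      fix z :: "'a \<times> 'w"
      obtain x \<omega> where z: "z = (x, \<omega>)" by (cases z)
      define S where "S = insert 0 (insert T J)"
      have S: "finite S" "0 \<in> S" "T \<in> S" "J \<subseteq> S" using J by (auto simp: S_def)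
      have "(\<lambda>s\<in>{0..T}. x + X (r s) \<omega>) \<in> prod_emb {0..T} (\<lambda>_. borel) J (Pi\<^sub>E J A) \<longleftrightarrow> (\<forall>s\<in>J. x + X (r s) \<omega> \<in> A s)"
        using J(2) by (auto simp: prod_emb_def restrict_def PiE_iff extensional_def subset_iff)
      then have 1: "(indicator (prod_emb {0..T} (\<lambda>_. borel) J (Pi\<^sub>E J A)) (\<lambda>s\<in>{0..T}. x + X (r s) \<omega>) :: ennreal) =
          (\<Prod>s\<in>J. indicator (A s) (x + X (r s) \<omega>))"
        unfolding prod_indicator_all[OF J(1)] by (simp add: indicator_def)
      have 2: "(\<Prod>s\<in>S. if s \<in> J then indicator (A s) (x + X (r s) \<omega>) else (1::ennreal)) = (\<Prod>s\<in>J. indicator (A s) (x + X (r s) \<omega>))"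
        using S by (simp add: prod.inter_restrict[symmetric] Int_absorb1)
      have "(\<Prod>s\<in>S. W J A s (x + X (r s) \<omega>)) =
          (\<Prod>s\<in>J. indicator (A s) (x + X (r s) \<omega>)) * g0 (x + X (r 0) \<omega>) * g1 (x + X (r T) \<omega>)"
        unfolding W_def prod.distrib 2 using S by simp
      then show "(case z of (x, \<omega>) \<Rightarrow> g0 (x + X (r 0) \<omega>) * g1 (x + X (r T) \<omega>)) *
         indicator (prod_emb {0..T} (\<lambda>_. borel) J (Pi\<^sub>E J A)) (case z of (x, \<omega>) \<Rightarrow> \<lambda>s\<in>{0..T}. x + X (r s) \<omega>) =
         (\<lambda>(x, \<omega>). (\<Prod>s\<in>insert 0 (insert T J). W J A s (x + X (r s) \<omega>))) z"
        by (simp add: z 1 S_def ac_simps)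
    qed
    also have "\<dots> = (\<integral>\<^sup>+x. (\<integral>\<^sup>+\<omega>. (\<Prod>s\<in>insert 0 (insert T J). W J A s (x + X (r s) \<omega>)) \<partial>M) \<partial>lborel)"
    proof (subst nn_integral_fst[symmetric])
      show "(\<lambda>(x, \<omega>). \<Prod>s\<in>insert 0 (insert T J). W J A s (x + X (r s) \<omega>)) \<in> borel_measurable (lborel \<Otimes>\<^sub>M M)"
        unfolding split_beta'
      proof (rule borel_measurable_prod_ennreal)
        fix s assume s: "s \<in> insert 0 (insert T J)"
        then have "W J A s \<in> borel_measurable borel" unfolding W_def using J(3) by (cases "s \<in> J") auto
        moreover have "0 \<le> r s" using s r[of s] J(2) T by auto
        ultimately show "(\<lambda>z. W J A s (fst z + X (r s) (snd z))) \<in> borel_measurable (lborel \<Otimes>\<^sub>M M)"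
          by (intro measurable_compose[OF Xs])
      qed
    qed simp
    finally show ?thesis .
  qed
  show ?thesis
  proof (rule measure_eqI_PiM_infinite)
    fix A and J :: "real set"
    assume J: "finite J" "J \<subseteq> {0..T}" and A: "\<And>s. s \<in> J \<Longrightarrow> A s \<in> sets (borel :: 'a measure)"
    have Wm: "W J A s \<in> borel_measurable borel" for s
      unfolding W_def using A by (cases "s \<in> J") auto
    have "emeasure ?Q (prod_emb {0..T} (\<lambda>_. borel) J (Pi\<^sub>E J A)) =
        (\<integral>\<^sup>+x. (\<integral>\<^sup>+\<omega>. (\<Prod>s\<in>insert 0 (insert T J). W J A s (x + X s \<omega>)) \<partial>M) \<partial>lborel)"
      by (rule cyl[of J A "\<lambda>s. s"]) (use J A F in auto)
    also have "\<dots> = (\<integral>\<^sup>+x. (\<integral>\<^sup>+\<omega>. (\<Prod>s\<in>insert 0 (insert T J). W J A s (x + X (T - s) \<omega>)) \<partial>M) \<partial>lborel)"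
      by (rule finite_dimensional_reversal) (use J T Wm in auto)
    also have "\<dots> = emeasure ?Q' (prod_emb {0..T} (\<lambda>_. borel) J (Pi\<^sub>E J A))"
      using cyl[of J A "\<lambda>s. T - s"] J A B by simp
    finally show "emeasure ?Q (prod_emb {0..T} (\<lambda>_. borel) J (Pi\<^sub>E J A)) = emeasure ?Q' (prod_emb {0..T} (\<lambda>_. borel) J (Pi\<^sub>E J A))" .
  next
    show "finite_measure ?Q"
    proof
      have "emeasure ?Q (space ?Q) = (\<integral>\<^sup>+p. 1 \<partial>?Q)" by simp
      also have "\<dots> = (\<integral>\<^sup>+z. (case z of (x, \<omega>) \<Rightarrow> g0 (x + X 0 \<omega>) * g1 (x + X T \<omega>)) \<partial>(lborel \<Otimes>\<^sub>M M))"
        by (subst nn_integral_distr, measurable, subst nn_integral_density) auto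
      also have "\<dots> \<le> (\<integral>\<^sup>+z. (case z of (x, \<omega>) \<Rightarrow> g0 (x + X 0 \<omega>)) \<partial>(lborel \<Otimes>\<^sub>M M))"
        using mult_left_mono[OF g1] by (intro nn_integral_mono) (auto simp: split_beta')
      also have "\<dots> = (\<integral>\<^sup>+\<omega>. (\<integral>\<^sup>+x. g0 (x + X 0 \<omega>) \<partial>lborel) \<partial>M)"
        by (subst L.nn_integral_snd[symmetric]) auto
      also have "\<dots> = (\<integral>\<^sup>+x. g0 x \<partial>lborel)"
        by (subst nn_integral_lborel_shift) (auto simp: emeasure_space_1)
      finally show "emeasure ?Q (space ?Q) \<noteq> \<infinity>" using g0 by auto
    qed
  qed auto
qed

text \<open>The weight of a path is unchanged by reversal, while the two end points are exchanged.\<close>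

lemma fk_weight_reversal:
  fixes g0 g1 :: "'a \<Rightarrow> ennreal" and h :: "real \<Rightarrow> ennreal"
  assumes T: "0 < T" and [measurable]: "g0 \<in> borel_measurable borel" "g1 \<in> borel_measurable borel" "V \<in> borel_measurable borel" "h \<in> borel_measurable borel"
    and g1: "\<And>y. g1 y \<le> 1" and g0: "(\<integral>\<^sup>+x. g0 x \<partial>lborel) < \<infinity>"
  shows "(\<integral>\<^sup>+z. (case z of (x, \<omega>) \<Rightarrow> g0 x * g1 (x + X T \<omega>) * h (fk_weight X V T x \<omega>)) \<partial>(lborel \<Otimes>\<^sub>M M)) =
         (\<integral>\<^sup>+z. (case z of (x, \<omega>) \<Rightarrow> g0 (x + X T \<omega>) * g1 x * h (fk_weight X V T x \<omega>)) \<partial>(lborel \<Otimes>\<^sub>M M))"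
proof -
  interpret L: pair_sigma_finite lborel M ..
  have [measurable]: "X T \<in> borel_measurable M" "X 0 \<in> borel_measurable M"
    using T by (auto intro: X_measurable)
  have Xs: "(\<lambda>z. fst z + X s (snd z)) \<in> borel_measurable (lborel \<Otimes>\<^sub>M M)" if "0 \<le> s" for s
    using X_measurable[OF that] by measurable
  have F [measurable]: "(\<lambda>(x, \<omega>). \<lambda>s\<in>{0..T}. x + X s \<omega>) \<in> (lborel \<Otimes>\<^sub>M M) \<rightarrow>\<^sub>M (\<Pi>\<^sub>M s\<in>{0..T}. borel)"
    unfolding split_beta' by (rule measurable_restrict) (use Xs in auto)
  have B [measurable]: "(\<lambda>(x, \<omega>). \<lambda>s\<in>{0..T}. x + X (T - s) \<omega>) \<in> (lborel \<Otimes>\<^sub>M M) \<rightarrow>\<^sub>M (\<Pi>\<^sub>M s\<in>{0..T}. borel)"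
    unfolding split_beta' by (rule measurable_restrict) (use Xs in auto)
  have [measurable]: "path_weight V T \<in> borel_measurable (\<Pi>\<^sub>M s\<in>{0..T}. borel)"
    by (rule path_weight_measurable) (use T in auto)
  have AE0: "AE z in lborel \<Otimes>\<^sub>M M. X 0 (snd z) = 0"
  proof (rule L.AE_pair_measure)
    show "{z \<in> space (lborel \<Otimes>\<^sub>M M). X 0 (snd z) = 0} \<in> sets (lborel \<Otimes>\<^sub>M M)" by measurable
  qed (use X_0 in auto)
  have AEB: "AE z in lborel \<Otimes>\<^sub>M M. path_weight V T (case z of (x, \<omega>) \<Rightarrow> \<lambda>s\<in>{0..T}. x + X (T - s) \<omega>) = (case z of (x, \<omega>) \<Rightarrow> fk_weight X V T x \<omega>)"
  proof (rule L.AE_pair_measure)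
    show "{z \<in> space (lborel \<Otimes>\<^sub>M M). path_weight V T (case z of (x, \<omega>) \<Rightarrow> \<lambda>s\<in>{0..T}. x + X (T - s) \<omega>) = (case z of (x, \<omega>) \<Rightarrow> fk_weight X V T x \<omega>)}
      \<in> sets (lborel \<Otimes>\<^sub>M M)"
      by measurable
    show "AE x in lborel. AE \<omega> in M. path_weight V T (case (x, \<omega>) of (x, \<omega>) \<Rightarrow> \<lambda>s\<in>{0..T}. x + X (T - s) \<omega>) = (case (x, \<omega>) of (x, \<omega>) \<Rightarrow> fk_weight X V T x \<omega>)"
    proof (rule AE_I2)
      fix x
      have "AE \<omega> in M. \<forall>x. path_weight V T (\<lambda>s\<in>{0..T}. x + X (T - s) \<omega>) = fk_weight X V T x \<omega>"
        by (rule path_weight_backward[OF T]) measurable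
      then show "AE \<omega> in M. path_weight V T (case (x, \<omega>) of (x, \<omega>) \<Rightarrow> \<lambda>s\<in>{0..T}. x + X (T - s) \<omega>) = (case (x, \<omega>) of (x, \<omega>) \<Rightarrow> fk_weight X V T x \<omega>)"
        by eventually_elim simp
    qed
  qed
  have "(\<integral>\<^sup>+z. (case z of (x, \<omega>) \<Rightarrow> g0 x * g1 (x + X T \<omega>) * h (fk_weight X V T x \<omega>)) \<partial>(lborel \<Otimes>\<^sub>M M)) =
     (\<integral>\<^sup>+z. (case z of (x, \<omega>) \<Rightarrow> g0 (x + X 0 \<omega>) * g1 (x + X T \<omega>)) * h (path_weight V T (case z of (x, \<omega>) \<Rightarrow> \<lambda>s\<in>{0..T}. x + X s \<omega>)) \<partial>(lborel \<Otimes>\<^sub>M M))"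
  proof (rule nn_integral_cong_AE)
    show "AE z in lborel \<Otimes>\<^sub>M M. (case z of (x, \<omega>) \<Rightarrow> g0 x * g1 (x + X T \<omega>) * h (fk_weight X V T x \<omega>)) =
      (case z of (x, \<omega>) \<Rightarrow> g0 (x + X 0 \<omega>) * g1 (x + X T \<omega>)) * h (path_weight V T (case z of (x, \<omega>) \<Rightarrow> \<lambda>s\<in>{0..T}. x + X s \<omega>))"
      using AE0 AE_space
    proof eventually_elim
      case (elim z)
      then show ?case using T by (cases z) (auto simp: path_weight_forward space_pair_measure)
    qed
  qed
  also have "\<dots> = (\<integral>\<^sup>+p. h (path_weight V T p) \<partial>(path_law T g0 g1 (\<lambda>s. s)))"
    by (subst nn_integral_distr, measurable, subst nn_integral_density) auto
  also have "\<dots> = (\<integral>\<^sup>+p. h (path_weight V T p) \<partial>(path_law T g0 g1 (\<lambda>s. T - s)))"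
    by (subst path_law_reversal) (use T g1 g0 in auto)
  also have "\<dots> = (\<integral>\<^sup>+z. (case z of (x, \<omega>) \<Rightarrow> g0 (x + X T \<omega>) * g1 (x + X 0 \<omega>)) * h (path_weight V T (case z of (x, \<omega>) \<Rightarrow> \<lambda>s\<in>{0..T}. x + X (T - s) \<omega>)) \<partial>(lborel \<Otimes>\<^sub>M M))"
    by (subst nn_integral_distr, measurable, subst nn_integral_density) auto
  also have "\<dots> = (\<integral>\<^sup>+z. (case z of (x, \<omega>) \<Rightarrow> g0 (x + X T \<omega>) * g1 x * h (fk_weight X V T x \<omega>)) \<partial>(lborel \<Otimes>\<^sub>M M))"
    by (rule nn_integral_cong_AE) (use AE0 AEB in \<open>eventually_elim, auto\<close>)
  finally show ?thesis .
qed

text \<open>The measure on pairs of end points with the Feynman-Kac weight need not be finite.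
  Truncating the weight and restricting both end points to a ball makes it so, and then equality
  on rectangles proves symmetry; monotone convergence removes the truncation.\<close>

lemma fk_symmetric:
  fixes F :: "'a \<times> 'a \<Rightarrow> ennreal"
  assumes T: "0 < T" and V [measurable]: "V \<in> borel_measurable borel" and F [measurable]: "F \<in> borel_measurable (borel \<Otimes>\<^sub>M borel)"
  shows "(\<integral>\<^sup>+z. (case z of (x, \<omega>) \<Rightarrow> ennreal (fk_weight X V T x \<omega>) * F (x, x + X T \<omega>)) \<partial>(lborel \<Otimes>\<^sub>M M)) =
         (\<integral>\<^sup>+z. (case z of (x, \<omega>) \<Rightarrow> ennreal (fk_weight X V T x \<omega>) * F (x + X T \<omega>, x)) \<partial>(lborel \<Otimes>\<^sub>M M))"
proof -
  interpret L: pair_sigma_finite lborel M ..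
  have [measurable]: "X T \<in> borel_measurable M" using T by (auto intro: X_measurable)
  have [measurable]: "(\<lambda>z. fk_weight X V T (fst z) (snd z)) \<in> borel_measurable (lborel \<Otimes>\<^sub>M M)"
    using fk_weight_measurable[OF V, of T]
    by (subst measurable_cong_sets[OF sets_pair_measure_cong[OF sets_lborel refl] refl]) (simp add: split_beta')
  have [measurable]: "ball (0::'a) r \<in> sets borel" for r by simp
  define v where "v n z = ennreal (min (real n) (fk_weight X V T (fst z) (snd z))) * indicator (ball 0 (real n)) (fst z)
      * indicator (ball 0 (real n)) (fst z + X T (snd z))" for n :: nat and z
  have [measurable]: "v n \<in> borel_measurable (lborel \<Otimes>\<^sub>M M)" for n
    unfolding v_def by measurable
  define e where "e z = (fst z, fst z + X T (snd z))" for z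
  define e' where "e' z = (fst z + X T (snd z), fst z)" for z
  have [measurable]: "e \<in> (lborel \<Otimes>\<^sub>M M) \<rightarrow>\<^sub>M (borel \<Otimes>\<^sub>M borel)" "e' \<in> (lborel \<Otimes>\<^sub>M M) \<rightarrow>\<^sub>M (borel \<Otimes>\<^sub>M borel)"
    unfolding e_def e'_def by measurable
  have rect: "(\<integral>\<^sup>+z. v n z * indicator (A \<times> B) (e z) \<partial>(lborel \<Otimes>\<^sub>M M)) = (\<integral>\<^sup>+z. v n z * indicator (A \<times> B) (e' z) \<partial>(lborel \<Otimes>\<^sub>M M))"
    if [measurable]: "A \<in> sets borel" "B \<in> sets borel" for A B n
  proof -
    have "emeasure lborel (A \<inter> ball 0 (real n)) < \<infinity>"
      by (intro emeasure_bounded_finite bounded_Int) auto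
    then have fin: "(\<integral>\<^sup>+x. indicator (A \<inter> ball 0 (real n)) x \<partial>lborel) < \<infinity>" by simp
    have *: "indicator (B \<inter> ball 0 (real n)) y \<le> (1::ennreal)" for y by (auto simp: indicator_def)
    have "(\<integral>\<^sup>+z. v n z * indicator (A \<times> B) (e z) \<partial>(lborel \<Otimes>\<^sub>M M)) =
      (\<integral>\<^sup>+z. (case z of (x, \<omega>) \<Rightarrow> indicator (A \<inter> ball 0 (real n)) x * indicator (B \<inter> ball 0 (real n)) (x + X T \<omega>) * ennreal (min (real n) (fk_weight X V T x \<omega>))) \<partial>(lborel \<Otimes>\<^sub>M M))"
      by (intro nn_integral_cong) (auto simp: v_def e_def indicator_def)
    also have "\<dots> = (\<integral>\<^sup>+z. (case z of (x, \<omega>) \<Rightarrow> indicator (A \<inter> ball 0 (real n)) (x + X T \<omega>) * indicator (B \<inter> ball 0 (real n)) x * ennreal (min (real n) (fk_weight X V T x \<omega>))) \<partial>(lborel \<Otimes>\<^sub>M M))"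
      by (rule fk_weight_reversal[OF T _ _ V _ * fin]) measurable
    also have "\<dots> = (\<integral>\<^sup>+z. v n z * indicator (A \<times> B) (e' z) \<partial>(lborel \<Otimes>\<^sub>M M))"
      by (intro nn_integral_cong) (auto simp: v_def e'_def indicator_def)
    finally show ?thesis .
  qed
  have trunc: "distr (density (lborel \<Otimes>\<^sub>M M) (v n)) (borel \<Otimes>\<^sub>M borel) e = distr (density (lborel \<Otimes>\<^sub>M M) (v n)) (borel \<Otimes>\<^sub>M borel) e'" (is "?K = ?K'") for n
  proof (rule measure_eqI_generator_eq[where E = "{A \<times> B | A B. A \<in> sets borel \<and> B \<in> sets borel}" and \<Omega> = UNIV and A = "\<lambda>_. UNIV"])
    have em: "emeasure (distr (density (lborel \<Otimes>\<^sub>M M) (v n)) (borel \<Otimes>\<^sub>M borel) k) C = (\<integral>\<^sup>+z. v n z * indicator C (k z) \<partial>(lborel \<Otimes>\<^sub>M M))"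
      if [measurable]: "k \<in> (lborel \<Otimes>\<^sub>M M) \<rightarrow>\<^sub>M (borel \<Otimes>\<^sub>M borel)" "C \<in> sets (borel \<Otimes>\<^sub>M borel)" for k C
    proof -
      have "emeasure (distr (density (lborel \<Otimes>\<^sub>M M) (v n)) (borel \<Otimes>\<^sub>M borel) k) C =
         (\<integral>\<^sup>+p. indicator C p \<partial>(distr (density (lborel \<Otimes>\<^sub>M M) (v n)) (borel \<Otimes>\<^sub>M borel) k))"
        by simp
      also have "\<dots> = (\<integral>\<^sup>+z. v n z * indicator C (k z) \<partial>(lborel \<Otimes>\<^sub>M M))"
        by (subst nn_integral_distr, measurable, subst nn_integral_density) auto
      finally show ?thesis .
    qed
    show "Int_stable {A \<times> B | A B. A \<in> sets (borel :: 'a measure) \<and> B \<in> sets (borel :: 'a measure)}"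
      by (rule Int_stable_pair_measure_generator)
    fix C assume "C \<in> {A \<times> B | A B. A \<in> sets (borel :: 'a measure) \<and> B \<in> sets (borel :: 'a measure)}"
    then obtain A B where C: "C = A \<times> B" "A \<in> sets borel" "B \<in> sets borel" by blast
    then show "emeasure ?K C = emeasure ?K' C"
      using rect[OF C(2,3)] by (simp add: em)
  next
    show "emeasure ?K UNIV \<noteq> \<infinity>" for i :: nat
    proof -
      have "emeasure ?K UNIV = (\<integral>\<^sup>+p. 1 \<partial>?K)" by (simp add: space_pair_measure)
      also have "\<dots> = (\<integral>\<^sup>+z. v n z \<partial>(lborel \<Otimes>\<^sub>M M))"
        by (subst nn_integral_distr, measurable, subst nn_integral_density) auto
      also have "\<dots> \<le> (\<integral>\<^sup>+z. ennreal (real n) * indicator (ball (0::'a) (real n)) (fst z) \<partial>(lborel \<Otimes>\<^sub>M M))"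
        by (intro nn_integral_mono) (auto simp: v_def indicator_def intro!: ennreal_leI)
      also have "\<dots> = (\<integral>\<^sup>+x. ennreal (real n) * indicator (ball 0 (real n)) x \<partial>(lborel :: 'a measure))"
        by (subst nn_integral_fst[symmetric]) (auto simp: emeasure_space_1)
      also have "\<dots> = ennreal (real n) * emeasure lborel (ball (0::'a) (real n))"
        by (rule nn_integral_cmult_indicator) simp
      also have "\<dots> < \<infinity>"
        using emeasure_bounded_finite[of "ball (0::'a) (real n)"] by (simp add: ennreal_mult_less_top)
      finally show ?thesis by simp
    qed
  next
    show "range (\<lambda>_::nat. UNIV) \<subseteq> {A \<times> B | A B. A \<in> sets (borel :: 'a measure) \<and> B \<in> sets (borel :: 'a measure)}"
      by (auto intro!: exI[of _ UNIV])
  qed (auto simp: sets_pair_measure)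
  have eq: "(\<integral>\<^sup>+z. v n z * F (e z) \<partial>(lborel \<Otimes>\<^sub>M M)) = (\<integral>\<^sup>+z. v n z * F (e' z) \<partial>(lborel \<Otimes>\<^sub>M M))" for n
  proof -
    have "(\<integral>\<^sup>+z. v n z * F (k z) \<partial>(lborel \<Otimes>\<^sub>M M)) = (\<integral>\<^sup>+p. F p \<partial>(distr (density (lborel \<Otimes>\<^sub>M M) (v n)) (borel \<Otimes>\<^sub>M borel) k))"
      if [measurable]: "k \<in> (lborel \<Otimes>\<^sub>M M) \<rightarrow>\<^sub>M (borel \<Otimes>\<^sub>M borel)" for k
      by (subst nn_integral_distr, measurable, subst nn_integral_density) auto
    then show ?thesis by (simp add: trunc)
  qed
  have lim: "(\<lambda>n. \<integral>\<^sup>+z. v n z * F (k z) \<partial>(lborel \<Otimes>\<^sub>M M)) \<longlonglongrightarrow> (\<integral>\<^sup>+z. ennreal (fk_weight X V T (fst z) (snd z)) * F (k z) \<partial>(lborel \<Otimes>\<^sub>M M))"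
    if [measurable]: "k \<in> (lborel \<Otimes>\<^sub>M M) \<rightarrow>\<^sub>M (borel \<Otimes>\<^sub>M borel)" for k
  proof (rule nn_integral_LIMSEQ)
    show "incseq (\<lambda>n z. v n z * F (k z))"
      unfolding v_def by (intro incseq_SucI le_funI mult_mono) (auto simp: indicator_def intro!: ennreal_leI)
    fix z :: "'a \<times> 'w"
    define b where "b = nat \<lceil>max (fk_weight X V T (fst z) (snd z)) (max (norm (fst z)) (norm (fst z + X T (snd z)))) + 1\<rceil>"
    have "\<forall>\<^sub>F n in sequentially. v n z * F (k z) = ennreal (fk_weight X V T (fst z) (snd z)) * F (k z)"
      using eventually_ge_at_top[of b]
    proof eventually_elim
      case (elim n)
      then have "max (fk_weight X V T (fst z) (snd z)) (max (norm (fst z)) (norm (fst z + X T (snd z)))) + 1 \<le> real n"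
        unfolding b_def by linarith
      then show ?case by (simp add: v_def)
    qed
    then show "(\<lambda>n. v n z * F (k z)) \<longlonglongrightarrow> ennreal (fk_weight X V T (fst z) (snd z)) * F (k z)"
      by (rule tendsto_eventually)
  qed measurable
  have "(\<integral>\<^sup>+z. ennreal (fk_weight X V T (fst z) (snd z)) * F (e z) \<partial>(lborel \<Otimes>\<^sub>M M)) =
      (\<integral>\<^sup>+z. ennreal (fk_weight X V T (fst z) (snd z)) * F (e' z) \<partial>(lborel \<Otimes>\<^sub>M M))"
  proof (rule LIMSEQ_unique)
    show "(\<lambda>n. \<integral>\<^sup>+z. v n z * F (e z) \<partial>(lborel \<Otimes>\<^sub>M M)) \<longlonglongrightarrow> (\<integral>\<^sup>+z. ennreal (fk_weight X V T (fst z) (snd z)) * F (e z) \<partial>(lborel \<Otimes>\<^sub>M M))"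
      by (rule lim) measurable
    show "(\<lambda>n. \<integral>\<^sup>+z. v n z * F (e z) \<partial>(lborel \<Otimes>\<^sub>M M)) \<longlonglongrightarrow> (\<integral>\<^sup>+z. ennreal (fk_weight X V T (fst z) (snd z)) * F (e' z) \<partial>(lborel \<Otimes>\<^sub>M M))"
      unfolding eq by (rule lim) measurable
  qed
  then show ?thesis by (simp add: split_beta' e_def e'_def)
qed

end

section \<open>The ground state transform as a semigroup of self-adjoint contractions\<close>

lemma feynman_kac_weight:
  "feynman_kac M X V t g x = (\<integral>\<omega>. fk_weight X V t x \<omega> * g (x + X t \<omega>) \<partial>M)"
  by (simp add: feynman_kac_def fk_weight_def)

locale fk_setting = sym_levy M X for M :: "'w measure" and X :: "real \<Rightarrow> 'w \<Rightarrow> 'a::euclidean_space" +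
  fixes V :: "'a \<Rightarrow> real"
  assumes V_measurable [measurable]: "V \<in> borel_measurable borel"
begin

sublocale L: pair_sigma_finite lborel M ..

abbreviation fk :: "real \<Rightarrow> ('a \<Rightarrow> real) \<Rightarrow> 'a \<Rightarrow> real" where "fk \<equiv> feynman_kac M X V"
abbreviation w :: "real \<Rightarrow> 'a \<Rightarrow> 'w \<Rightarrow> real" where "w \<equiv> fk_weight X V"

lemma w_pos: "0 < w t x \<omega>"
  by (simp add: fk_weight_def)

lemma w_nonneg [simp]: "0 \<le> w t x \<omega>"
  by (simp add: fk_weight_def)

lemma w_measurable [measurable]: "(\<lambda>z. w t (fst z) (snd z)) \<in> borel_measurable (lborel \<Otimes>\<^sub>M M)"
  using fk_weight_measurable[OF V_measurable, of t]
  by (subst measurable_cong_sets[OF sets_pair_measure_cong[OF sets_lborel refl] refl]) (simp add: split_beta')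

lemma w_measurable2 [measurable]: "(\<lambda>\<omega>. w t x \<omega>) \<in> borel_measurable M"
  using measurable_Pair2[OF fk_weight_measurable[OF V_measurable, of t], of x] by simp

lemma end_measurable: "0 < t \<Longrightarrow> (\<lambda>z. (fst z, fst z + X t (snd z))) \<in> (lborel \<Otimes>\<^sub>M M) \<rightarrow>\<^sub>M (borel \<Otimes>\<^sub>M borel)"
  using X_measurable[of t] by measurable

text \<open>The measure on pairs of points with \<open>\<integral>\<integral> u x * v y = (u, T\<^sub>t v)\<close>.\<close>

definition kappa :: "real \<Rightarrow> ('a \<times> 'a) measure" where
  "kappa t = distr (density (lborel \<Otimes>\<^sub>M M) (\<lambda>z. ennreal (w t (fst z) (snd z)))) (borel \<Otimes>\<^sub>M borel) (\<lambda>z. (fst z, fst z + X t (snd z)))"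

lemma sets_kappa [measurable_cong, simp]: "sets (kappa t) = sets (borel \<Otimes>\<^sub>M borel)"
  by (simp add: kappa_def)

lemma nn_integral_kappa:
  assumes t: "0 < t" and [measurable]: "F \<in> borel_measurable (borel \<Otimes>\<^sub>M borel)"
  shows "(\<integral>\<^sup>+p. F p \<partial>kappa t) = (\<integral>\<^sup>+x. (\<integral>\<^sup>+\<omega>. ennreal (w t x \<omega>) * F (x, x + X t \<omega>) \<partial>M) \<partial>lborel)"
proof -
  note [measurable] = end_measurable[OF t]
  have "(\<integral>\<^sup>+p. F p \<partial>kappa t) = (\<integral>\<^sup>+z. ennreal (w t (fst z) (snd z)) * F (fst z, fst z + X t (snd z)) \<partial>(lborel \<Otimes>\<^sub>M M))"
    unfolding kappa_def by (subst nn_integral_distr, measurable, subst nn_integral_density) auto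
  also have "\<dots> = (\<integral>\<^sup>+x. (\<integral>\<^sup>+\<omega>. ennreal (w t x \<omega>) * F (x, x + X t \<omega>) \<partial>M) \<partial>lborel)"
    by (subst nn_integral_fst[symmetric]) auto
  finally show ?thesis .
qed

lemma kappa_swap:
  assumes t: "0 < t" and [measurable]: "F \<in> borel_measurable (borel \<Otimes>\<^sub>M borel)"
  shows "(\<integral>\<^sup>+p. F p \<partial>kappa t) = (\<integral>\<^sup>+p. F (snd p, fst p) \<partial>kappa t)"
proof -
  note [measurable] = end_measurable[OF t]
  have k: "(\<integral>\<^sup>+p. G p \<partial>kappa t) = (\<integral>\<^sup>+z. ennreal (w t (fst z) (snd z)) * G (fst z, fst z + X t (snd z)) \<partial>(lborel \<Otimes>\<^sub>M M))"
    if [measurable]: "G \<in> borel_measurable (borel \<Otimes>\<^sub>M borel)" for G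
    unfolding kappa_def by (subst nn_integral_distr, measurable, subst nn_integral_density) auto
  show ?thesis
    using fk_symmetric[OF t V_measurable assms(2)] by (subst (1 2) k) (auto simp: split_beta')
qed

lemma kappa_swap_measure: "0 < t \<Longrightarrow> distr (kappa t) (borel \<Otimes>\<^sub>M borel) (\<lambda>p. (snd p, fst p)) = kappa t"
proof (rule measure_eqI)
  fix A assume t: "0 < t" and "A \<in> sets (distr (kappa t) (borel \<Otimes>\<^sub>M borel) (\<lambda>p. (snd p, fst p)))"
  then have [measurable]: "A \<in> sets (borel \<Otimes>\<^sub>M borel)" by simp
  have "emeasure (distr (kappa t) (borel \<Otimes>\<^sub>M borel) (\<lambda>p. (snd p, fst p))) A =
      (\<integral>\<^sup>+p. indicator A p \<partial>(distr (kappa t) (borel \<Otimes>\<^sub>M borel) (\<lambda>p. (snd p, fst p))))" by simp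
  also have "\<dots> = (\<integral>\<^sup>+p. indicator A (snd p, fst p) \<partial>kappa t)" by (subst nn_integral_distr) auto
  also have "\<dots> = (\<integral>\<^sup>+p. indicator A p \<partial>kappa t)" by (rule kappa_swap[OF t, symmetric]) measurable
  finally show "emeasure (distr (kappa t) (borel \<Otimes>\<^sub>M borel) (\<lambda>p. (snd p, fst p))) A = emeasure (kappa t) A" by simp
qed simp

lemma integral_kappa_swap:
  fixes F :: "'a \<times> 'a \<Rightarrow> real"
  assumes t: "0 < t" and [measurable]: "F \<in> borel_measurable (borel \<Otimes>\<^sub>M borel)"
  shows "(\<integral>p. F p \<partial>kappa t) = (\<integral>p. F (snd p, fst p) \<partial>kappa t)"
  by (subst kappa_swap_measure[OF t, symmetric], subst integral_distr) auto

lemma AE_kappa_fst: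
  assumes t: "0 < t" and P: "AE x in lborel. P x"
  shows "AE p in kappa t. P (fst p)"
proof -
  obtain B where B: "B \<in> null_sets lborel" "{x. \<not> P x} \<subseteq> B" using P by (auto elim!: AE_E simp: null_sets_def)
  then have [measurable]: "B \<in> sets borel" by auto
  have "(\<integral>\<^sup>+p. indicator B (fst p) \<partial>kappa t) = (\<integral>\<^sup>+x. (\<integral>\<^sup>+\<omega>. ennreal (w t x \<omega>) * indicator B x \<partial>M) \<partial>lborel)"
    by (subst nn_integral_kappa[OF t]) auto
  also have "\<dots> = (\<integral>\<^sup>+x. 0 \<partial>(lborel::'a measure))"
    by (rule nn_integral_cong_AE, rule AE_mp[OF AE_not_in[OF B(1)]]) (auto intro!: AE_I2)
  finally have "(\<integral>\<^sup>+p. indicator B (fst p) \<partial>kappa t) = 0" by simp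
  then have "AE p in kappa t. indicator B (fst p) = (0::ennreal)"
    by (subst (asm) nn_integral_0_iff_AE) auto
  then show ?thesis by eventually_elim (use B(2) in \<open>auto simp: indicator_def split: if_splits\<close>)
qed

lemma AE_kappa_snd:
  assumes t: "0 < t" and P: "AE x in lborel. P x"
  shows "AE p in kappa t. P (snd p)"
proof -
  obtain B where B: "B \<in> null_sets lborel" "{x. \<not> P x} \<subseteq> B" using P by (auto elim!: AE_E simp: null_sets_def)
  then have [measurable]: "B \<in> sets borel" by auto
  have "AE x in lborel. x \<notin> B" using AE_not_in[OF B(1)] .
  from AE_kappa_fst[OF t this] have "(\<integral>\<^sup>+p. indicator B (fst p) \<partial>kappa t) = (\<integral>\<^sup>+p. 0 \<partial>kappa t)"
    by (intro nn_integral_cong_AE) auto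
  then have "(\<integral>\<^sup>+p. indicator B (snd p) \<partial>kappa t) = 0"
    using kappa_swap[OF t, of "\<lambda>p. indicator B (fst p)"] by simp
  then have "AE p in kappa t. indicator B (snd p) = (0::ennreal)"
    by (subst (asm) nn_integral_0_iff_AE) auto
  then show ?thesis by eventually_elim (use B(2) in \<open>auto simp: indicator_def split: if_splits\<close>)
qed

lemma fk_measurable [measurable]:
  assumes [measurable]: "g \<in> borel_measurable borel" and t: "0 < t"
  shows "fk t g \<in> borel_measurable borel"
proof -
  have [measurable]: "X t \<in> borel_measurable M" using t by (simp add: X_measurable)
  have "(\<lambda>x. \<integral>\<omega>. w t x \<omega> * g (x + X t \<omega>) \<partial>M) \<in> borel_measurable lborel"
    by (rule borel_measurable_lebesgue_integral) (simp add: split_beta')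
  then show ?thesis by (simp add: feynman_kac_weight[abs_def])
qed

lemma integral_kappa:
  assumes t: "0 < t" and [measurable]: "u \<in> borel_measurable borel" "v \<in> borel_measurable borel"
    and int: "integrable (kappa t) (\<lambda>p. u (fst p) * v (snd p))"
  shows "(\<integral>x. u x * fk t v x \<partial>lborel) = (\<integral>p. u (fst p) * v (snd p) \<partial>kappa t)"
proof -
  note [measurable] = end_measurable[OF t]
  have [measurable]: "X t \<in> borel_measurable M" using t by (simp add: X_measurable)
  let ?D = "density (lborel \<Otimes>\<^sub>M M) (\<lambda>z. ennreal (w t (fst z) (snd z)))"
  have "integrable ?D (\<lambda>z. u (fst z) * v (fst z + X t (snd z)))"
    using int unfolding kappa_def by (subst (asm) integrable_distr_eq) auto
  then have int2: "integrable (lborel \<Otimes>\<^sub>M M) (\<lambda>z. w t (fst z) (snd z) * (u (fst z) * v (fst z + X t (snd z))))"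
    by (subst (asm) integrable_density) (auto simp: less_imp_le[OF w_pos])
  have "(\<integral>p. u (fst p) * v (snd p) \<partial>kappa t) = (\<integral>z. u (fst z) * v (fst z + X t (snd z)) \<partial>?D)"
    unfolding kappa_def by (subst integral_distr) auto
  also have "\<dots> = (\<integral>z. w t (fst z) (snd z) * (u (fst z) * v (fst z + X t (snd z))) \<partial>(lborel \<Otimes>\<^sub>M M))"
    by (subst integral_density) (auto simp: less_imp_le[OF w_pos])
  also have "\<dots> = (\<integral>x. (\<integral>\<omega>. w t x \<omega> * (u x * v (x + X t \<omega>)) \<partial>M) \<partial>lborel)"
    using L.integral_fst'[OF int2] by simp
  also have "\<dots> = (\<integral>x. u x * fk t v x \<partial>lborel)"
    by (simp add: feynman_kac_weight mult.left_commute[of _ "u _"])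
  finally show ?thesis ..
qed

end

locale gst_setting = fk_setting M X V for M :: "'w measure" and X :: "real \<Rightarrow> 'w \<Rightarrow> 'a::euclidean_space" and V +
  fixes lam :: real and \<phi> :: "'a \<Rightarrow> real" and N :: "'v measure" and Y :: "real \<Rightarrow> 'v \<Rightarrow> 'a"
  assumes phi_L2: "L2_fun \<phi>" and phi_pos: "0 < \<phi> x" and phi_norm: "L2_norm \<phi> = 1"
    and gst: "gst_process N Y (gst_semigroup M X V lam \<phi>) \<phi>"
begin

lemma phi_measurable [measurable]: "\<phi> \<in> borel_measurable borel"
  using phi_L2 by (rule L2_funD)

lemma phi_nz [simp]: "\<phi> x \<noteq> 0" using phi_pos[of x] by simp

lemma phi_nonneg [simp]: "0 \<le> \<phi> x" using phi_pos[of x] by simp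

lemma phi_square: "integrable lborel (\<lambda>x. (\<phi> x)\<^sup>2)" "(\<integral>x. (\<phi> x)\<^sup>2 \<partial>lborel) = 1"
  using phi_L2 phi_norm by (auto simp: L2_fun_def L2_norm_def)

lemma one_point:
  assumes "g0 \<in> borel_measurable borel" "bounded (range g0)"
  shows "(\<integral>\<omega>. g0 (Y s \<omega>) \<partial>N) = (\<integral>x. g0 x * (\<phi> x)\<^sup>2 \<partial>lborel)"
  using gst[unfolded gst_process_def] assms
  by (elim conjE allE[of _ s] allE[of _ g0] allE[of _ "[]"]) simp

lemma two_point_raw:
  assumes "g0 \<in> borel_measurable borel" "bounded (range g0)" "g1 \<in> borel_measurable borel" "bounded (range g1)"
    and t: "0 < t"
  shows "(\<integral>\<omega>. g0 (Y s \<omega>) * g1 (Y (s + t) \<omega>) \<partial>N) =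
         (\<integral>x. (\<phi> x * g0 x) * (exp (lam * t) * fk t (\<lambda>y. \<phi> y * g1 y) x) \<partial>lborel)"
proof -
  have "(\<integral>\<omega>. g0 (Y s \<omega>) * prod_list (map (\<lambda>(t, g). g (Y t \<omega>)) [(s + t, g1)]) \<partial>N) =
      (\<integral>x. g0 x * semigroup_chain (gst_semigroup M X V lam \<phi>) s [(s + t, g1)] x * (\<phi> x)\<^sup>2 \<partial>lborel)"
    using gst[unfolded gst_process_def] assms
    by (elim conjE allE[of _ s] allE[of _ g0] allE[of _ "[(s + t, g1)]"]) simp
  then show ?thesis
    by (simp add: gst_semigroup_def power2_eq_square mult.assoc mult.left_commute)
qed

text \<open>The constant function at the intermediate time \<open>s\<close> makes the two-point law appear with a
  composition of two operators, to be compared with the single operator for the time \<open>s + t\<close>.\<close>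

lemma three_point_raw:
  assumes "g0 \<in> borel_measurable borel" "bounded (range g0)" "g1 \<in> borel_measurable borel" "bounded (range g1)"
    and t: "0 < t" and s: "0 < s"
  shows "(\<integral>\<omega>. g0 (Y 0 \<omega>) * g1 (Y (s + t) \<omega>) \<partial>N) =
         (\<integral>x. (\<phi> x * g0 x) * (exp (lam * s) * fk s (\<lambda>y. exp (lam * t) * fk t (\<lambda>y. \<phi> y * g1 y) y) x) \<partial>lborel)"
proof -
  have "(\<integral>\<omega>. g0 (Y 0 \<omega>) * prod_list (map (\<lambda>(t, g). g (Y t \<omega>)) [(s, \<lambda>x. 1), (s + t, g1)]) \<partial>N) =
      (\<integral>x. g0 x * semigroup_chain (gst_semigroup M X V lam \<phi>) 0 [(s, \<lambda>x. 1), (s + t, g1)] x * (\<phi> x)\<^sup>2 \<partial>lborel)"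
    using gst[unfolded gst_process_def] assms
    by (elim conjE allE[of _ 0] allE[of _ g0] allE[of _ "[(s, \<lambda>x. 1), (s + t, g1)]"]) simp
  then show ?thesis
    by (simp add: gst_semigroup_def power2_eq_square mult.assoc mult.left_commute)
qed

lemma L2_fun_phi_mult:
  assumes [measurable]: "g \<in> borel_measurable borel" and "bounded (range g)"
  shows "L2_fun (\<lambda>x. \<phi> x * g x)"
proof -
  obtain B where B: "\<And>x. \<bar>g x\<bar> \<le> B" using assms(2) by (auto simp: bounded_iff)
  have "integrable lborel (\<lambda>x. (\<phi> x * g x)\<^sup>2)"
  proof (rule Bochner_Integration.integrable_bound)
    show "integrable lborel (\<lambda>x. B\<^sup>2 * (\<phi> x)\<^sup>2)" using phi_square by simp
    show "AE x in lborel. norm ((\<phi> x * g x)\<^sup>2) \<le> norm (B\<^sup>2 * (\<phi> x)\<^sup>2)"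
    proof (rule AE_I2)
      fix x
      have "(g x)\<^sup>2 \<le> B\<^sup>2" using B[of x] by (metis abs_ge_zero order_trans power2_abs power_mono)
      then have "(g x)\<^sup>2 * (\<phi> x)\<^sup>2 \<le> B\<^sup>2 * (\<phi> x)\<^sup>2" by (intro mult_right_mono) auto
      then show "norm ((\<phi> x * g x)\<^sup>2) \<le> norm (B\<^sup>2 * (\<phi> x)\<^sup>2)" by (simp add: power_mult_distrib mult.commute)
    qed
  qed simp
  then show ?thesis by (simp add: L2_fun_def)
qed

text \<open>Test with \<open>g = d / \<phi>\<close> on the set where its modulus is at most \<open>k\<close>. Integrability is a
  premise of the orthogonality, as \<open>d\<close> is not assumed to be square-integrable.\<close>

lemma zero_of_orthogonal_to_phi_multiples:
  assumes [measurable]: "d \<in> borel_measurable borel"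
    and orth: "\<And>g. g \<in> borel_measurable borel \<Longrightarrow> bounded (range g) \<Longrightarrow> integrable lborel (\<lambda>x. (\<phi> x * g x) * d x) \<Longrightarrow>
      (\<integral>x. (\<phi> x * g x) * d x \<partial>lborel) = 0"
  shows "AE x in lborel. d x = 0"
proof -
  have "AE x in lborel. \<bar>d x\<bar> \<le> real k * \<phi> x \<longrightarrow> d x = 0" for k
  proof -
    define B where "B = {x. \<bar>d x\<bar> \<le> real k * \<phi> x}"
    have [measurable]: "B \<in> sets borel" unfolding B_def by measurable
    define g where "g x = indicator B x * (d x / \<phi> x)" for x
    have gm [measurable]: "g \<in> borel_measurable borel" unfolding g_def by measurable
    have "\<bar>g x\<bar> \<le> real k" for x
      using phi_pos[of x] by (auto simp: g_def B_def indicator_def abs_divide pos_divide_le_eq)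
    then have gb: "bounded (range g)" by (auto simp: bounded_iff)
    have eq: "(\<phi> x * g x) * d x = indicator B x * (d x)\<^sup>2" for x
      by (simp add: g_def power2_eq_square)
    have int: "integrable lborel (\<lambda>x. indicator B x * (d x)\<^sup>2)"
    proof (rule Bochner_Integration.integrable_bound)
      show "integrable lborel (\<lambda>x. (real k)\<^sup>2 * (\<phi> x)\<^sup>2)" using phi_square by simp
      show "AE x in lborel. norm (indicator B x * (d x)\<^sup>2) \<le> norm ((real k)\<^sup>2 * (\<phi> x)\<^sup>2)"
      proof (rule AE_I2)
        fix x
        show "norm (indicator B x * (d x)\<^sup>2) \<le> norm ((real k)\<^sup>2 * (\<phi> x)\<^sup>2)"
          using power_mono[of "\<bar>d x\<bar>" "real k * \<phi> x" 2] by (cases "x \<in> B") (auto simp: B_def power_mult_distrib)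
      qed
    qed measurable
    then have "(\<integral>x. indicator B x * (d x)\<^sup>2 \<partial>lborel) = 0"
      using orth[OF gm gb] by (simp add: eq)
    with int have "AE x in lborel. indicator B x * (d x)\<^sup>2 = 0"
      by (subst (asm) integral_nonneg_eq_0_iff_AE) auto
    then show ?thesis
      by eventually_elim (auto simp: B_def indicator_def split: if_splits)
  qed
  then have "AE x in lborel. \<forall>k::nat. \<bar>d x\<bar> \<le> real k * \<phi> x \<longrightarrow> d x = 0"
    by (subst AE_all_countable) blast
  then show ?thesis
  proof eventually_elim
    case (elim x)
    obtain k :: nat where "\<bar>d x\<bar> < real k * \<phi> x" using reals_Archimedean3[OF phi_pos[of x]] by blast
    from less_imp_le[OF this] elim show ?case by blast
  qed
qed

text \<open>Stationarity: the constant function at the later time leaves the one-point law, whose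
  density is the same at all times.\<close>

lemma fk_phi:
  assumes t: "0 < t"
  shows "AE x in lborel. exp (lam * t) * fk t \<phi> x = \<phi> x"
proof -
  define q where "q x = exp (lam * t) * fk t \<phi> x" for x
  have [measurable]: "q \<in> borel_measurable borel" unfolding q_def using t by measurable
  have "AE x in lborel. q x - \<phi> x = 0"
  proof (rule zero_of_orthogonal_to_phi_multiples)
    fix g :: "'a \<Rightarrow> real"
    assume g: "g \<in> borel_measurable borel" "bounded (range g)" and "integrable lborel (\<lambda>x. (\<phi> x * g x) * (q x - \<phi> x))"
    moreover have i: "integrable lborel (\<lambda>x. (\<phi> x * g x) * \<phi> x)"
      by (rule L2_fun_mult_integrable[OF L2_fun_phi_mult[OF g] phi_L2])
    ultimately have "integrable lborel (\<lambda>x. (\<phi> x * g x) * (q x - \<phi> x) + (\<phi> x * g x) * \<phi> x)"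
      by (intro Bochner_Integration.integrable_add)
    then have "integrable lborel (\<lambda>x. (\<phi> x * g x) * q x)" by (simp add: algebra_simps)
    moreover have "(\<integral>x. (\<phi> x * g x) * q x \<partial>lborel) = (\<integral>x. (\<phi> x * g x) * \<phi> x \<partial>lborel)"
      using two_point_raw[OF g, of "\<lambda>_. 1" t 0] one_point[OF g, of 0] t by (simp add: q_def power2_eq_square ac_simps)
    ultimately show "(\<integral>x. (\<phi> x * g x) * (q x - \<phi> x) \<partial>lborel) = 0"
      using i unfolding right_diff_distrib by (subst Bochner_Integration.integral_diff) auto
  qed measurable
  then show ?thesis by eventually_elim (simp add: q_def)
qed

lemma nn_fk_phi:
  assumes t: "0 < t"
  shows "AE x in lborel. (\<integral>\<^sup>+\<omega>. ennreal (w t x \<omega>) * ennreal (\<phi> (x + X t \<omega>)) \<partial>M) = ennreal (exp (- lam * t) * \<phi> x)"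
  using fk_phi[OF t]
proof eventually_elim
  case (elim x)
  have [measurable]: "X t \<in> borel_measurable M" using t by (simp add: X_measurable)
  have nn: "0 \<le> w t x \<omega> * \<phi> (x + X t \<omega>)" for \<omega>
    using w_pos[of t x \<omega>] phi_pos[of "x + X t \<omega>"] by (simp add: less_imp_le)
  have eq: "fk t \<phi> x = exp (- lam * t) * \<phi> x"
    using elim by (simp add: exp_minus field_simps)
  \<comment> \<open>A Bochner integral that is not 0 has an integrable integrand.\<close>
  have "0 < fk t \<phi> x" unfolding eq using phi_pos by simp
  then have "integrable M (\<lambda>\<omega>. w t x \<omega> * \<phi> (x + X t \<omega>))"
    unfolding feynman_kac_weight using not_integrable_integral_eq by fastforce
  then have "(\<integral>\<^sup>+\<omega>. ennreal (w t x \<omega> * \<phi> (x + X t \<omega>)) \<partial>M) = ennreal (fk t \<phi> x)"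
    unfolding feynman_kac_weight by (intro nn_integral_eq_integral) (auto simp: nn)
  then show ?case
    by (simp add: eq ennreal_mult)
qed

lemma kappa_phi:
  assumes t: "0 < t" and [measurable]: "g \<in> borel_measurable borel"
  shows "(\<integral>\<^sup>+p. g (fst p) * ennreal (\<phi> (snd p)) \<partial>kappa t) = ennreal (exp (- lam * t)) * (\<integral>\<^sup>+x. g x * ennreal (\<phi> x) \<partial>lborel)"
proof -
  have [measurable]: "X t \<in> borel_measurable M" using t by (simp add: X_measurable)
  have "(\<integral>\<^sup>+p. g (fst p) * ennreal (\<phi> (snd p)) \<partial>kappa t) =
      (\<integral>\<^sup>+x. (\<integral>\<^sup>+\<omega>. g x * (ennreal (w t x \<omega>) * ennreal (\<phi> (x + X t \<omega>))) \<partial>M) \<partial>lborel)"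
    by (subst nn_integral_kappa[OF t]) (auto simp: ac_simps)
  also have "\<dots> = (\<integral>\<^sup>+x. g x * (\<integral>\<^sup>+\<omega>. ennreal (w t x \<omega>) * ennreal (\<phi> (x + X t \<omega>)) \<partial>M) \<partial>lborel)"
    by (intro nn_integral_cong nn_integral_cmult) measurable
  also have "\<dots> = (\<integral>\<^sup>+x. ennreal (exp (- lam * t)) * (g x * ennreal (\<phi> x)) \<partial>lborel)"
    by (rule nn_integral_cong_AE, rule AE_mp[OF nn_fk_phi[OF t]]) (auto intro!: AE_I2 simp: ennreal_mult less_imp_le[OF phi_pos] ac_simps)
  also have "\<dots> = ennreal (exp (- lam * t)) * (\<integral>\<^sup>+x. g x * ennreal (\<phi> x) \<partial>lborel)"
    by (rule nn_integral_cmult) measurable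
  finally show ?thesis .
qed

text \<open>Weighting with the quotient of the ground state at the two ends, in the appropriate order,
  turns a marginal of \<open>kappa t\<close> into a multiple of Lebesgue measure, by invariance of the ground
  state and symmetry of \<open>kappa t\<close>.\<close>

lemma kappa_phi_ratio:
  assumes t: "0 < t" and [measurable]: "u \<in> borel_measurable borel"
  shows "(\<integral>\<^sup>+p. ennreal ((u (fst p))\<^sup>2 * \<phi> (snd p) / \<phi> (fst p)) \<partial>kappa t) = ennreal (exp (- lam * t)) * (\<integral>\<^sup>+x. ennreal ((u x)\<^sup>2) \<partial>lborel)"
    and "(\<integral>\<^sup>+p. ennreal ((u (snd p))\<^sup>2 * \<phi> (fst p) / \<phi> (snd p)) \<partial>kappa t) = ennreal (exp (- lam * t)) * (\<integral>\<^sup>+x. ennreal ((u x)\<^sup>2) \<partial>lborel)"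
proof -
  have "(\<integral>\<^sup>+p. ennreal ((u (fst p))\<^sup>2 * \<phi> (snd p) / \<phi> (fst p)) \<partial>kappa t) =
        (\<integral>\<^sup>+p. ennreal ((u (fst p))\<^sup>2 / \<phi> (fst p)) * ennreal (\<phi> (snd p)) \<partial>kappa t)"
    by (intro nn_integral_cong) (simp add: ennreal_mult[symmetric])
  also have "\<dots> = ennreal (exp (- lam * t)) * (\<integral>\<^sup>+x. ennreal ((u x)\<^sup>2 / \<phi> x) * ennreal (\<phi> x) \<partial>lborel)"
    by (rule kappa_phi[OF t]) measurable
  also have "(\<integral>\<^sup>+x. ennreal ((u x)\<^sup>2 / \<phi> x) * ennreal (\<phi> x) \<partial>lborel) = (\<integral>\<^sup>+x. ennreal ((u x)\<^sup>2) \<partial>lborel)"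
    by (intro nn_integral_cong) (simp add: ennreal_mult[symmetric])
  finally show 1: "(\<integral>\<^sup>+p. ennreal ((u (fst p))\<^sup>2 * \<phi> (snd p) / \<phi> (fst p)) \<partial>kappa t) = ennreal (exp (- lam * t)) * (\<integral>\<^sup>+x. ennreal ((u x)\<^sup>2) \<partial>lborel)" .
  show "(\<integral>\<^sup>+p. ennreal ((u (snd p))\<^sup>2 * \<phi> (fst p) / \<phi> (snd p)) \<partial>kappa t) = ennreal (exp (- lam * t)) * (\<integral>\<^sup>+x. ennreal ((u x)\<^sup>2) \<partial>lborel)"
    unfolding 1[symmetric] by (subst kappa_swap[OF t]) auto
qed

lemma kappa_ratio_integrable:
  assumes t: "0 < t" and u: "L2_fun u"
  shows "integrable (kappa t) (\<lambda>p. (u (fst p))\<^sup>2 * \<phi> (snd p) / \<phi> (fst p))"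
    and "integrable (kappa t) (\<lambda>p. (u (snd p))\<^sup>2 * \<phi> (fst p) / \<phi> (snd p))"
    and "(\<integral>p. (u (fst p))\<^sup>2 * \<phi> (snd p) / \<phi> (fst p) \<partial>kappa t) = exp (- lam * t) * (norm (abs_L2 u))\<^sup>2"
    and "(\<integral>p. (u (snd p))\<^sup>2 * \<phi> (fst p) / \<phi> (snd p) \<partial>kappa t) = exp (- lam * t) * (norm (abs_L2 u))\<^sup>2"
proof -
  have [measurable]: "u \<in> borel_measurable borel" using u by (rule L2_funD)
  have pos: "0 \<le> (u (fst p))\<^sup>2 * \<phi> (snd p) / \<phi> (fst p)" "0 \<le> (u (snd p))\<^sup>2 * \<phi> (fst p) / \<phi> (snd p)" for p
    by simp_all
  have v: "(\<integral>\<^sup>+p. ennreal ((u (fst p))\<^sup>2 * \<phi> (snd p) / \<phi> (fst p)) \<partial>kappa t) = ennreal (exp (- lam * t) * (norm (abs_L2 u))\<^sup>2)"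
          "(\<integral>\<^sup>+p. ennreal ((u (snd p))\<^sup>2 * \<phi> (fst p) / \<phi> (snd p)) \<partial>kappa t) = ennreal (exp (- lam * t) * (norm (abs_L2 u))\<^sup>2)"
    using kappa_phi_ratio[OF t, of u] nn_integral_square_L2[OF u] by (simp_all add: ennreal_mult)
  then have "(\<lambda>p. (u (fst p))\<^sup>2 * \<phi> (snd p) / \<phi> (fst p)) \<in> borel_measurable (kappa t)"
     "(\<lambda>p. (u (snd p))\<^sup>2 * \<phi> (fst p) / \<phi> (snd p)) \<in> borel_measurable (kappa t)" by measurable
  then show "integrable (kappa t) (\<lambda>p. (u (fst p))\<^sup>2 * \<phi> (snd p) / \<phi> (fst p))"
    "integrable (kappa t) (\<lambda>p. (u (snd p))\<^sup>2 * \<phi> (fst p) / \<phi> (snd p))"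
    "(\<integral>p. (u (fst p))\<^sup>2 * \<phi> (snd p) / \<phi> (fst p) \<partial>kappa t) = exp (- lam * t) * (norm (abs_L2 u))\<^sup>2"
    "(\<integral>p. (u (snd p))\<^sup>2 * \<phi> (fst p) / \<phi> (snd p) \<partial>kappa t) = exp (- lam * t) * (norm (abs_L2 u))\<^sup>2"
    using v pos by (auto intro!: integrableI_nn_integral_finite simp: integral_eq_nn_integral)
qed

text \<open>With \<open>a\<close> and \<open>b\<close> the values of the ground state at the two ends, twice the product of \<open>u b\<close>
  and \<open>v a\<close> is at most the sum of their squares; divided by \<open>a b\<close>, both terms on the right are
  integrable by the preceding lemma.\<close>

lemma kappa_bilinear_integrable:
  assumes t: "0 < t" and u: "L2_fun u" and v: "L2_fun v"
  shows "integrable (kappa t) (\<lambda>p. u (fst p) * v (snd p))"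
proof (rule Bochner_Integration.integrable_bound)
  have [measurable]: "u \<in> borel_measurable borel" "v \<in> borel_measurable borel" using u v by (auto dest: L2_funD)
  show "integrable (kappa t) (\<lambda>p. (u (fst p))\<^sup>2 * \<phi> (snd p) / \<phi> (fst p) + (v (snd p))\<^sup>2 * \<phi> (fst p) / \<phi> (snd p))"
    by (intro Bochner_Integration.integrable_add kappa_ratio_integrable t u v)
  show "(\<lambda>p. u (fst p) * v (snd p)) \<in> borel_measurable (kappa t)" by measurable
  show "AE p in kappa t. norm (u (fst p) * v (snd p)) \<le>
      norm ((u (fst p))\<^sup>2 * \<phi> (snd p) / \<phi> (fst p) + (v (snd p))\<^sup>2 * \<phi> (fst p) / \<phi> (snd p))"
  proof (rule AE_I2)
    fix p :: "'a \<times> 'a"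
    define a b where "a = \<phi> (fst p)" and "b = \<phi> (snd p)"
    have ab: "0 < a" "0 < b" using phi_pos by (auto simp: a_def b_def)
    define r s where "r = \<bar>u (fst p)\<bar>" and "s = \<bar>v (snd p)\<bar>"
    have rs: "0 \<le> r" "0 \<le> s" by (auto simp: r_def s_def)
    have "2 * ((r * b) * (s * a)) \<le> (r * b)\<^sup>2 + (s * a)\<^sup>2" using sum_squares_bound[of "r * b" "s * a"] by simp
    then have "2 * ((r * b) * (s * a)) / (a * b) \<le> ((r * b)\<^sup>2 + (s * a)\<^sup>2) / (a * b)"
      using ab by (intro divide_right_mono) auto
    then have "2 * (r * s) \<le> r\<^sup>2 * b / a + s\<^sup>2 * a / b"
      using ab by (simp add: power2_eq_square add_divide_distrib)
    moreover have "0 \<le> r * s" using rs by simp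
    ultimately have "r * s \<le> r\<^sup>2 * b / a + s\<^sup>2 * a / b" by linarith
    moreover have "r\<^sup>2 = (u (fst p))\<^sup>2" "s\<^sup>2 = (v (snd p))\<^sup>2" by (auto simp: r_def s_def)
    ultimately show "norm (u (fst p) * v (snd p)) \<le>
      norm ((u (fst p))\<^sup>2 * \<phi> (snd p) / \<phi> (fst p) + (v (snd p))\<^sup>2 * \<phi> (fst p) / \<phi> (snd p))"
      by (simp add: abs_mult r_def s_def a_def b_def)
  qed
qed

text \<open>The Schur test with the ground state as test function: Cauchy-Schwarz for the factorization
  of the weight \<open>w\<close> into \<open>sqrt (w \<phi>)\<close> and \<open>sqrt (w / \<phi>)\<close>.\<close>

lemma fk_L2_bound:
  assumes t: "0 < t" and v: "L2_fun v"
  shows "L2_fun (fk t v)" and "norm (abs_L2 (fk t v)) \<le> exp (- lam * t) * norm (abs_L2 v)"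
proof -
  have [measurable]: "v \<in> borel_measurable borel" using v by (rule L2_funD)
  have [measurable]: "X t \<in> borel_measurable M" using t by (simp add: X_measurable)
  have [measurable]: "fk t v \<in> borel_measurable borel" using t by measurable
  define J where "J x = (\<integral>\<^sup>+\<omega>. ennreal (w t x \<omega>) * ennreal ((v (x + X t \<omega>))\<^sup>2 / \<phi> (x + X t \<omega>)) \<partial>M)" for x
  have [measurable]: "J \<in> borel_measurable borel"
  proof -
    have "J \<in> borel_measurable lborel" unfolding J_def
      by (rule borel_measurable_nn_integral) (simp add: split_beta')
    then show ?thesis by simp
  qed
  have pt: "AE x in lborel. ennreal ((fk t v x)\<^sup>2) \<le> ennreal (exp (- lam * t) * \<phi> x) * J x"
    using nn_fk_phi[OF t]
  proof eventually_elim
    case (elim x)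
    have "ennreal \<bar>fk t v x\<bar> \<le> (\<integral>\<^sup>+\<omega>. ennreal (norm (w t x \<omega> * v (x + X t \<omega>))) \<partial>M)"
      using integral_norm_bound_ennreal[of M "\<lambda>\<omega>. w t x \<omega> * v (x + X t \<omega>)"]
      unfolding feynman_kac_weight real_norm_def[symmetric]
      by (cases "integrable M (\<lambda>\<omega>. w t x \<omega> * v (x + X t \<omega>))") (simp_all add: not_integrable_integral_eq)
    also have "\<dots> = (\<integral>\<^sup>+\<omega>. ennreal (sqrt (w t x \<omega> * \<phi> (x + X t \<omega>))) * ennreal (sqrt (w t x \<omega> / \<phi> (x + X t \<omega>)) * \<bar>v (x + X t \<omega>)\<bar>) \<partial>M)"
    proof (intro nn_integral_cong)
      fix \<omega>
      define a b where "a = w t x \<omega>" and "b = \<phi> (x + X t \<omega>)"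
      have "0 < a" "0 < b" using w_pos phi_pos by (auto simp: a_def b_def)
      then have "sqrt (a * b) * sqrt (a / b) = a"
        by (simp add: real_sqrt_mult[symmetric])
      then have "sqrt (a * b) * (sqrt (a / b) * c) = a * c" for c
        by (simp add: mult.assoc[symmetric])
      then show "ennreal (norm (w t x \<omega> * v (x + X t \<omega>))) = ennreal (sqrt (w t x \<omega> * \<phi> (x + X t \<omega>))) * ennreal (sqrt (w t x \<omega> / \<phi> (x + X t \<omega>)) * \<bar>v (x + X t \<omega>)\<bar>)"
        using \<open>0 < a\<close> \<open>0 < b\<close> by (subst ennreal_mult[symmetric]) (auto simp: a_def b_def abs_mult less_imp_le)
    qed
    finally have "(ennreal \<bar>fk t v x\<bar>)\<^sup>2 \<le> (\<integral>\<^sup>+\<omega>. ennreal (sqrt (w t x \<omega> * \<phi> (x + X t \<omega>))) * ennreal (sqrt (w t x \<omega> / \<phi> (x + X t \<omega>)) * \<bar>v (x + X t \<omega>)\<bar>) \<partial>M)\<^sup>2"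
      by (rule power_mono) simp
    also have "\<dots> \<le> (\<integral>\<^sup>+\<omega>. (ennreal (sqrt (w t x \<omega> * \<phi> (x + X t \<omega>))))\<^sup>2 \<partial>M) * (\<integral>\<^sup>+\<omega>. (ennreal (sqrt (w t x \<omega> / \<phi> (x + X t \<omega>)) * \<bar>v (x + X t \<omega>)\<bar>))\<^sup>2 \<partial>M)"
      by (rule Cauchy_Schwarz_nn_integral) measurable
    also have "(\<integral>\<^sup>+\<omega>. (ennreal (sqrt (w t x \<omega> * \<phi> (x + X t \<omega>))))\<^sup>2 \<partial>M) = (\<integral>\<^sup>+\<omega>. ennreal (w t x \<omega>) * ennreal (\<phi> (x + X t \<omega>)) \<partial>M)"
      by (intro nn_integral_cong) (simp add: ennreal_power ennreal_mult[symmetric])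
    also have "(\<integral>\<^sup>+\<omega>. (ennreal (sqrt (w t x \<omega> / \<phi> (x + X t \<omega>)) * \<bar>v (x + X t \<omega>)\<bar>))\<^sup>2 \<partial>M) = J x"
      unfolding J_def
      by (intro nn_integral_cong) (simp add: ennreal_power ennreal_mult[symmetric] power_mult_distrib)
    finally show ?case by (simp add: elim ennreal_power)
  qed
  have "(\<integral>\<^sup>+x. ennreal ((fk t v x)\<^sup>2) \<partial>lborel) \<le> (\<integral>\<^sup>+x. ennreal (exp (- lam * t)) * (ennreal (\<phi> x) * J x) \<partial>lborel)"
    by (rule nn_integral_mono_AE, rule AE_mp[OF pt]) (auto intro!: AE_I2 simp: ennreal_mult ac_simps less_imp_le[OF phi_pos])
  also have "\<dots> = ennreal (exp (- lam * t)) * (\<integral>\<^sup>+x. ennreal (\<phi> x) * J x \<partial>lborel)"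
    by (rule nn_integral_cmult) measurable
  also have "(\<integral>\<^sup>+x. ennreal (\<phi> x) * J x \<partial>lborel) = (\<integral>\<^sup>+p. ennreal ((v (snd p))\<^sup>2 * \<phi> (fst p) / \<phi> (snd p)) \<partial>kappa t)"
    unfolding J_def
  proof (subst nn_integral_kappa[OF t])
    show "(\<integral>\<^sup>+x. ennreal (\<phi> x) * (\<integral>\<^sup>+\<omega>. ennreal (w t x \<omega>) * ennreal ((v (x + X t \<omega>))\<^sup>2 / \<phi> (x + X t \<omega>)) \<partial>M) \<partial>lborel) =
      (\<integral>\<^sup>+x. (\<integral>\<^sup>+\<omega>. ennreal (w t x \<omega>) * ennreal ((v (snd (x, x + X t \<omega>)))\<^sup>2 * \<phi> (fst (x, x + X t \<omega>)) / \<phi> (snd (x, x + X t \<omega>))) \<partial>M) \<partial>lborel)"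
      by (subst nn_integral_cmult[symmetric]) (auto intro!: nn_integral_cong simp: ennreal_mult[symmetric] ac_simps)
  qed measurable
  also have "\<dots> = ennreal (exp (- lam * t)) * ennreal ((norm (abs_L2 v))\<^sup>2)"
    using kappa_phi_ratio(2)[OF t, of v] nn_integral_square_L2[OF v] by simp
  finally have bd: "(\<integral>\<^sup>+x. ennreal ((fk t v x)\<^sup>2) \<partial>lborel) \<le> ennreal ((exp (- lam * t) * norm (abs_L2 v))\<^sup>2)"
    by (simp add: ennreal_mult[symmetric] power_mult_distrib power2_eq_square ac_simps)
  show L: "L2_fun (fk t v)"
    unfolding L2_fun_iff_nn_integral using bd by (auto intro: le_less_trans)
  have "(norm (abs_L2 (fk t v)))\<^sup>2 \<le> (exp (- lam * t) * norm (abs_L2 v))\<^sup>2"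
    using bd unfolding nn_integral_square_L2[OF L] by simp
  then show "norm (abs_L2 (fk t v)) \<le> exp (- lam * t) * norm (abs_L2 v)"
    by (rule power2_le_imp_le) simp
qed

end

context gst_setting
begin

definition Tt :: "real \<Rightarrow> 'a L2 \<Rightarrow> 'a L2" where
  "Tt t u = exp (lam * t) *\<^sub>R abs_L2 (fk t (rep_L2 u))"

lemma fk_inner:
  assumes t: "0 < t" and u: "L2_fun u" and v: "L2_fun v"
  shows "inner (abs_L2 u) (abs_L2 (fk t v)) = (\<integral>p. u (fst p) * v (snd p) \<partial>kappa t)"
  using integral_kappa[OF t L2_funD(1)[OF u] L2_funD(1)[OF v] kappa_bilinear_integrable[OF t u v]]
  by (simp add: inner_abs_L2 u v fk_L2_bound(1)[OF t v])

lemma fk_L2_cong: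
  assumes t: "0 < t" and v: "L2_fun v" "L2_fun v'" and eq: "AE x in lborel. v x = v' x"
  shows "abs_L2 (fk t v) = abs_L2 (fk t v')"
proof (rule vector_eq_ldot[THEN iffD1], intro allI)
  fix z :: "'a L2"
  obtain u where u: "L2_fun u" "z = abs_L2 u" by (rule L2_cases)
  have m: "u \<in> borel_measurable borel" "v \<in> borel_measurable borel" "v' \<in> borel_measurable borel"
    using u v by (auto dest: L2_funD)
  note [measurable] = m
  have "(\<integral>p. u (fst p) * v (snd p) \<partial>kappa t) = (\<integral>p. u (fst p) * v' (snd p) \<partial>kappa t)"
    by (rule integral_cong_AE) (use AE_kappa_snd[OF t eq] in auto)
  then show "inner z (abs_L2 (fk t v)) = inner z (abs_L2 (fk t v'))"
    using u v by (simp add: fk_inner[OF t])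
qed

lemma Tt_abs:
  assumes t: "0 < t" and v: "L2_fun v"
  shows "Tt t (abs_L2 v) = exp (lam * t) *\<^sub>R abs_L2 (fk t v)"
  unfolding Tt_def using fk_L2_cong[OF t L2_fun_rep v rep_abs_L2[OF v]] by simp

lemma inner_Tt:
  assumes t: "0 < t" and u: "L2_fun u" and v: "L2_fun v"
  shows "inner (abs_L2 u) (Tt t (abs_L2 v)) = exp (lam * t) * (\<integral>p. u (fst p) * v (snd p) \<partial>kappa t)"
  by (simp add: Tt_abs[OF t v] fk_inner[OF t u v])

lemma Tt_add:
  assumes t: "0 < t"
  shows "Tt t (x + y) = Tt t x + Tt t y"
proof (rule vector_eq_ldot[THEN iffD1], intro allI)
  fix z :: "'a L2"
  obtain u v v' where u: "L2_fun u" "z = abs_L2 u" and v: "L2_fun v" "x = abs_L2 v" "L2_fun v'" "y = abs_L2 v'"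
    by (metis L2_cases)
  have "(\<integral>p. u (fst p) * (v (snd p) + v' (snd p)) \<partial>kappa t) = (\<integral>p. u (fst p) * v (snd p) \<partial>kappa t) + (\<integral>p. u (fst p) * v' (snd p) \<partial>kappa t)"
    unfolding distrib_left
    by (intro Bochner_Integration.integral_add kappa_bilinear_integrable t u v)
  then show "inner z (Tt t (x + y)) = inner z (Tt t x + Tt t y)"
    using u v by (simp add: add_abs_L2 inner_add_right inner_Tt[OF t] L2_fun_add distrib_left)
qed

lemma Tt_scale:
  assumes t: "0 < t"
  shows "Tt t (c *\<^sub>R x) = c *\<^sub>R Tt t x"
proof (rule vector_eq_ldot[THEN iffD1], intro allI)
  fix z :: "'a L2"
  obtain u v where u: "L2_fun u" "z = abs_L2 u" and v: "L2_fun v" "x = abs_L2 v"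
    by (metis L2_cases)
  have "(\<integral>p. u (fst p) * (c * v (snd p)) \<partial>kappa t) = c * (\<integral>p. u (fst p) * v (snd p) \<partial>kappa t)"
    by (simp add: mult.left_commute[of _ c])
  then show "inner z (Tt t (c *\<^sub>R x)) = inner z (c *\<^sub>R Tt t x)"
    using u v by (simp add: scaleR_abs_L2 inner_Tt[OF t] L2_fun_cmult)
qed

lemma Tt_symmetric:
  assumes t: "0 < t"
  shows "inner (Tt t x) y = inner x (Tt t y)"
proof -
  obtain u v where u: "L2_fun u" "y = abs_L2 u" and v: "L2_fun v" "x = abs_L2 v"
    by (metis L2_cases)
  have [measurable]: "u \<in> borel_measurable borel" "v \<in> borel_measurable borel"
    using u v by (auto dest: L2_funD)
  have "(\<integral>p. u (fst p) * v (snd p) \<partial>kappa t) = (\<integral>p. v (fst p) * u (snd p) \<partial>kappa t)"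
    by (subst integral_kappa_swap[OF t]) (auto simp: mult.commute)
  then show ?thesis
    using u v by (simp add: inner_commute[of "Tt t _"] inner_Tt[OF t])
qed

lemma Tt_contraction:
  assumes t: "0 < t"
  shows "norm (Tt t x) \<le> norm x"
proof -
  obtain v where v: "L2_fun v" "x = abs_L2 v" by (metis L2_cases)
  have "norm (Tt t x) \<le> exp (lam * t) * (exp (- lam * t) * norm x)"
    using fk_L2_bound(2)[OF t v(1)] by (simp add: v Tt_abs[OF t])
  then show ?thesis by (simp add: mult.assoc[symmetric] mult_exp_exp)
qed

lemma Tt_phi:
  assumes t: "0 < t"
  shows "Tt t (abs_L2 \<phi>) = abs_L2 \<phi>"
  using fk_phi[OF t] fk_L2_bound(1)[OF t phi_L2]
  by (simp add: Tt_abs[OF t phi_L2] scaleR_abs_L2 abs_L2_eq_iff L2_fun_cmult phi_L2)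

lemma phi_multiples_total:
  assumes "\<And>g. g \<in> borel_measurable borel \<Longrightarrow> bounded (range g) \<Longrightarrow> inner (abs_L2 (\<lambda>x. \<phi> x * g x)) x = inner (abs_L2 (\<lambda>x. \<phi> x * g x)) y"
  shows "x = y"
proof -
  obtain d where d: "L2_fun d" "x - y = abs_L2 d" by (metis L2_cases)
  have "AE x in lborel. d x = 0"
  proof (rule zero_of_orthogonal_to_phi_multiples)
    fix g :: "'a \<Rightarrow> real" assume g: "g \<in> borel_measurable borel" "bounded (range g)"
    have "inner (abs_L2 (\<lambda>x. \<phi> x * g x)) (x - y) = 0"
      using assms[OF g] by (simp add: inner_diff_right)
    then show "(\<integral>x. (\<phi> x * g x) * d x \<partial>lborel) = 0"
      using d by (simp add: inner_abs_L2 L2_fun_phi_mult[OF g])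
  qed (use d in \<open>auto dest: L2_funD\<close>)
  then have "x - y = 0" unfolding d(2) using abs_L2_eq_iff[OF d(1) L2_fun_zero] by (simp add: zero_L2.abs_eq)
  then show ?thesis by simp
qed

lemma two_point:
  assumes g0: "g0 \<in> borel_measurable borel" "bounded (range g0)" and g1: "g1 \<in> borel_measurable borel" "bounded (range g1)"
    and t: "0 < t"
  shows "(\<integral>\<omega>. g0 (Y s \<omega>) * g1 (Y (s + t) \<omega>) \<partial>N) =
         inner (abs_L2 (\<lambda>x. \<phi> x * g0 x)) (Tt t (abs_L2 (\<lambda>x. \<phi> x * g1 x)))"
proof -
  note L = L2_fun_phi_mult[OF g0] L2_fun_phi_mult[OF g1]
  show ?thesis
    unfolding two_point_raw[OF g0 g1 t]
    by (simp add: Tt_abs[OF t L(2)] inner_abs_L2 L fk_L2_bound(1)[OF t L(2)] mult.left_commute[of _ "exp _"])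
qed

text \<open>The two-point and three-point laws of the process give the identity on multiples of the
  ground state by bounded functions. These are total, and by symmetry both sides can be moved onto
  them.\<close>

lemma Tt_semigroup:
  assumes s: "0 < s" and t: "0 < t"
  shows "Tt s (Tt t x) = Tt (s + t) x"
proof -
  have st: "0 < s + t" using s t by simp
  have on_multiples: "Tt s (Tt t (abs_L2 (\<lambda>x. \<phi> x * g1 x))) = Tt (s + t) (abs_L2 (\<lambda>x. \<phi> x * g1 x))"
    if g1: "g1 \<in> borel_measurable borel" "bounded (range g1)" and s: "0 < s" and t: "0 < t" for g1 s t
  proof (rule phi_multiples_total)
    fix g0 :: "'a \<Rightarrow> real" assume g0: "g0 \<in> borel_measurable borel" "bounded (range g0)"
    note L0 = L2_fun_phi_mult[OF g0] and L1 = L2_fun_phi_mult[OF g1]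
    note L2 = L2_fun_cmult[OF fk_L2_bound(1)[OF t L1], of "exp (lam * t)"]
    note L3 = fk_L2_bound(1)[OF s L2]
    have "Tt s (Tt t (abs_L2 (\<lambda>x. \<phi> x * g1 x))) = exp (lam * s) *\<^sub>R abs_L2 (fk s (\<lambda>y. exp (lam * t) * fk t (\<lambda>y. \<phi> y * g1 y) y))"
      by (simp add: Tt_abs[OF t L1] scaleR_abs_L2 fk_L2_bound(1)[OF t L1] Tt_abs[OF s L2])
    then have "inner (abs_L2 (\<lambda>x. \<phi> x * g0 x)) (Tt s (Tt t (abs_L2 (\<lambda>x. \<phi> x * g1 x)))) = (\<integral>\<omega>. g0 (Y 0 \<omega>) * g1 (Y (s + t) \<omega>) \<partial>N)"
      unfolding three_point_raw[OF g0 g1 t s]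
      by (simp add: inner_abs_L2 L0 L3 mult.left_commute[of _ "exp (lam * s)"])
    also have "\<dots> = inner (abs_L2 (\<lambda>x. \<phi> x * g0 x)) (Tt (s + t) (abs_L2 (\<lambda>x. \<phi> x * g1 x)))"
      using two_point[OF g0 g1, of "s + t" 0] s t by simp
    finally show "inner (abs_L2 (\<lambda>x. \<phi> x * g0 x)) (Tt s (Tt t (abs_L2 (\<lambda>x. \<phi> x * g1 x)))) =
      inner (abs_L2 (\<lambda>x. \<phi> x * g0 x)) (Tt (s + t) (abs_L2 (\<lambda>x. \<phi> x * g1 x)))" .
  qed
  show ?thesis
  proof (rule phi_multiples_total)
    fix g :: "'a \<Rightarrow> real" assume g: "g \<in> borel_measurable borel" "bounded (range g)"
    let ?v = "abs_L2 (\<lambda>x. \<phi> x * g x)"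
    have "inner ?v (Tt s (Tt t x)) = inner (Tt t (Tt s ?v)) x"
      by (simp add: Tt_symmetric s t)
    also have "\<dots> = inner (Tt (t + s) ?v) x" unfolding on_multiples[OF g t s] ..
    also have "\<dots> = inner ?v (Tt (s + t) x)" by (simp add: Tt_symmetric st add.commute)
    finally show "inner ?v (Tt s (Tt t x)) = inner ?v (Tt (s + t) x)" .
  qed
qed

sublocale S: symmetric_contraction_semigroup Tt
proof (rule symmetric_contraction_semigroup.intro)
  fix t :: real and x y :: "'a L2"
  assume t: "0 < t"
  show "linear (Tt t)" by (intro linearI Tt_add Tt_scale t)
  show "norm (Tt t x) \<le> norm x" by (rule Tt_contraction[OF t])
  show "inner (Tt t x) y = inner x (Tt t y)" by (rule Tt_symmetric[OF t])
next
  fix s t :: real and x :: "'a L2"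
  assume "0 < s" "0 < t"
  then show "Tt s (Tt t x) = Tt (s + t) x" by (rule Tt_semigroup)
qed

section \<open>Simplicity of the ground state and decay of covariances\<close>

text \<open>For a fixed vector the Dirichlet form vanishes, that is, the integral of
  \<open>(q x - q y)\<^sup>2 \<phi> x \<phi> y\<close> under \<open>kappa t\<close>, where \<open>q\<close> is its quotient by the ground state. Hence \<open>q\<close>
  takes the same value at both ends of almost every path, and from a single good starting point a
  positive transition density reaches almost every point.\<close>

lemma fixed_vector_multiple:
  assumes t: "0 < t" and dens: "distributed M lborel (X t) (\<lambda>x. ennreal (p x))" and p: "\<And>x. 0 < p x"
    and fixed: "Tt t x = x"
  shows "\<exists>c. x = c *\<^sub>R abs_L2 \<phi>"
proof -
  obtain u where u: "L2_fun u" "x = abs_L2 u" by (metis L2_cases)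
  have [measurable]: "u \<in> borel_measurable borel" using u by (auto dest: L2_funD)
  have Xt [measurable]: "X t \<in> borel_measurable M" using t by (simp add: X_measurable)
  define q where "q x = u x / \<phi> x" for x
  have [measurable]: "q \<in> borel_measurable borel" unfolding q_def by measurable
  define D where "D z = (q (fst z) - q (snd z))\<^sup>2 * (\<phi> (fst z) * \<phi> (snd z))" for z
  have D_eq: "D z = (u (fst z))\<^sup>2 * \<phi> (snd z) / \<phi> (fst z) + (u (snd z))\<^sup>2 * \<phi> (fst z) / \<phi> (snd z) - 2 * (u (fst z) * u (snd z))" for z
    unfolding D_def q_def by (simp add: power2_eq_square field_simps)
  have "integrable (kappa t) D" "(\<integral>z. D z \<partial>kappa t) = 0"
  proof -
    note i = kappa_ratio_integrable[OF t u(1)] kappa_bilinear_integrable[OF t u(1) u(1)]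
    show "integrable (kappa t) D"
      unfolding D_eq by (intro Bochner_Integration.integrable_add Bochner_Integration.integrable_diff Bochner_Integration.integrable_mult_right i)
    have "exp (lam * t) * (\<integral>z. u (fst z) * u (snd z) \<partial>kappa t) = (norm x)\<^sup>2"
      using inner_Tt[OF t u(1) u(1)] fixed u(2) by (simp add: power2_norm_eq_inner)
    then have "(\<integral>z. u (fst z) * u (snd z) \<partial>kappa t) = exp (- lam * t) * (norm x)\<^sup>2"
      by (simp add: exp_minus field_simps)
    then show "(\<integral>z. D z \<partial>kappa t) = 0"
      unfolding D_eq using i u(2)
      by (simp add: Bochner_Integration.integral_add Bochner_Integration.integral_diff)
  qed
  then have "AE z in kappa t. D z = 0"
    by (subst (asm) integral_nonneg_eq_0_iff_AE) (auto simp: D_def)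
  then have "AE z in kappa t. q (fst z) = q (snd z)"
    by eventually_elim (simp add: D_def)
  then have "AE z in density (lborel \<Otimes>\<^sub>M M) (\<lambda>z. ennreal (w t (fst z) (snd z))). q (fst z) = q (fst z + X t (snd z))"
    unfolding kappa_def by (subst (asm) AE_distr_iff) auto
  then have "AE z in lborel \<Otimes>\<^sub>M M. q (fst z) = q (fst z + X t (snd z))"
    by (subst (asm) AE_density) (auto simp: w_pos)
  from L.AE_pair[OF this] have "AE x in lborel. AE \<omega> in M. q x = q (x + X t \<omega>)" by simp
  then obtain x0 where x0: "AE \<omega> in M. q x0 = q (x0 + X t \<omega>)"
    using eventually_happens'[of "ae_filter (lborel :: 'a measure)"] by (auto simp: ae_filter_eq_bot_iff)
  then have "AE y in distr M lborel (X t). q x0 = q (x0 + y)"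
    by (subst AE_distr_iff) auto
  moreover have "distr M lborel (X t) = density lborel (\<lambda>x. ennreal (p x))"
    using dens by (simp add: distributed_def)
  ultimately have "AE y in density lborel (\<lambda>x. ennreal (p x)). q x0 = q (x0 + y)"
    by metis
  then have "AE y in lborel. q x0 = q (x0 + y)"
    using dens p by (subst (asm) AE_density) (auto simp: distributed_def)
  then have "AE y in distr lborel borel ((+) x0). q x0 = q y"
    by (subst AE_distr_iff) auto
  then have "AE y in lborel. q x0 = q y" by (metis lborel_distr_plus)
  then have "AE y in lborel. u y = q x0 * \<phi> y"
    by eventually_elim (simp add: q_def)
  then have "abs_L2 u = abs_L2 (\<lambda>y. q x0 * \<phi> y)"
    using u(1) by (simp add: abs_L2_eq_iff L2_fun_cmult phi_L2)
  then show ?thesis using u(2) by (auto simp: scaleR_abs_L2 phi_L2)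
qed

text \<open>The factor \<open>exp (lam t)\<close> in the ground state transform shifts the generator by \<open>lam\<close>: the
  difference quotients of the two semigroups determine each other up to a factor that tends to 1
  and a term that tends to \<open>- lam\<close> times the vector.\<close>

lemma schroedinger_op_iff:
  assumes g: "L2_fun g" and h: "L2_fun h"
  shows "(g, h) \<in> schroedinger_op M X V \<longleftrightarrow> S.gen (abs_L2 g) (abs_L2 h - lam *\<^sub>R abs_L2 g)"
proof -
  define u where "u = abs_L2 g"
  define D where "D t = (1 / t) *\<^sub>R (u - abs_L2 (fk t g))" for t
  define E where "E t = (1 / t) *\<^sub>R (u - Tt t u)" for t
  have nn: "(\<integral>\<^sup>+x. ennreal (((g x - fk t g x) / t - h x)\<^sup>2) \<partial>lborel) = ennreal ((norm (D t - abs_L2 h))\<^sup>2)" if t: "0 < t" for t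
  proof -
    note L = fk_L2_bound(1)[OF t g]
    have "L2_fun (\<lambda>x. (1 / t) * (g x - fk t g x) - h x)"
      by (intro L2_fun_diff L2_fun_cmult g h L)
    moreover have "abs_L2 (\<lambda>x. (1 / t) * (g x - fk t g x) - h x) = D t - abs_L2 h"
      using g h L by (simp only: D_def u_def diff_abs_L2 scaleR_abs_L2 L2_fun_diff L2_fun_cmult)
    ultimately show ?thesis
      using nn_integral_square_L2[of "\<lambda>x. (1 / t) * (g x - fk t g x) - h x"] by (simp add: divide_inverse mult.commute)
  qed
  have "(g, h) \<in> schroedinger_op M X V \<longleftrightarrow> ((\<lambda>t. \<integral>\<^sup>+x. ennreal (((g x - fk t g x) / t - h x)\<^sup>2) \<partial>lborel) \<longlongrightarrow> 0) (at_right 0)"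
    using g h by (simp add: schroedinger_op_def)
  also have "\<dots> \<longleftrightarrow> ((\<lambda>t. ennreal ((norm (D t - abs_L2 h))\<^sup>2)) \<longlongrightarrow> 0) (at_right 0)"
    by (rule tendsto_cong, rule eventually_mono[OF S.ev_pos]) (rule nn)
  also have "\<dots> \<longleftrightarrow> ((\<lambda>t. ennreal ((norm (D t - abs_L2 h))\<^sup>2)) \<longlongrightarrow> ennreal 0) (at_right 0)"
    by simp
  also have "\<dots> \<longleftrightarrow> ((\<lambda>t. (norm (D t - abs_L2 h))\<^sup>2) \<longlongrightarrow> 0) (at_right 0)"
    by (rule tendsto_ennreal_iff) auto
  also have "\<dots> \<longleftrightarrow> ((\<lambda>t. norm (D t - abs_L2 h)) \<longlongrightarrow> 0) (at_right 0)"
  proof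
    assume "((\<lambda>t. (norm (D t - abs_L2 h))\<^sup>2) \<longlongrightarrow> 0) (at_right 0)"
    from tendsto_real_sqrt[OF this] show "((\<lambda>t. norm (D t - abs_L2 h)) \<longlongrightarrow> 0) (at_right 0)" by simp
  next
    assume "((\<lambda>t. norm (D t - abs_L2 h)) \<longlongrightarrow> 0) (at_right 0)"
    from tendsto_power[OF this, of 2] show "((\<lambda>t. (norm (D t - abs_L2 h))\<^sup>2) \<longlongrightarrow> 0) (at_right 0)" by simp
  qed
  also have "\<dots> \<longleftrightarrow> (D \<longlongrightarrow> abs_L2 h) (at_right 0)"
    by (simp add: tendsto_norm_zero_iff LIM_zero_iff)
  also have "\<dots> \<longleftrightarrow> (E \<longlongrightarrow> abs_L2 h - lam *\<^sub>R u) (at_right 0)"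
  proof -
    have c1: "((\<lambda>t. exp (lam * t)) \<longlongrightarrow> 1) (at_right 0)" by real_asymp
    have c2: "((\<lambda>t. exp (- lam * t)) \<longlongrightarrow> 1) (at_right 0)" by real_asymp
    have c3: "((\<lambda>t. (1 - exp (lam * t)) / t) \<longlongrightarrow> - lam) (at_right 0)" by real_asymp
    have ED: "E t = exp (lam * t) *\<^sub>R D t + ((1 - exp (lam * t)) / t) *\<^sub>R u" if "0 < t" for t
      using that by (simp add: E_def D_def u_def Tt_abs[OF that g] algebra_simps diff_divide_distrib)
    show ?thesis
    proof
      assume "(D \<longlongrightarrow> abs_L2 h) (at_right 0)"
      then have "((\<lambda>t. exp (lam * t) *\<^sub>R D t + ((1 - exp (lam * t)) / t) *\<^sub>R u) \<longlongrightarrow> 1 *\<^sub>R abs_L2 h + (- lam) *\<^sub>R u) (at_right 0)"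
        by (intro tendsto_add tendsto_scaleR c1 c3 tendsto_const)
      then have "((\<lambda>t. exp (lam * t) *\<^sub>R D t + ((1 - exp (lam * t)) / t) *\<^sub>R u) \<longlongrightarrow> abs_L2 h - lam *\<^sub>R u) (at_right 0)"
        by simp
      then show "(E \<longlongrightarrow> abs_L2 h - lam *\<^sub>R u) (at_right 0)"
        by (rule Lim_transform_eventually) (rule eventually_mono[OF S.ev_pos], simp add: ED)
    next
      assume "(E \<longlongrightarrow> abs_L2 h - lam *\<^sub>R u) (at_right 0)"
      then have "((\<lambda>t. exp (- lam * t) *\<^sub>R (E t - ((1 - exp (lam * t)) / t) *\<^sub>R u)) \<longlongrightarrow> 1 *\<^sub>R ((abs_L2 h - lam *\<^sub>R u) - (- lam) *\<^sub>R u)) (at_right 0)"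
        by (intro tendsto_diff tendsto_scaleR c2 c3 tendsto_const)
      then have "((\<lambda>t. exp (- lam * t) *\<^sub>R (E t - ((1 - exp (lam * t)) / t) *\<^sub>R u)) \<longlongrightarrow> abs_L2 h) (at_right 0)"
        by simp
      then show "(D \<longlongrightarrow> abs_L2 h) (at_right 0)"
        by (rule Lim_transform_eventually) (rule eventually_mono[OF S.ev_pos], simp add: ED mult_exp_exp)
    qed
  qed
  finally show ?thesis by (simp add: S.gen_def E_def[abs_def] u_def)
qed

end

text \<open>A lower bound \<open>\<epsilon>\<close> for the distance of \<open>lam\<close> from the rest of the spectrum becomes the rate
  of decay of correlations. The positive density at time \<open>tb\<close> makes the eigenvalue simple.\<close>

locale gapped_gst = gst_setting M X V lam \<phi> N Y for M :: "'w measure" and X :: "real \<Rightarrow> 'w \<Rightarrow> 'a::euclidean_space"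
    and V lam \<phi> and N :: "'v measure" and Y +
  fixes \<epsilon> tb :: real and p :: "'a \<Rightarrow> real"
  assumes eps: "0 < \<epsilon>" and res: "0 < \<bar>\<mu> - lam\<bar> \<Longrightarrow> \<bar>\<mu> - lam\<bar> < \<epsilon> \<Longrightarrow> \<mu> \<in> resolvent_set (schroedinger_op M X V)"
    and tb: "0 < tb" and dens: "distributed M lborel (X tb) (\<lambda>x. ennreal (p x))" and p_pos: "0 < p x"
begin

lemma spectral_gap:
  assumes orth: "inner v (abs_L2 \<phi>) = 0" and t: "0 < t"
  shows "norm (Tt t v) \<le> exp (- \<epsilon> * t) * norm v"
proof (rule S.spectral_gap_decay[OF eps])
  fix \<mu> :: real assume \<mu>: "0 < \<bar>\<mu>\<bar>" "\<bar>\<mu>\<bar> < \<epsilon>"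
  then have R: "lam + \<mu> \<in> resolvent_set (schroedinger_op M X V)" by (intro res) auto
  have sub: "abs_L2 (\<lambda>x. h x - (lam + \<mu>) * g x) = (abs_L2 h - lam *\<^sub>R abs_L2 g) - \<mu> *\<^sub>R abs_L2 g"
    if "L2_fun g" "L2_fun h" for g h
    using that by (simp add: diff_abs_L2 scaleR_abs_L2 L2_fun_diff L2_fun_cmult algebra_simps)
  obtain C where C: "\<And>g h. (g, h) \<in> schroedinger_op M X V \<Longrightarrow> L2_norm g \<le> C * L2_norm (\<lambda>x. h x - (lam + \<mu>) * g x)"
  proof -
    have "\<exists>C. \<forall>(g, h)\<in>schroedinger_op M X V. L2_norm g \<le> C * L2_norm (\<lambda>x. h x - (lam + \<mu>) * g x)"
      using R unfolding resolvent_set_def by simp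
    then show ?thesis using that by blast
  qed
  show "\<exists>C. \<forall>x y. S.gen x y \<longrightarrow> norm x \<le> C * norm (y - \<mu> *\<^sub>R x)"
  proof (intro exI[of _ C] allI impI)
    fix x y :: "'a L2" assume xy: "S.gen x y"
    obtain g h where g: "L2_fun g" "x = abs_L2 g" and h: "L2_fun h" "y + lam *\<^sub>R x = abs_L2 h" by (metis L2_cases)
    have "y = abs_L2 h - lam *\<^sub>R abs_L2 g" using g(2) by (simp add: h(2)[symmetric])
    then have "(g, h) \<in> schroedinger_op M X V" using xy g h by (simp add: schroedinger_op_iff)
    from C[OF this] show "norm x \<le> C * norm (y - \<mu> *\<^sub>R x)"
      using g h \<open>y = _\<close> by (simp add: norm_abs_L2[symmetric] sub L2_fun_diff L2_fun_cmult)
  qed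
  fix k :: "'a L2"
  obtain kf where kf: "L2_fun kf" "k = abs_L2 kf" by (metis L2_cases)
  then obtain g h where gh: "(g, h) \<in> schroedinger_op M X V" "AE x in lborel. h x - (lam + \<mu>) * g x = kf x"
    using R by (fastforce simp: resolvent_set_def)
  then have L: "L2_fun g" "L2_fun h" by (auto simp: schroedinger_op_def)
  have "abs_L2 (\<lambda>x. h x - (lam + \<mu>) * g x) = k"
    using gh L kf by (simp add: abs_L2_eq_iff L2_fun_diff L2_fun_cmult)
  then show "\<exists>x y. S.gen x y \<and> y - \<mu> *\<^sub>R x = k"
    using gh(1) L by (intro exI[of _ "abs_L2 g"] exI[of _ "abs_L2 h - lam *\<^sub>R abs_L2 g"]) (simp add: schroedinger_op_iff sub)
next
  show "Tt t (abs_L2 \<phi>) = abs_L2 \<phi>" if "0 < t" for t using Tt_phi[OF that] .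
  show "\<exists>c. x = c *\<^sub>R abs_L2 \<phi>" if "\<And>t. 0 < t \<Longrightarrow> Tt t x = x" for x
    using fixed_vector_multiple[OF tb dens p_pos that[OF tb]] .
qed (use orth t in auto)

text \<open>A two-point expectation is a matrix element of the semigroup between \<open>\<phi> g0\<close> and \<open>\<phi> g1\<close>, and
  means are inner products with the ground state. Subtracting the product of the means replaces
  \<open>\<phi> g1\<close> by its component orthogonal to the ground state.\<close>

theorem covariance_decay:
  assumes g0: "g0 \<in> borel_measurable borel" "bounded (range g0)" and g1: "g1 \<in> borel_measurable borel" "bounded (range g1)"
    and t: "0 < t"
  shows "\<bar>(\<integral>\<omega>. g0 (Y s \<omega>) * g1 (Y (s + t) \<omega>) \<partial>N) - (\<integral>\<omega>. g0 (Y s \<omega>) \<partial>N) * (\<integral>\<omega>. g1 (Y (s + t) \<omega>) \<partial>N)\<bar>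
     \<le> exp (- \<epsilon> * t) * (sqrt (\<integral>\<omega>. (g0 (Y s \<omega>))\<^sup>2 \<partial>N) * sqrt (\<integral>\<omega>. (g1 (Y (s + t) \<omega>))\<^sup>2 \<partial>N))"
proof -
  define e where "e = abs_L2 \<phi>"
  define u0 where "u0 = abs_L2 (\<lambda>x. \<phi> x * g0 x)"
  define u1 where "u1 = abs_L2 (\<lambda>x. \<phi> x * g1 x)"
  note L0 = L2_fun_phi_mult[OF g0] and L1 = L2_fun_phi_mult[OF g1]
  have ee: "inner e e = 1"
    using phi_norm norm_abs_L2[OF phi_L2] by (simp add: e_def power2_norm_eq_inner[symmetric])
  have mean: "(\<integral>\<omega>. g (Y s \<omega>) \<partial>N) = inner (abs_L2 (\<lambda>x. \<phi> x * g x)) e" "(\<integral>\<omega>. (g (Y s \<omega>))\<^sup>2 \<partial>N) = (norm (abs_L2 (\<lambda>x. \<phi> x * g x)))\<^sup>2"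
    if g: "g \<in> borel_measurable borel" "bounded (range g)" for g s
  proof -
    note L = L2_fun_phi_mult[OF g]
    show "(\<integral>\<omega>. g (Y s \<omega>) \<partial>N) = inner (abs_L2 (\<lambda>x. \<phi> x * g x)) e"
      unfolding one_point[OF g] e_def by (simp add: inner_abs_L2[OF L phi_L2] power2_eq_square ac_simps)
    obtain B where B: "\<And>x. \<bar>g x\<bar> \<le> B" using g(2) by (auto simp: bounded_iff)
    have "\<bar>(g x)\<^sup>2\<bar> \<le> B\<^sup>2" for x using B[of x] by (metis abs_ge_zero abs_power2 order_trans power2_abs power_mono)
    then have "bounded (range (\<lambda>x. (g x)\<^sup>2))" by (auto simp: bounded_iff)
    moreover have "(\<lambda>x. (g x)\<^sup>2) \<in> borel_measurable borel" using g(1) by measurable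
    ultimately have "(\<integral>\<omega>. (g (Y s \<omega>))\<^sup>2 \<partial>N) = (\<integral>x. (g x)\<^sup>2 * (\<phi> x)\<^sup>2 \<partial>lborel)" using one_point by blast
    then show "(\<integral>\<omega>. (g (Y s \<omega>))\<^sup>2 \<partial>N) = (norm (abs_L2 (\<lambda>x. \<phi> x * g x)))\<^sup>2"
      by (simp add: norm_abs_L2[OF L] L2_norm_def power_mult_distrib mult.commute)
  qed
  define v where "v = u1 - (inner u1 e) *\<^sub>R e"
  have ve: "inner v e = 0" by (simp add: v_def inner_diff_left ee)
  interpret Tl: bounded_linear "Tt t" by (rule S.bounded_linear_T[OF t])
  have "(norm u1)\<^sup>2 = (norm v)\<^sup>2 + (inner u1 e)\<^sup>2"
    using ee unfolding v_def norm_diff_square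
    by (simp add: norm_eq_sqrt_inner[of e] power_mult_distrib) (simp add: power2_eq_square)
  then have "(norm v)\<^sup>2 \<le> (norm u1)\<^sup>2" by simp
  then have vu: "norm v \<le> norm u1" by (rule power2_le_imp_le) simp
  have "inner u0 (Tt t u1) - inner u0 e * inner u1 e = inner u0 (Tt t v)"
    by (simp add: v_def Tl.diff Tl.scaleR Tt_phi[OF t, folded e_def] inner_diff_right)
  also have "\<bar>\<dots>\<bar> \<le> norm u0 * norm (Tt t v)" by (rule Cauchy_Schwarz_ineq2)
  also have "\<dots> \<le> norm u0 * (exp (- \<epsilon> * t) * norm v)"
    using spectral_gap[OF ve[unfolded e_def] t] by (intro mult_left_mono) auto
  also have "\<dots> \<le> norm u0 * (exp (- \<epsilon> * t) * norm u1)"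
    using vu by (intro mult_left_mono) auto
  finally have "\<bar>inner u0 (Tt t u1) - inner u0 e * inner u1 e\<bar> \<le> exp (- \<epsilon> * t) * (norm u0 * norm u1)"
    by (simp add: ac_simps)
  then show ?thesis
    unfolding two_point[OF g0 g1 t] mean[OF g0] mean[OF g1] u0_def u1_def by simp
qed

end

section \<open>A Borel-Cantelli lemma under exponentially decaying correlations\<close>

text \<open>Let \<open>S K\<close> count the events before \<open>K\<close> and let \<open>m K\<close> be its mean. The correlation bound
  together with \<open>sqrt (P n) sqrt (P k) \<le> (P n + P k) / 2\<close> and a geometric series yields a variance
  of at most a constant times \<open>m K\<close>. As \<open>m K\<close> diverges, Chebyshev's inequality makes \<open>S K \<le> j\<close> for
  all \<open>K\<close> an event of probability 0.\<close>

lemma (in prob_space) borel_cantelli_correlated: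
  fixes A :: "nat \<Rightarrow> 'a set"
  assumes A [measurable]: "\<And>n. A n \<in> events" and \<rho>: "0 \<le> \<rho>" "\<rho> < 1"
    and corr: "\<And>n m. n \<le> m \<Longrightarrow> \<bar>prob (A n \<inter> A m) - prob (A n) * prob (A m)\<bar> \<le> \<rho> ^ (m - n) * (sqrt (prob (A n)) * sqrt (prob (A m)))"
    and div: "\<not> summable (\<lambda>n. prob (A n))"
  shows "AE \<omega> in M. \<exists>\<^sub>\<infinity>n. \<omega> \<in> A n"
proof -
  define P where "P n = prob (A n)" for n
  have P0: "0 \<le> P n" for n by (simp add: P_def)
  define S where "S K \<omega> = (\<Sum>n<K. indicator (A n) \<omega> :: real)" for K \<omega>
  define m where "m K = (\<Sum>n<K. P n)" for K
  have [measurable]: "S K \<in> borel_measurable M" for K unfolding S_def by measurable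
  have m0: "0 \<le> m K" for K unfolding m_def by (intro sum_nonneg P0)
  have m_top: "filterlim m at_top sequentially"
  proof -
    have mono: "mono m" unfolding m_def by (intro monoI sum_mono2) (auto intro: P0)
    have "\<exists>K. Z \<le> m K" for Z
    proof (rule ccontr)
      assume "\<not> ?thesis"
      then have "m K \<le> Z" for K by (auto simp: not_le less_imp_le)
      then have "summable P" by (intro bounded_imp_summable[where B = Z])
          (auto simp: P0 m_def lessThan_Suc_atMost[symmetric] simp del: lessThan_Suc sum.lessThan_Suc)
      then show False using div by (simp add: P_def[abs_def])
    qed
    then show ?thesis using mono
      by (auto simp: filterlim_at_top eventually_sequentially mono_def) (meson order_trans)
  qed
  have geo: "(\<Sum>k<K. \<rho> ^ (if k \<le> n then n - k else k - n)) \<le> 2 / (1 - \<rho>)" for n K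
  proof -
    have fin: "(\<Sum>k\<in>F. \<rho> ^ h k) \<le> 1 / (1 - \<rho>)" if "finite F" "inj_on h F" for F and h :: "nat \<Rightarrow> nat"
    proof -
      have "(\<Sum>k\<in>F. \<rho> ^ h k) = (\<Sum>j\<in>h ` F. \<rho> ^ j)" using that by (simp add: sum.reindex)
      also have "\<dots> \<le> (\<Sum>j. \<rho> ^ j)"
        using that \<rho> by (intro sum_le_suminf) (auto intro!: summable_geometric)
      also have "\<dots> = 1 / (1 - \<rho>)" using \<rho> by (intro suminf_geometric) auto
      finally show ?thesis .
    qed
    have "(\<Sum>k<K. \<rho> ^ (if k \<le> n then n - k else k - n)) =
      (\<Sum>k\<in>{..<K} \<inter> {..n}. \<rho> ^ (n - k)) + (\<Sum>k\<in>{..<K} \<inter> - {..n}. \<rho> ^ (k - n))"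
    proof -
      have "(\<Sum>k<K. \<rho> ^ (if k \<le> n then n - k else k - n)) = (\<Sum>k<K. if k \<le> n then \<rho> ^ (n - k) else \<rho> ^ (k - n))"
        by (intro sum.cong) auto
      then show ?thesis by (simp add: sum.If_cases atMost_def)
    qed
    also have "\<dots> \<le> 1 / (1 - \<rho>) + 1 / (1 - \<rho>)"
      by (intro add_mono fin) (auto simp: inj_on_def)
    finally show ?thesis by simp
  qed
  have var: "(\<integral>\<omega>. (S K \<omega> - m K)\<^sup>2 \<partial>M) \<le> 2 / (1 - \<rho>) * m K" for K
  proof -
    have int: "integrable M (\<lambda>\<omega>. (indicator (A n) \<omega> - P n) * (indicator (A k) \<omega> - P k))" for n k
    proof (rule integrable_const_bound[of _ 1])
      show "AE \<omega> in M. norm ((indicator (A n) \<omega> - P n) * (indicator (A k) \<omega> - P k)) \<le> 1"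
      proof (rule AE_I2)
        fix \<omega>
        have "\<bar>indicator (A j) \<omega> - P j\<bar> \<le> 1" for j by (auto simp: P_def indicator_def)
        then show "norm ((indicator (A n) \<omega> - P n) * (indicator (A k) \<omega> - P k)) \<le> 1"
          unfolding real_norm_def abs_mult by (intro mult_le_one) auto
      qed
    qed measurable
    have cov: "(\<integral>\<omega>. (indicator (A n) \<omega> - P n) * (indicator (A k) \<omega> - P k) \<partial>M) = prob (A n \<inter> A k) - P n * P k" for n k
    proof -
      have i: "integrable M (\<lambda>\<omega>. indicator B \<omega> :: real)" if "B \<in> events" for B
        using that by (intro integrable_const_bound[of _ 1]) (auto simp: indicator_def)
      have "(\<lambda>\<omega>. (indicator (A n) \<omega> - P n) * (indicator (A k) \<omega> - P k)) =
        (\<lambda>\<omega>. indicator (A n \<inter> A k) \<omega> - P k * indicator (A n) \<omega> - P n * indicator (A k) \<omega> + P n * P k)"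
        by (rule ext) (simp add: indicator_inter_arith algebra_simps)
      then show ?thesis by (simp add: P_def prob_space i)
    qed
    have "S K \<omega> - m K = (\<Sum>n<K. indicator (A n) \<omega> - P n)" for \<omega>
      by (simp add: S_def m_def sum_subtractf)
    then have "(\<integral>\<omega>. (S K \<omega> - m K)\<^sup>2 \<partial>M) = (\<integral>\<omega>. (\<Sum>n<K. \<Sum>k<K. (indicator (A n) \<omega> - P n) * (indicator (A k) \<omega> - P k)) \<partial>M)"
      by (simp add: power2_eq_square sum_product)
    also have "\<dots> = (\<Sum>n<K. \<Sum>k<K. prob (A n \<inter> A k) - P n * P k)"
      by (simp add: Bochner_Integration.integral_sum int cov)
    also have "\<dots> \<le> (\<Sum>n<K. \<Sum>k<K. \<rho> ^ (if k \<le> n then n - k else k - n) * ((P n + P k) / 2))"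
    proof (intro sum_mono)
      fix n k
      have "\<bar>prob (A n \<inter> A k) - P n * P k\<bar> \<le> \<rho> ^ (if k \<le> n then n - k else k - n) * (sqrt (P n) * sqrt (P k))"
        using corr[of n k] corr[of k n] by (cases "k \<le> n") (auto simp: P_def ac_simps)
      also have "\<dots> \<le> \<rho> ^ (if k \<le> n then n - k else k - n) * ((P n + P k) / 2)"
        using arith_geo_mean_sqrt[OF P0 P0, of n k] \<rho> by (intro mult_left_mono) (auto simp: real_sqrt_mult)
      finally show "prob (A n \<inter> A k) - P n * P k \<le> \<rho> ^ (if k \<le> n then n - k else k - n) * ((P n + P k) / 2)"
        by (rule order_trans[OF abs_ge_self])
    qed
    also have "\<dots> = (\<Sum>n<K. \<Sum>k<K. \<rho> ^ (if k \<le> n then n - k else k - n) * P n)"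
    proof -
      define r where "r n k = \<rho> ^ (if k \<le> n then n - k else k - n)" for n k :: nat
      have sym: "r n k = r k n" for n k by (auto simp: r_def)
      have "(\<Sum>n<K. \<Sum>k<K. r n k * ((P n + P k) / 2)) = (\<Sum>n<K. \<Sum>k<K. r n k * P n) / 2 + (\<Sum>n<K. \<Sum>k<K. r n k * P k) / 2"
        by (simp only: add_divide_distrib distrib_left sum.distrib times_divide_eq_right sum_divide_distrib)
      also have "(\<Sum>n<K. \<Sum>k<K. r n k * P k) = (\<Sum>n<K. \<Sum>k<K. r n k * P n)"
        by (subst sum.swap) (simp add: sym)
      finally show ?thesis by (simp add: r_def)
    qed
    also have "\<dots> = (\<Sum>n<K. (\<Sum>k<K. \<rho> ^ (if k \<le> n then n - k else k - n)) * P n)"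
      by (simp add: sum_distrib_right)
    also have "\<dots> \<le> (\<Sum>n<K. 2 / (1 - \<rho>) * P n)"
      by (intro sum_mono mult_right_mono geo P0)
    also have "\<dots> = 2 / (1 - \<rho>) * m K" by (simp add: m_def sum_distrib_left)
    finally show ?thesis .
  qed
  have null: "AE \<omega> in M. \<exists>K. real j < S K \<omega>" for j :: nat
  proof -
    define B where "B = {\<omega> \<in> space M. \<forall>K. S K \<omega> \<le> real j}"
    have [measurable]: "B \<in> events" unfolding B_def by measurable
    have bd: "prob B \<le> 2 / (1 - \<rho>) * (m K / (m K - real j)\<^sup>2)" if "real j < m K" for K
    proof -
      have "(m K - real j)\<^sup>2 * prob B = (\<integral>\<omega>. (m K - real j)\<^sup>2 * indicator B \<omega> \<partial>M)" by simp
      also have "\<dots> \<le> (\<integral>\<omega>. (S K \<omega> - m K)\<^sup>2 \<partial>M)"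
      proof (rule integral_mono)
        show "integrable M (\<lambda>\<omega>. (S K \<omega> - m K)\<^sup>2)"
        proof (rule integrable_const_bound[of _ "(real K + m K)\<^sup>2"])
          show "AE \<omega> in M. norm ((S K \<omega> - m K)\<^sup>2) \<le> (real K + m K)\<^sup>2"
          proof (rule AE_I2)
            fix \<omega>
            have "0 \<le> S K \<omega>" "S K \<omega> \<le> real K"
              using sum_bounded_above[of "{..<K}" "\<lambda>n. indicator (A n) \<omega> :: real" 1] by (auto simp: S_def intro: sum_nonneg)
            then have "\<bar>S K \<omega> - m K\<bar> \<le> real K + m K" using m0[of K] by linarith
            then show "norm ((S K \<omega> - m K)\<^sup>2) \<le> (real K + m K)\<^sup>2"
              by (simp add: power2_le_iff_abs_le m0)
          qed
        qed measurable
        show "(m K - real j)\<^sup>2 * indicator B \<omega> \<le> (S K \<omega> - m K)\<^sup>2" if "\<omega> \<in> space M" for \<omega>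
        proof (cases "\<omega> \<in> B")
          case True
          then have "S K \<omega> \<le> real j" by (simp add: B_def)
          then have "(m K - real j)\<^sup>2 \<le> (m K - S K \<omega>)\<^sup>2" using \<open>real j < m K\<close> by (intro power_mono) auto
          then show ?thesis using True by (simp add: power2_commute)
        qed simp
        show "integrable M (\<lambda>\<omega>. (m K - real j)\<^sup>2 * indicator B \<omega>)"
          by (intro integrable_mult_right integrable_const_bound[of _ 1]) (auto simp: indicator_def)
      qed
      also have "\<dots> \<le> 2 / (1 - \<rho>) * m K" by (rule var)
      finally have "(m K - real j)\<^sup>2 * prob B \<le> 2 / (1 - \<rho>) * m K" .
      moreover have "0 < (m K - real j)\<^sup>2" using that by simp
      ultimately have "prob B \<le> (2 / (1 - \<rho>) * m K) / (m K - real j)\<^sup>2"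
        by (metis pos_le_divide_eq mult.commute)
      then show ?thesis by simp
    qed
    have "((\<lambda>x::real. x / (x - c)\<^sup>2) \<longlongrightarrow> 0) at_top" for c by real_asymp
    then have lim: "((\<lambda>x::real. 2 / (1 - \<rho>) * (x / (x - real j)\<^sup>2)) \<longlongrightarrow> 0) at_top"
      by (rule tendsto_mult_right_zero)
    have "prob B \<le> 0"
    proof (rule tendsto_lowerbound[OF filterlim_compose[OF lim m_top]])
      show "\<forall>\<^sub>F K in sequentially. prob B \<le> 2 / (1 - \<rho>) * (m K / (m K - real j)\<^sup>2)"
        using filterlim_at_top_dense[THEN iffD1, OF m_top, rule_format, of "real j"]
        by eventually_elim (rule bd)
    qed simp
    then have "prob B = 0" by (simp add: measure_le_0_iff)
    then have "AE \<omega> in M. \<omega> \<notin> B" by (simp add: prob_eq_0)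
    then show ?thesis by (rule AE_mp) (auto intro!: AE_I2 simp: B_def not_le)
  qed
  have "AE \<omega> in M. \<forall>j::nat. \<exists>K. real j < S K \<omega>" by (subst AE_all_countable) (use null in blast)
  then show ?thesis
  proof eventually_elim
    case (elim \<omega>)
    show ?case
    proof (rule ccontr)
      assume "\<not> ?thesis"
      then have fin: "finite {n. \<omega> \<in> A n}" by (simp add: INFM_iff_infinite)
      obtain K where K: "real (card {n. \<omega> \<in> A n}) < S K \<omega>" using elim by blast
      have "S K \<omega> = real (card ({..<K} \<inter> {n. \<omega> \<in> A n}))"
        unfolding S_def indicator_def by (simp add: sum.If_cases of_bool_def)
      also have "\<dots> \<le> real (card {n. \<omega> \<in> A n})" using fin by (intro of_nat_mono card_mono) auto
      finally show False using K by simp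
    qed
  qed
qed

section \<open>Monotone regularly varying functions and their generalized inverses\<close>

locale regular_variation =
  fixes r0 \<alpha> :: real and \<L> :: "real \<Rightarrow> real"
  assumes r0: "0 \<le> r0" and \<alpha>: "0 < \<alpha>" and slow: "slowly_varying r0 \<L>" and mono: "mono_on {r0..} (regular_part \<alpha> \<L>)"
begin

abbreviation R where "R \<equiv> regular_part \<alpha> \<L>"
abbreviation Rs where "Rs \<equiv> gen_inverse r0 R"

lemma R_pos: "r0 \<le> r \<Longrightarrow> 0 < r \<Longrightarrow> 0 < R r"
  using slow unfolding slowly_varying_def regular_part_def by simp

lemma R_mono: "r0 \<le> r \<Longrightarrow> r \<le> s \<Longrightarrow> R r \<le> R s"
  by (rule mono_onD[OF mono]) auto

lemma R_ratio: "0 < s \<Longrightarrow> ((\<lambda>r. R (s * r) / R r) \<longlongrightarrow> s powr \<alpha>) at_top"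
proof -
  assume s: "0 < s"
  have "((\<lambda>r. s powr \<alpha> * (\<L> (s * r) / \<L> r)) \<longlongrightarrow> s powr \<alpha> * 1) at_top"
    using slow s by (intro tendsto_intros) (auto simp: slowly_varying_def)
  then have "((\<lambda>r. s powr \<alpha> * (\<L> (s * r) / \<L> r)) \<longlongrightarrow> s powr \<alpha>) at_top" by simp
  then show ?thesis
  proof (rule Lim_transform_eventually)
    show "\<forall>\<^sub>F r in at_top. s powr \<alpha> * (\<L> (s * r) / \<L> r) = R (s * r) / R r"
      using eventually_gt_at_top[of 0]
      by eventually_elim (use s in \<open>simp add: regular_part_def powr_mult\<close>)
  qed
qed

lemma R_ratio2:
  assumes "0 < a" "0 < b"
  shows "((\<lambda>r. R (a * r) / R (b * r)) \<longlongrightarrow> (a / b) powr \<alpha>) at_top"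
proof -
  have "filterlim (\<lambda>r. b * r) at_top at_top"
    using assms(2) by (rule filterlim_tendsto_pos_mult_at_top[OF tendsto_const _ filterlim_ident])
  from filterlim_compose[OF R_ratio[of "a / b"] this] show ?thesis using assms by simp
qed

text \<open>The quotient of \<open>R (2 r)\<close> and \<open>R r\<close> tends to \<open>2 powr \<alpha> > 1\<close>, so \<open>R\<close> grows geometrically
  along the doublings of some radius.\<close>

lemma R_at_top: "filterlim R at_top at_top"
proof -
  have "1 < (2::real) powr \<alpha>" using \<alpha> by simp
  define q where "q = (1 + 2 powr \<alpha>) / 2"
  have q: "1 < q" "q < 2 powr \<alpha>" using \<open>1 < 2 powr \<alpha>\<close> by (auto simp: q_def)
  have "\<forall>\<^sub>F r in at_top. q < R (2 * r) / R r"
    using order_tendstoD(1)[OF R_ratio[of 2] q(2)] by simp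
  then obtain r1 where r1: "\<And>r. r1 \<le> r \<Longrightarrow> q < R (2 * r) / R r"
    by (auto simp: eventually_at_top_linorder)
  define r2 where "r2 = max (max r1 r0) 1"
  have r2: "r1 \<le> r2" "r0 \<le> r2" "1 \<le> r2" by (auto simp: r2_def)
  have grow: "q ^ k * R r2 \<le> R (2 ^ k * r2)" for k
  proof (induction k)
    case (Suc k)
    have ge: "r2 \<le> 2 ^ k * r2" using r2 by simp
    then have big: "r1 \<le> 2 ^ k * r2" "r0 \<le> 2 ^ k * r2" "0 < 2 ^ k * r2" using r2 by linarith+
    have "q * R (2 ^ k * r2) \<le> R (2 * (2 ^ k * r2))"
      using r1[OF big(1)] R_pos[OF big(2,3)] by (simp add: pos_less_divide_eq less_imp_le)
    moreover have "q * (q ^ k * R r2) \<le> q * R (2 ^ k * r2)" using Suc q by (intro mult_left_mono) auto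
    ultimately show ?case by (simp add: mult.assoc)
  qed simp
  show ?thesis
  proof (rule filterlim_at_top[THEN iffD2], rule allI)
    fix Z
    have Rp: "0 < R r2" using r2 by (intro R_pos) auto
    obtain k where k: "Z / R r2 < q ^ k" using real_arch_pow[OF q(1)] by blast
    have "Z \<le> R (2 ^ k * r2)" using grow[of k] k Rp by (simp add: pos_divide_less_eq)
    moreover have "r0 \<le> 2 ^ k * r2"
    proof -
      have "r2 \<le> 2 ^ k * r2" using r2 by simp
      then show ?thesis using r2 by linarith
    qed
    ultimately show "\<forall>\<^sub>F r in at_top. Z \<le> R r"
      using R_mono by (auto simp: eventually_at_top_linorder intro!: exI[of _ "2 ^ k * r2"] intro: order_trans)
  qed
qed

lemma level_set: "{s. r0 \<le> s \<and> u \<le> R s} \<noteq> {}" "bdd_below {s. r0 \<le> s \<and> u \<le> R s}"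
proof -
  have "\<forall>\<^sub>F r in at_top. u \<le> R r" using R_at_top unfolding filterlim_at_top by (rule spec)
  then have "\<forall>\<^sub>F r in at_top. u \<le> R r \<and> r0 \<le> r"
    using eventually_ge_at_top[of r0] by (rule eventually_conj)
  from eventually_happens'[OF _ this] obtain r where "u \<le> R r \<and> r0 \<le> r" by auto
  then show "{s. r0 \<le> s \<and> u \<le> R s} \<noteq> {}" by blast
  show "bdd_below {s. r0 \<le> s \<and> u \<le> R s}" by (rule bdd_belowI[of _ r0]) auto
qed

lemma R_above: assumes "Rs u < s" shows "u \<le> R s"
proof -
  obtain s' where "r0 \<le> s'" "u \<le> R s'" "s' < s"
    using assms cInf_lessD[OF level_set(1)[of u]] unfolding gen_inverse_def by blast
  then show ?thesis using R_mono[of s' s] by simp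
qed

lemma R_below: assumes "r0 \<le> s" "s < Rs u" shows "R s < u"
proof (rule ccontr)
  assume "\<not> R s < u"
  then have "Rs u \<le> s" unfolding gen_inverse_def using assms level_set by (intro cInf_lower) auto
  then show False using assms by simp
qed

lemma Rs_at_top: "filterlim Rs at_top at_top"
  unfolding filterlim_at_top
proof (intro allI)
  fix Z :: real
  have "Z \<le> Rs u" if "R Z < u" for u
    using R_above[of u Z] that by linarith
  then show "\<forall>\<^sub>F u in at_top. Z \<le> Rs u"
    using eventually_gt_at_top[of "R Z"] by (rule eventually_mono[rotated])
qed

lemma Rs_eventually_ge: "\<forall>\<^sub>F u in at_top. Z \<le> Rs u"
  using Rs_at_top unfolding filterlim_at_top by (rule spec)

text \<open>By monotonicity \<open>u\<close> lies between the values of \<open>R\<close> at \<open>(1 - d) Rs u\<close> and \<open>(1 + d) Rs u\<close>,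
  whatever \<open>R\<close> does at \<open>Rs u\<close> itself. Regular variation compares these values with \<open>R (c * Rs u)\<close>,
  and \<open>d\<close> is arbitrary.\<close>

lemma R_Rs: assumes c: "0 < c" shows "((\<lambda>u. R (c * Rs u) / u) \<longlongrightarrow> c powr \<alpha>) at_top"
proof (rule order_tendstoI)
  fix a assume a: "a < c powr \<alpha>"
  have "((\<lambda>d. (c / (1 + d)) powr \<alpha>) \<longlongrightarrow> (c / (1 + 0)) powr \<alpha>) (at_right 0)"
    using c by (intro tendsto_intros) auto
  then have "\<forall>\<^sub>F d in at_right 0. a < (c / (1 + d)) powr \<alpha>" using a by (intro order_tendstoD) auto
  then obtain d where d: "0 < d" "a < (c / (1 + d)) powr \<alpha>"
    unfolding eventually_at_right_field by (metis field_lbound_gt_zero less_numeral_extra(1) dense)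
  have "((\<lambda>u. R (c * Rs u) / R ((1 + d) * Rs u)) \<longlongrightarrow> (c / (1 + d)) powr \<alpha>) at_top"
    using c d by (intro filterlim_compose[OF R_ratio2 Rs_at_top]) auto
  then have "\<forall>\<^sub>F u in at_top. a < R (c * Rs u) / R ((1 + d) * Rs u)" using d by (intro order_tendstoD)
  moreover have "\<forall>\<^sub>F u in at_top. max 1 (max r0 (r0 / c)) \<le> Rs u" by (rule Rs_eventually_ge)
  moreover have "\<forall>\<^sub>F u::real in at_top. 0 < u" by (rule eventually_gt_at_top)
  ultimately show "\<forall>\<^sub>F u in at_top. a < R (c * Rs u) / u"
  proof eventually_elim
    case (elim u)
    have "Rs u < (1 + d) * Rs u" using elim d by simp
    then have "u \<le> R ((1 + d) * Rs u)" by (rule R_above)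
    moreover have "0 < R (c * Rs u)" using elim c by (intro R_pos) (auto simp: pos_divide_le_eq mult.commute)
    ultimately have "R (c * Rs u) / R ((1 + d) * Rs u) \<le> R (c * Rs u) / u"
      using elim by (intro divide_left_mono) (auto intro!: mult_pos_pos)
    then show ?case using elim by simp
  qed
next
  fix a assume a: "c powr \<alpha> < a"
  have "((\<lambda>d. (c / (1 - d)) powr \<alpha>) \<longlongrightarrow> (c / (1 - 0)) powr \<alpha>) (at_right 0)"
    using c by (intro tendsto_intros) auto
  then have "\<forall>\<^sub>F d in at_right 0. (c / (1 - d)) powr \<alpha> < a" using a by (intro order_tendstoD) auto
  moreover have "\<forall>\<^sub>F d::real in at_right 0. d < 1" by (auto simp: eventually_at_right_field intro!: exI[of _ 1])
  ultimately have "\<forall>\<^sub>F d in at_right 0. (c / (1 - d)) powr \<alpha> < a \<and> d < 1 \<and> 0 < d"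
    using eventually_at_right_less[of 0] by eventually_elim simp
  then obtain d where d: "0 < d" "d < 1" "(c / (1 - d)) powr \<alpha> < a"
    by (metis (mono_tags, lifting) eventually_happens trivial_limit_at_right_real)
  have "((\<lambda>u. R (c * Rs u) / R ((1 - d) * Rs u)) \<longlongrightarrow> (c / (1 - d)) powr \<alpha>) at_top"
    using c d by (intro filterlim_compose[OF R_ratio2 Rs_at_top]) auto
  then have "\<forall>\<^sub>F u in at_top. R (c * Rs u) / R ((1 - d) * Rs u) < a" using d by (intro order_tendstoD)
  moreover have "\<forall>\<^sub>F u in at_top. max 1 (max (r0 / (1 - d)) (r0 / c)) \<le> Rs u" by (rule Rs_eventually_ge)
  moreover have "\<forall>\<^sub>F u::real in at_top. 0 < u" by (rule eventually_gt_at_top)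
  ultimately show "\<forall>\<^sub>F u in at_top. R (c * Rs u) / u < a"
  proof eventually_elim
    case (elim u)
    have lo: "r0 \<le> (1 - d) * Rs u" "0 < (1 - d) * Rs u" using elim d by (auto simp: pos_divide_le_eq mult.commute)
    have "R ((1 - d) * Rs u) < u" by (rule R_below[OF lo(1)]) (use elim d in simp)
    moreover have "0 < R ((1 - d) * Rs u)" using lo by (rule R_pos)
    moreover have "0 < R (c * Rs u)" using elim c by (intro R_pos) (auto simp: pos_divide_le_eq mult.commute)
    ultimately have "R (c * Rs u) / u \<le> R (c * Rs u) / R ((1 - d) * Rs u)"
      using elim by (intro divide_left_mono) (auto intro!: mult_pos_pos)
    then show ?case using elim by simp
  qed
qed

lemma conj_slow_scale: "0 < u \<Longrightarrow> u powr (1 / \<alpha>) * conj_slow r0 \<alpha> \<L> u = Rs u"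
  by (simp add: conj_slow_def)

end

section \<open>Excursions of the ground state-transformed process\<close>

lemma limsup_ge_frequently:
  fixes y b :: "nat \<Rightarrow> real"
  assumes b: "\<forall>\<^sub>F n in sequentially. 0 < b n" and inf: "\<exists>\<^sub>\<infinity>n. c * b n < y n"
  shows "ereal c \<le> limsup (\<lambda>n. ereal (y n / b n))"
proof (rule ccontr)
  assume "\<not> ?thesis"
  then have "limsup (\<lambda>n. ereal (y n / b n)) < ereal c" by simp
  from Limsup_lessD[OF this] b have "\<forall>\<^sub>F n in sequentially. y n < c * b n"
    by eventually_elim (simp add: pos_divide_less_eq)
  then have "\<forall>\<^sub>F n in sequentially. \<not> c * b n < y n" by eventually_elim simp
  then show False using inf by (simp add: frequently_def cofinite_eq_sequentially)
qed

lemma limsup_le_eventually: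
  fixes y b :: "nat \<Rightarrow> real"
  assumes b: "\<forall>\<^sub>F n in sequentially. 0 < b n" and le: "\<forall>\<^sub>F n in sequentially. y n \<le> c * b n"
  shows "limsup (\<lambda>n. ereal (y n / b n)) \<le> ereal c"
proof (rule Limsup_bounded)
  show "\<forall>\<^sub>F n in sequentially. ereal (y n / b n) \<le> ereal c"
    using b le by eventually_elim (simp add: pos_divide_le_eq)
qed

context gst_setting
begin

lemma prob_space_N: "prob_space N" and Y_measurable [measurable]: "Y t \<in> borel_measurable N"
  using gst by (auto simp: gst_process_def)

sublocale N: prob_space N by (rule prob_space_N)

definition tail :: "real \<Rightarrow> real" where
  "tail r = (\<integral>x. indicator {x. r < norm x} x * (\<phi> x)\<^sup>2 \<partial>lborel)"

lemma annulus_measurable [measurable]: "{x::'a. r < norm x} \<in> sets borel"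
  by measurable

lemma indicator_bounded: "bounded (range (indicator S :: 'a \<Rightarrow> real))"
  by (auto simp: bounded_iff indicator_def intro!: exI[of _ 1])

lemma prob_exceed: "N.prob {\<omega> \<in> space N. r < norm (Y s \<omega>)} = tail r"
proof -
  have "N.prob {\<omega> \<in> space N. r < norm (Y s \<omega>)} = (\<integral>\<omega>. indicator {\<omega> \<in> space N. r < norm (Y s \<omega>)} \<omega> \<partial>N)"
    by simp
  also have "\<dots> = (\<integral>\<omega>. indicator {x. r < norm x} (Y s \<omega>) \<partial>N)"
    by (rule Bochner_Integration.integral_cong) (auto simp: indicator_def)
  also have "\<dots> = tail r"
    unfolding tail_def by (rule one_point) (auto simp: indicator_bounded)
  finally show ?thesis .
qed

lemma tail_integrable: "integrable lborel (\<lambda>x. indicator {x. r < norm x} x * (\<phi> x)\<^sup>2)"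
  by (rule Bochner_Integration.integrable_bound[OF phi_square(1)]) (auto simp: indicator_def)

lemma eventually_below:
  assumes "summable (\<lambda>n. tail (r n))"
  shows "AE \<omega> in N. \<forall>\<^sub>F n in sequentially. norm (Y (real n) \<omega>) \<le> r n"
proof -
  have "AE \<omega> in N. \<forall>\<^sub>F n in sequentially. \<omega> \<in> space N - {\<omega> \<in> space N. r n < norm (Y (real n) \<omega>)}"
    by (rule borel_cantelli_AE1) (use assms in \<open>auto simp: prob_exceed N.emeasure_eq_measure less_top[symmetric]\<close>)
  then show ?thesis
    by (rule AE_mp) (auto intro!: AE_I2 simp: not_less elim!: eventually_mono)
qed

text \<open>The annulus between the radii \<open>r\<close> and \<open>r + 2\<close> contains a ball of radius 1.\<close>

lemma tail_lower:
  assumes r: "0 \<le> r" and \<psi>: "0 \<le> \<psi>" and le: "\<And>x. r < norm x \<Longrightarrow> norm x < r + 2 \<Longrightarrow> \<psi> \<le> \<phi> x"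
  shows "\<psi>\<^sup>2 * unit_ball_vol (real DIM('a)) \<le> tail r"
proof -
  obtain b :: 'a where b: "b \<in> Basis" using nonempty_Basis by blast
  define z where "z = (r + 1) *\<^sub>R b"
  have nz: "norm z = r + 1" using r b by (simp add: z_def)
  have B: "r < norm x" "norm x < r + 2" if "x \<in> ball z 1" for x
  proof -
    have "dist z x < 1" using that by simp
    then have "norm (z - x) < 1" by (simp add: dist_norm)
    then show "r < norm x" "norm x < r + 2"
      using norm_triangle_ineq2[of z x] norm_triangle_ineq2[of x z] nz by (auto simp: norm_minus_commute)
  qed
  have "\<psi>\<^sup>2 * unit_ball_vol (real DIM('a)) = (\<integral>x. \<psi>\<^sup>2 * indicator (ball z 1) x \<partial>lborel)"
    by (simp add: content_ball)
  also have "\<dots> \<le> tail r"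
    unfolding tail_def
  proof (rule integral_mono[OF _ tail_integrable])
    show "integrable lborel (\<lambda>x. \<psi>\<^sup>2 * indicator (ball z 1) x)"
      using emeasure_bounded_finite[of "ball z 1"] by (intro integrable_mult_right integrable_real_indicator) auto
    fix x
    show "\<psi>\<^sup>2 * indicator (ball z 1) x \<le> indicator {x. r < norm x} x * (\<phi> x)\<^sup>2"
    proof (cases "x \<in> ball z 1")
      case True
      then show ?thesis using B[OF True] le[of x] \<psi> by (simp add: power_mono)
    qed simp
  qed
  finally show ?thesis .
qed

lemma tail_nonneg: "0 \<le> tail r"
  unfolding tail_def by (intro integral_nonneg_AE) simp

lemma not_summable_tail:
  assumes K: "0 < K" and b: "b \<le> 1" and ev: "\<forall>\<^sub>F n in sequentially. K * real n powr (- b) \<le> tail (r n)"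
  shows "\<not> summable (\<lambda>n. tail (r n))"
proof
  assume "summable (\<lambda>n. tail (r n))"
  moreover from ev have "\<forall>\<^sub>F n in sequentially. norm (K * real n powr (- b)) \<le> tail (r n)"
    by eventually_elim (use K in simp)
  ultimately have "summable (\<lambda>n. K * real n powr (- b))"
    by (rule summable_comparison_test_ev[rotated])
  then have "summable (\<lambda>n. real n powr (- b))" using K by simp
  then show False using b by (simp add: summable_real_powr_iff)
qed

lemma limsup_lower_bound:
  assumes L: "0 < L" and b: "\<forall>\<^sub>F n in sequentially. 0 < b n"
    and inf: "\<And>c. 0 < c \<Longrightarrow> c < L \<Longrightarrow> AE \<omega> in N. \<exists>\<^sub>\<infinity>n. c * b n < norm (Y (real n) \<omega>)"
  shows "AE \<omega> in N. ereal L \<le> limsup (\<lambda>n. ereal (norm (Y (real n) \<omega>) / b n))"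
proof -
  define c where "c k = L - L / real (Suc (Suc k))" for k
  have c: "0 < c k" "c k < L" for k using L by (auto simp: c_def field_simps add_pos_nonneg)
  have "AE \<omega> in N. \<exists>\<^sub>\<infinity>n. c k * b n < norm (Y (real n) \<omega>)" for k using inf[OF c] .
  then have "AE \<omega> in N. \<forall>k. \<exists>\<^sub>\<infinity>n. c k * b n < norm (Y (real n) \<omega>)" by (subst AE_all_countable) blast
  then show ?thesis
  proof eventually_elim
    case (elim \<omega>)
    have lim: "(\<lambda>k. ereal (c k)) \<longlonglongrightarrow> ereal (L - 0)"
      unfolding c_def using lim_const_over_n[of L, THEN LIMSEQ_Suc, THEN LIMSEQ_Suc]
      by (intro tendsto_ereal tendsto_diff tendsto_const)
    have "ereal (c k) \<le> limsup (\<lambda>n. ereal (norm (Y (real n) \<omega>) / b n))" for k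
      using elim by (intro limsup_ge_frequently b) auto
    then show ?case using LIMSEQ_le_const2[OF lim] by auto
  qed
qed

lemma limsup_upper_bound:
  assumes b: "\<forall>\<^sub>F n in sequentially. 0 < b n"
    and ev: "\<And>c. L < c \<Longrightarrow> AE \<omega> in N. \<forall>\<^sub>F n in sequentially. norm (Y (real n) \<omega>) \<le> c * b n"
  shows "AE \<omega> in N. limsup (\<lambda>n. ereal (norm (Y (real n) \<omega>) / b n)) \<le> ereal L"
proof -
  define c where "c k = L + 1 / real (Suc k)" for k
  have c: "L < c k" for k by (auto simp: c_def)
  have "AE \<omega> in N. \<forall>\<^sub>F n in sequentially. norm (Y (real n) \<omega>) \<le> c k * b n" for k using ev[OF c] .
  then have "AE \<omega> in N. \<forall>k. \<forall>\<^sub>F n in sequentially. norm (Y (real n) \<omega>) \<le> c k * b n" by (subst AE_all_countable) blast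
  then show ?thesis
  proof eventually_elim
    case (elim \<omega>)
    have lim: "(\<lambda>k. ereal (c k)) \<longlonglongrightarrow> ereal (L + 0)"
      unfolding c_def using lim_const_over_n[of 1, THEN LIMSEQ_Suc]
      by (intro tendsto_ereal tendsto_add tendsto_const)
    have "limsup (\<lambda>n. ereal (norm (Y (real n) \<omega>) / b n)) \<le> ereal (c k)" for k
      using elim by (intro limsup_le_eventually b) auto
    then show ?case using LIMSEQ_le_const[OF lim] by auto
  qed
qed

end

context gapped_gst
begin

text \<open>For indicator functions the second moments in the bound on covariances are probabilities, so
  that bound is the correlation hypothesis of the Borel-Cantelli lemma with \<open>exp (- \<epsilon>)\<close> in the
  role of \<open>\<rho>\<close>.\<close>

lemma infinitely_often_above:
  assumes div: "\<not> summable (\<lambda>n. tail (r n))"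
  shows "AE \<omega> in N. \<exists>\<^sub>\<infinity>n. r n < norm (Y (real n) \<omega>)"
proof -
  define A where "A n = {\<omega> \<in> space N. r n < norm (Y (real n) \<omega>)}" for n
  have [measurable]: "A n \<in> sets N" for n unfolding A_def by measurable
  have PA: "N.prob (A n) = tail (r n)" for n by (simp add: A_def prob_exceed)
  have "AE \<omega> in N. \<exists>\<^sub>\<infinity>n. \<omega> \<in> A n"
  proof (rule N.borel_cantelli_correlated[where \<rho> = "exp (- \<epsilon>)"])
    fix n m :: nat assume nm: "n \<le> m"
    define g where "g k = (indicator {x. r k < norm x} :: 'a \<Rightarrow> real)" for k
    have g: "g k \<in> borel_measurable borel" "bounded (range (g k))" for k
      by (auto simp: g_def indicator_bounded)
    have gA: "g k (Y (real k) \<omega>) = indicator (A k) \<omega>" if "\<omega> \<in> space N" for k \<omega>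
      using that by (simp add: g_def A_def indicator_def)
    have e1: "(\<integral>\<omega>. g k (Y (real k) \<omega>) \<partial>N) = N.prob (A k)" for k
      by (subst Bochner_Integration.integral_cong[OF refl gA]) auto
    have "(g k x)\<^sup>2 = g k x" for k x by (simp add: g_def indicator_def)
    then have e2: "(\<integral>\<omega>. (g k (Y (real k) \<omega>))\<^sup>2 \<partial>N) = N.prob (A k)" for k using e1 by simp
    have e3: "(\<integral>\<omega>. g n (Y (real n) \<omega>) * g m (Y (real m) \<omega>) \<partial>N) = N.prob (A n \<inter> A m)"
    proof -
      have "(\<integral>\<omega>. g n (Y (real n) \<omega>) * g m (Y (real m) \<omega>) \<partial>N) = (\<integral>\<omega>. indicator (A n \<inter> A m) \<omega> \<partial>N)"
        by (rule Bochner_Integration.integral_cong) (auto simp: gA indicator_inter_arith)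
      then show ?thesis by simp
    qed
    show "\<bar>N.prob (A n \<inter> A m) - N.prob (A n) * N.prob (A m)\<bar>
      \<le> exp (- \<epsilon>) ^ (m - n) * (sqrt (N.prob (A n)) * sqrt (N.prob (A m)))"
    proof (cases "n = m")
      case True
      have "N.prob (A m) * N.prob (A m) \<le> N.prob (A m) * 1" by (intro mult_left_mono) auto
      then show ?thesis using True by simp
    next
      case False
      define k where "k = m - n"
      have k: "0 < real k" "real m = real n + real k" using nm False by (auto simp: k_def)
      have "exp (- \<epsilon>) ^ k = exp (- \<epsilon> * real k)" by (simp add: exp_of_nat_mult[symmetric] mult.commute)
      then show ?thesis
        using covariance_decay[OF g[of n] g[of m] k(1), of "real n"]
        unfolding k(2)[symmetric] e1 e2 e3 by (simp add: k_def)
    qed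
  qed (use eps div in \<open>auto simp: PA\<close>)
  then show ?thesis
    by (rule AE_mp) (auto intro!: AE_I2 simp: A_def elim!: INFM_mono)
qed

text \<open>Write \<open>\<beta> = \<theta> sqrt (\<bar>lam\<bar> + \<delta>)\<close>. Up to a constant the tail beyond \<open>c ln n\<close> is at least the
  \<open>2 \<beta> c\<close>-th power of \<open>1 / n\<close>, and for \<open>c\<close> below the stated bound the exponent is less than 1 as
  soon as \<open>\<delta>\<close> is small.\<close>

lemma exponential_lower_limsup:
  assumes \<theta>: "0 < \<theta>" and lam: "lam \<noteq> 0"
    and lower: "\<And>\<delta>. 0 < \<delta> \<Longrightarrow> \<delta> < 1 \<Longrightarrow> \<exists>C>0. \<forall>x. C * exp (- \<theta> * sqrt (\<bar>lam\<bar> + \<delta>) * norm x) \<le> \<phi> x"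
  shows "AE \<omega> in N. ereal (1 / (2 * \<theta> * sqrt \<bar>lam\<bar>)) \<le> limsup (\<lambda>n. ereal (norm (Y (real n) \<omega>) / ln (real n)))"
proof (rule limsup_lower_bound)
  show "0 < 1 / (2 * \<theta> * sqrt \<bar>lam\<bar>)" using \<theta> lam by simp
  show "\<forall>\<^sub>F n in sequentially. 0 < ln (real n)"
    using eventually_ge_at_top[of 2] by eventually_elim simp
  fix c assume c: "0 < c" "c < 1 / (2 * \<theta> * sqrt \<bar>lam\<bar>)"
  then have lt: "2 * \<theta> * sqrt (\<bar>lam\<bar> + 0) * c < 1" using \<theta> lam by (simp add: pos_less_divide_eq mult.commute)
  have "((\<lambda>\<delta>. 2 * \<theta> * sqrt (\<bar>lam\<bar> + \<delta>) * c) \<longlongrightarrow> 2 * \<theta> * sqrt (\<bar>lam\<bar> + 0) * c) (at_right 0)"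
    by (intro tendsto_intros)
  then have "\<forall>\<^sub>F \<delta> in at_right 0. 2 * \<theta> * sqrt (\<bar>lam\<bar> + \<delta>) * c < 1" using lt by (rule order_tendstoD)
  moreover have "\<forall>\<^sub>F \<delta>::real in at_right 0. \<delta> < 1" by (auto simp: eventually_at_right_field intro!: exI[of _ 1])
  ultimately have "\<forall>\<^sub>F \<delta> in at_right 0. 2 * \<theta> * sqrt (\<bar>lam\<bar> + \<delta>) * c < 1 \<and> \<delta> < 1 \<and> 0 < \<delta>"
    using eventually_at_right_less[of 0] by eventually_elim simp
  from eventually_happens'[OF _ this] obtain \<delta> where \<delta>: "0 < \<delta>" "\<delta> < 1" "2 * \<theta> * sqrt (\<bar>lam\<bar> + \<delta>) * c < 1" by auto
  define \<beta> where "\<beta> = \<theta> * sqrt (\<bar>lam\<bar> + \<delta>)"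
  have \<beta>: "0 < \<beta>" using \<theta> \<delta> by (simp add: \<beta>_def)
  obtain C where C: "0 < C" "\<And>x. C * exp (- \<theta> * sqrt (\<bar>lam\<bar> + \<delta>) * norm x) \<le> \<phi> x" using lower[OF \<delta>(1,2)] by blast
  show "AE \<omega> in N. \<exists>\<^sub>\<infinity>n. c * ln (real n) < norm (Y (real n) \<omega>)"
  proof (rule infinitely_often_above)
    show "\<not> summable (\<lambda>n. tail (c * ln (real n)))"
    proof (rule not_summable_tail)
      show "0 < (C * exp (- 2 * \<beta>))\<^sup>2 * unit_ball_vol (real DIM('a))" using C by simp
      show "2 * \<beta> * c \<le> 1" using \<delta>(3) by (simp add: \<beta>_def)
      show "\<forall>\<^sub>F n in sequentially. (C * exp (- 2 * \<beta>))\<^sup>2 * unit_ball_vol (real DIM('a)) * real n powr - (2 * \<beta> * c) \<le> tail (c * ln (real n))"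
        using eventually_ge_at_top[of 1]
      proof eventually_elim
        case (elim n)
        have "(C * exp (- \<beta> * (c * ln (real n) + 2)))\<^sup>2 * unit_ball_vol (real DIM('a)) \<le> tail (c * ln (real n))"
        proof (rule tail_lower)
          show "0 \<le> c * ln (real n)" using c elim by simp
          show "0 \<le> C * exp (- \<beta> * (c * ln (real n) + 2))" using C by simp
          fix x :: 'a assume x: "norm x < c * ln (real n) + 2"
          then have "\<beta> * norm x \<le> \<beta> * (c * ln (real n) + 2)" using \<beta> by (intro mult_left_mono) auto
          then have "C * exp (- \<beta> * (c * ln (real n) + 2)) \<le> C * exp (- \<theta> * sqrt (\<bar>lam\<bar> + \<delta>) * norm x)"
            using C(1) by (intro mult_left_mono) (auto simp: \<beta>_def)
          then show "C * exp (- \<beta> * (c * ln (real n) + 2)) \<le> \<phi> x" using C(2)[of x] by linarith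
        qed
        also have "(C * exp (- \<beta> * (c * ln (real n) + 2)))\<^sup>2 = (C * exp (- 2 * \<beta>))\<^sup>2 * real n powr - (2 * \<beta> * c)"
        proof -
          have "exp (- \<beta> * (c * ln (real n) + 2)) = exp (- 2 * \<beta>) * exp (- \<beta> * c * ln (real n))"
            by (simp add: mult_exp_exp algebra_simps)
          moreover have "(exp (- \<beta> * c * ln (real n)))\<^sup>2 = real n powr - (2 * \<beta> * c)"
            using elim by (simp add: power2_eq_square mult_exp_exp powr_def algebra_simps)
          ultimately show ?thesis by (simp add: power_mult_distrib)
        qed
        finally show ?case by (simp add: ac_simps)
      qed
    qed
  qed
qed

end

section \<open>Excursions when the logarithm of the profile varies regularly\<close>

locale light_tails = gapped_gst M X V lam \<phi> N Y \<epsilon> tb p + regular_variation r0 \<alpha> \<L>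
  for M :: "'w measure" and X :: "real \<Rightarrow> 'w \<Rightarrow> 'a::euclidean_space" and V lam \<phi> and N :: "'v measure" and Y \<epsilon> tb p r0 \<alpha> \<L> +
  fixes \<nu> :: "'a \<Rightarrow> real" and f :: "real \<Rightarrow> real" and c1 c2 C1 C2 A :: real
  assumes f_pos: "0 < r \<Longrightarrow> 0 < f r" and f_anti: "antimono_on {0<..} f"
    and nu_measurable [measurable]: "\<nu> \<in> borel_measurable borel" and nu_pos: "0 < \<nu> x"
    and nu_levy: "(\<integral>\<^sup>+z. ennreal (min 1 ((norm z)\<^sup>2)) \<partial>jump_measure \<nu>) < \<infinity>"
    and c_pos: "0 < c1" "0 < c2" and nu_f: "x \<noteq> 0 \<Longrightarrow> c1 * f (norm x) \<le> \<nu> x" "x \<noteq> 0 \<Longrightarrow> \<nu> x \<le> c2 * f (norm x)"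
    and C_pos: "0 < C1" "0 < C2" and phi_nu: "C1 * min 1 (\<nu> x) \<le> \<phi> x" "\<phi> x \<le> C2 * min 1 (\<nu> x)"
    and A: "0 < A" and profile: "(\<lambda>r. ln (f r) - (- A * R r)) \<in> o[at_top](R)"
begin

lemma ln_f_ratio: "((\<lambda>r. ln (f r) / R r) \<longlongrightarrow> - A) at_top"
proof -
  have "((\<lambda>r. (ln (f r) - (- A * R r)) / R r - A) \<longlongrightarrow> 0 - A) at_top"
    using smalloD_tendsto[OF profile] by (intro tendsto_intros)
  then have "((\<lambda>r. (ln (f r) - (- A * R r)) / R r - A) \<longlongrightarrow> - A) at_top" by simp
  then show ?thesis
  proof (rule Lim_transform_eventually)
    show "\<forall>\<^sub>F r in at_top. (ln (f r) - (- A * R r)) / R r - A = ln (f r) / R r"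
      using eventually_gt_at_top[of "max 0 r0"]
    proof eventually_elim
      case (elim r)
      then have "0 < R r" by (intro R_pos) auto
      then show ?case by (simp add: field_simps)
    qed
  qed
qed

lemma scale_at_top: "0 < c \<Longrightarrow> filterlim (\<lambda>r::real. c * r) at_top at_top"
  by (rule filterlim_tendsto_pos_mult_at_top[OF tendsto_const _ filterlim_ident])

lemma ln_f_Rs:
  assumes c: "0 < c"
  shows "((\<lambda>u. ln (f (c * Rs u)) / u) \<longlongrightarrow> - A * c powr \<alpha>) at_top"
proof -
  have top: "filterlim (\<lambda>u. c * Rs u) at_top at_top"
    using filterlim_compose[OF scale_at_top[OF c] Rs_at_top] .
  have "((\<lambda>u. ln (f (c * Rs u)) / R (c * Rs u) * (R (c * Rs u) / u)) \<longlongrightarrow> - A * c powr \<alpha>) at_top"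
    by (intro tendsto_mult filterlim_compose[OF ln_f_ratio top] R_Rs c)
  then show ?thesis
  proof (rule Lim_transform_eventually)
    have "\<forall>\<^sub>F u in at_top. max 0 r0 < c * Rs u" using top unfolding filterlim_at_top_dense by (rule spec)
    then show "\<forall>\<^sub>F u in at_top. ln (f (c * Rs u)) / R (c * Rs u) * (R (c * Rs u) / u) = ln (f (c * Rs u)) / u"
    proof eventually_elim
      case (elim u)
      then have "0 < R (c * Rs u)" by (intro R_pos) auto
      then show ?case by simp
    qed
  qed
qed

lemma ln_real_at_top: "filterlim (\<lambda>n. ln (real n)) at_top sequentially"
  using filterlim_compose[OF ln_at_top filterlim_real_sequentially] .

text \<open>In other words, the \<open>q\<close>-th power of \<open>f (c * Rs (ln n))\<close> is \<open>n\<close> to the power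
  \<open>- q A c\<^sup>\<alpha> + o(1)\<close>. With \<open>q\<close> close to 2 this is the size of the squared ground state at radius
  \<open>c * Rs (ln n)\<close>, which explains the critical value of \<open>c\<close>.\<close>

lemma f_Rs_power:
  assumes c: "0 < c" and q: "0 < q"
  shows "b < q * A * c powr \<alpha> \<Longrightarrow> \<forall>\<^sub>F n in sequentially. f (c * Rs (ln (real n))) powr q \<le> real n powr (- b)"
    and "q * A * c powr \<alpha> < b \<Longrightarrow> \<forall>\<^sub>F n in sequentially. real n powr (- b) \<le> f (c * Rs (ln (real n))) powr q"
proof -
  define l where "l n = q * (ln (f (c * Rs (ln (real n)))) / ln (real n))" for n
  have "((\<lambda>u. q * (ln (f (c * Rs u)) / u)) \<longlongrightarrow> q * (- A * c powr \<alpha>)) at_top"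
    by (intro tendsto_mult tendsto_const ln_f_Rs c)
  from filterlim_compose[OF this ln_real_at_top]
  have lim: "l \<longlonglongrightarrow> - (q * A * c powr \<alpha>)" by (simp add: l_def[abs_def] mult.assoc)
  have big: "\<forall>\<^sub>F n in sequentially. 1 \<le> Rs (ln (real n))"
    using filterlim_compose[OF Rs_at_top ln_real_at_top] unfolding filterlim_at_top by (rule spec)
  have "\<forall>\<^sub>F n in sequentially. f (c * Rs (ln (real n))) powr q = real n powr l n \<and> 1 < real n"
    using big eventually_ge_at_top[of 2]
  proof eventually_elim
    case (elim n)
    then have "0 < f (c * Rs (ln (real n)))" "0 < ln (real n)" using c by (auto intro!: f_pos)
    then show ?case using elim by (simp add: powr_def l_def)
  qed
  note ev = this
  show "\<forall>\<^sub>F n in sequentially. f (c * Rs (ln (real n))) powr q \<le> real n powr (- b)" if "b < q * A * c powr \<alpha>"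
  proof -
    have "\<forall>\<^sub>F n in sequentially. l n < - b" using that by (intro order_tendstoD(2)[OF lim]) simp
    with ev show ?thesis by eventually_elim simp
  qed
  show "\<forall>\<^sub>F n in sequentially. real n powr (- b) \<le> f (c * Rs (ln (real n))) powr q" if "q * A * c powr \<alpha> < b"
  proof -
    have "\<forall>\<^sub>F n in sequentially. - b < l n" using that by (intro order_tendstoD(1)[OF lim]) simp
    with ev show ?thesis by eventually_elim simp
  qed
qed

text \<open>The logarithms of the two sides are asymptotic to \<open>- A \<delta> R r\<close> and \<open>- A s\<^sup>\<alpha> R r\<close>, so any \<open>s\<close>
  with \<open>s\<^sup>\<alpha> < \<delta>\<close> serves.\<close>

lemma f_power_dilation:
  assumes \<delta>: "0 < \<delta>"
  obtains s where "0 < s" "\<forall>\<^sub>F r in at_top. f r powr \<delta> \<le> f (s * r)"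
proof -
  define s where "s = (\<delta> / 2) powr (1 / \<alpha>)"
  have s: "0 < s" "s powr \<alpha> = \<delta> / 2" using \<delta> \<alpha> by (auto simp: s_def powr_powr)
  have "((\<lambda>r. ln (f (s * r)) / R (s * r) * (R (s * r) / R r) - \<delta> * (ln (f r) / R r)) \<longlongrightarrow> - A * s powr \<alpha> - \<delta> * - A) at_top"
    by (intro tendsto_intros filterlim_compose[OF ln_f_ratio scale_at_top] ln_f_ratio R_ratio s)
  moreover have "0 < - A * s powr \<alpha> - \<delta> * - A" using A \<delta> by (simp add: s)
  ultimately have "\<forall>\<^sub>F r in at_top. 0 < ln (f (s * r)) / R (s * r) * (R (s * r) / R r) - \<delta> * (ln (f r) / R r)"
    by (rule order_tendstoD)
  moreover have "\<forall>\<^sub>F r in at_top. max r0 (r0 / s) \<le> r" by (rule eventually_ge_at_top)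
  moreover have "\<forall>\<^sub>F r::real in at_top. 0 < r" by (rule eventually_gt_at_top)
  ultimately have "\<forall>\<^sub>F r in at_top. f r powr \<delta> \<le> f (s * r)"
  proof eventually_elim
    case (elim r)
    have "0 < R r" using elim by (intro R_pos) auto
    moreover have "0 < R (s * r)" using elim s by (intro R_pos) (auto simp: pos_divide_le_eq mult.commute)
    ultimately have "\<delta> * ln (f r) < ln (f (s * r))"
      using elim(1) by (simp add: diff_divide_distrib[symmetric] zero_less_divide_iff)
    then have "exp (\<delta> * ln (f r)) \<le> exp (ln (f (s * r)))" by simp
    then show ?case using f_pos[of r] f_pos[of "s * r"] elim s by (simp add: powr_def)
  qed
  with s(1) show ?thesis by (rule that)
qed

text \<open>A Levy measure is finite away from the origin, and a dilation changes this mass by a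
  constant factor.\<close>

lemma nu_dilation_integrable:
  assumes s: "0 < s" and r1: "0 < r1"
  shows "integrable lborel (\<lambda>x. indicator {x. r1 < norm x} x * \<nu> (s *\<^sub>R x))"
proof -
  define H where "H z = ennreal (\<nu> z) * ennreal (min 1 ((norm z)\<^sup>2))" for z
  have [measurable]: "H \<in> borel_measurable borel" unfolding H_def by measurable
  have HI: "(\<integral>\<^sup>+z. H z \<partial>lborel) < \<infinity>"
    using nu_levy unfolding jump_measure_def H_def by (subst (asm) nn_integral_density) auto
  have "(\<integral>\<^sup>+z. H z \<partial>lborel) = ennreal (s ^ DIM('a)) * (\<integral>\<^sup>+x. H (s *\<^sub>R x) \<partial>lborel)"
    using s by (subst lborel_affine[of s 0]) (auto simp: nn_integral_density nn_integral_distr nn_integral_cmult)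
  then have HS: "(\<integral>\<^sup>+x. H (s *\<^sub>R x) \<partial>lborel) < \<infinity>"
    using HI s by (auto simp: ennreal_mult_less_top)
  define k where "k = min 1 ((s * r1)\<^sup>2)"
  have k: "0 < k" using s r1 by (simp add: k_def)
  have "(\<integral>\<^sup>+x. ennreal (norm (indicator {x. r1 < norm x} x * \<nu> (s *\<^sub>R x))) \<partial>lborel) \<le> (\<integral>\<^sup>+x. ennreal (1 / k) * H (s *\<^sub>R x) \<partial>lborel)"
  proof (rule nn_integral_mono)
    fix x :: 'a
    show "ennreal (norm (indicator {x. r1 < norm x} x * \<nu> (s *\<^sub>R x))) \<le> ennreal (1 / k) * H (s *\<^sub>R x)"
    proof (cases "r1 < norm x")
      case True
      have "(s * r1)\<^sup>2 \<le> (norm (s *\<^sub>R x))\<^sup>2" using True s r1 by (intro power_mono) auto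
      then have "k \<le> min 1 ((norm (s *\<^sub>R x))\<^sup>2)" by (auto simp: k_def)
      then have "\<nu> (s *\<^sub>R x) * k \<le> \<nu> (s *\<^sub>R x) * min 1 ((norm (s *\<^sub>R x))\<^sup>2)"
        using nu_pos by (intro mult_left_mono) (auto intro: less_imp_le)
      then have "\<nu> (s *\<^sub>R x) \<le> 1 / k * (\<nu> (s *\<^sub>R x) * min 1 ((norm (s *\<^sub>R x))\<^sup>2))"
        using k by (simp add: pos_le_divide_eq)
      then have "ennreal (\<nu> (s *\<^sub>R x)) \<le> ennreal (1 / k * (\<nu> (s *\<^sub>R x) * min 1 ((norm (s *\<^sub>R x))\<^sup>2)))"
        by (rule ennreal_leI)
      also have "\<dots> = ennreal (1 / k) * H (s *\<^sub>R x)"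
      proof -
        have nn: "0 \<le> \<nu> (s *\<^sub>R x)" using nu_pos[of "s *\<^sub>R x"] by simp
        have "ennreal (1 / k * (\<nu> (s *\<^sub>R x) * min 1 ((norm (s *\<^sub>R x))\<^sup>2))) =
            ennreal (1 / k) * ennreal (\<nu> (s *\<^sub>R x) * min 1 ((norm (s *\<^sub>R x))\<^sup>2))"
          by (rule ennreal_mult) (use k nn in auto)
        also have "ennreal (\<nu> (s *\<^sub>R x) * min 1 ((norm (s *\<^sub>R x))\<^sup>2)) = H (s *\<^sub>R x)"
          unfolding H_def by (rule ennreal_mult) (use nn in auto)
        finally show ?thesis .
      qed
      finally show ?thesis using True nu_pos[of "s *\<^sub>R x"] by simp
    qed simp
  qed
  also have "\<dots> = ennreal (1 / k) * (\<integral>\<^sup>+x. H (s *\<^sub>R x) \<partial>lborel)" by (rule nn_integral_cmult) measurable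
  also have "\<dots> < \<infinity>" using HS by (simp add: ennreal_mult_less_top)
  finally show ?thesis by (intro integrableI_bounded) auto
qed

text \<open>Split the square of the profile as \<open>f\<^bsup>2 - \<delta>\<^esup> f\<^bsup>\<delta>\<^esup>\<close>. Beyond radius \<open>r\<close> the first factor is at
  most its value at \<open>r\<close>, and the second is dominated by a dilation of the Levy density and
  therefore integrable. The loss of \<open>\<delta>\<close> in the exponent does not affect the critical value.\<close>

lemma tail_upper:
  assumes \<delta>: "0 < \<delta>" "\<delta> < 2"
  obtains K where "0 \<le> K" "\<forall>\<^sub>F r in at_top. tail r \<le> K * f r powr (2 - \<delta>)"
proof -
  obtain s where s: "0 < s" "\<forall>\<^sub>F r in at_top. f r powr \<delta> \<le> f (s * r)" using f_power_dilation[OF \<delta>(1)] .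
  obtain r2 where r2: "\<And>r. r2 \<le> r \<Longrightarrow> f r powr \<delta> \<le> f (s * r)" using s(2) by (auto simp: eventually_at_top_linorder)
  define r1 where "r1 = max r2 1"
  have r1: "0 < r1" "r2 \<le> r1" by (auto simp: r1_def)
  define I where "I = (\<integral>x. indicator {x. r1 < norm x} x * \<nu> (s *\<^sub>R x) \<partial>lborel)"
  define K where "K = (C2 * c2)\<^sup>2 / c1"
  have "tail r \<le> (K * I) * f r powr (2 - \<delta>)" if r: "r1 \<le> r" for r
  proof -
    have "tail r \<le> (\<integral>x. K * f r powr (2 - \<delta>) * (indicator {x. r1 < norm x} x * \<nu> (s *\<^sub>R x)) \<partial>lborel)"
      unfolding tail_def
    proof (rule integral_mono[OF tail_integrable integrable_mult_right[OF nu_dilation_integrable[OF s(1) r1(1)]]])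
      fix x :: 'a
      show "indicator {x. r < norm x} x * (\<phi> x)\<^sup>2 \<le> K * f r powr (2 - \<delta>) * (indicator {x. r1 < norm x} x * \<nu> (s *\<^sub>R x))"
      proof (cases "r < norm x")
        case True
        define a where "a = norm x"
        have a: "r < a" "0 < a" "r1 < a" "r2 \<le> a" using True r r1 by (auto simp: a_def)
        have x0: "x \<noteq> 0" using a by (auto simp: a_def)
        have fa: "0 < f a" using a by (intro f_pos)
        have "f a \<le> f r" using monotone_onD[OF f_anti, of r a] a r r1 by auto
        have "min 1 (\<nu> x) \<le> c2 * f a" using nu_f(2)[OF x0] by (simp add: a_def)
        then have "C2 * min 1 (\<nu> x) \<le> C2 * (c2 * f a)" using C_pos(2) by (intro mult_left_mono) auto
        then have "\<phi> x \<le> C2 * (c2 * f a)" using phi_nu(2)[of x] by linarith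
        then have "(\<phi> x)\<^sup>2 \<le> (C2 * c2)\<^sup>2 * (f a)\<^sup>2"
          using power_mono[of "\<phi> x" "C2 * (c2 * f a)" 2] by (simp add: power_mult_distrib ac_simps)
        also have "(f a)\<^sup>2 = f a powr (2 - \<delta>) * f a powr \<delta>"
          using fa by (simp add: powr_add[symmetric])
        also have "\<dots> \<le> f r powr (2 - \<delta>) * (\<nu> (s *\<^sub>R x) / c1)"
        proof (intro mult_mono)
          show "f a powr (2 - \<delta>) \<le> f r powr (2 - \<delta>)" using fa \<open>f a \<le> f r\<close> \<delta> by (intro powr_mono2) auto
          have "f a powr \<delta> \<le> f (s * a)" using r2 a by simp
          also have "\<dots> \<le> \<nu> (s *\<^sub>R x) / c1"
            using nu_f(1)[of "s *\<^sub>R x"] x0 s(1) c_pos(1) by (simp add: a_def pos_le_divide_eq mult.commute)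
          finally show "f a powr \<delta> \<le> \<nu> (s *\<^sub>R x) / c1" .
        qed auto
        finally have "(\<phi> x)\<^sup>2 \<le> (C2 * c2)\<^sup>2 * (f r powr (2 - \<delta>) * (\<nu> (s *\<^sub>R x) / c1))"
          by (auto simp: mult_left_mono)
        then show ?thesis using True a by (simp add: K_def a_def ac_simps)
      next
        case False
        then show ?thesis using c_pos nu_pos[of "s *\<^sub>R x"] by (simp add: K_def less_imp_le)
      qed
    qed
    also have "\<dots> = K * f r powr (2 - \<delta>) * I" by (simp add: I_def)
    finally show ?thesis by (simp add: ac_simps)
  qed
  moreover have "0 \<le> K * I"
  proof (rule mult_nonneg_nonneg)
    show "0 \<le> K" using c_pos by (simp add: K_def)
    show "0 \<le> I" unfolding I_def by (intro integral_nonneg_AE AE_I2) (simp add: less_imp_le[OF nu_pos])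
  qed
  ultimately show ?thesis
    by (intro that[of "K * I"]) (auto simp: eventually_at_top_linorder)
qed

lemma threshold_powr:
  assumes c: "0 < c"
  shows "c < 1 / (2 * A) powr (1 / \<alpha>) \<Longrightarrow> 2 * A * c powr \<alpha> < 1"
    and "1 / (2 * A) powr (1 / \<alpha>) < c \<Longrightarrow> 1 < 2 * A * c powr \<alpha>"
proof -
  have e: "(1 / (2 * A) powr (1 / \<alpha>)) powr \<alpha> = 1 / (2 * A)"
    using A \<alpha> by (simp add: powr_divide powr_powr)
  show "c < 1 / (2 * A) powr (1 / \<alpha>) \<Longrightarrow> 2 * A * c powr \<alpha> < 1"
    using powr_less_mono2[of \<alpha> c "1 / (2 * A) powr (1 / \<alpha>)"] c \<alpha> A unfolding e by (simp add: field_simps)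
  show "1 / (2 * A) powr (1 / \<alpha>) < c \<Longrightarrow> 1 < 2 * A * c powr \<alpha>"
    using powr_less_mono2[of \<alpha> "1 / (2 * A) powr (1 / \<alpha>)" c] c \<alpha> A unfolding e by (simp add: field_simps)
qed

lemma summable_tail_Rs:
  assumes c: "1 / (2 * A) powr (1 / \<alpha>) < c"
  shows "summable (\<lambda>n. tail (c * Rs (ln (real n))))"
proof -
  have c0: "0 < c" using c by (rule le_less_trans[rotated]) simp
  define E where "E = A * c powr \<alpha>"
  have E: "1 < 2 * E" using threshold_powr(2)[OF c0 c] by (simp add: E_def)
  \<comment> \<open>Chosen so that \<open>(2 - \<delta>) E = E + 1 / 2\<close>, which exceeds 1.\<close>
  define \<delta> where "\<delta> = 1 - 1 / (2 * E)"
  have "(2 - \<delta>) * E = E + 1 / 2" using E by (simp add: \<delta>_def field_simps)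
  then have \<delta>: "0 < \<delta>" "\<delta> < 2" "1 < (2 - \<delta>) * E" using E by (auto simp: \<delta>_def field_simps)
  obtain b where b: "1 < b" "b < (2 - \<delta>) * E" using dense[OF \<delta>(3)] by blast
  obtain K where K: "0 \<le> K" "\<forall>\<^sub>F r in at_top. tail r \<le> K * f r powr (2 - \<delta>)" using tail_upper[OF \<delta>(1,2)] .
  have "filterlim (\<lambda>n. c * Rs (ln (real n))) at_top sequentially"
    by (intro filterlim_compose[OF scale_at_top[OF c0]] filterlim_compose[OF Rs_at_top ln_real_at_top])
  then have "\<forall>\<^sub>F n in sequentially. tail (c * Rs (ln (real n))) \<le> K * f (c * Rs (ln (real n))) powr (2 - \<delta>)"
    using K(2) by (rule eventually_compose_filterlim[rotated])
  moreover have "\<forall>\<^sub>F n in sequentially. f (c * Rs (ln (real n))) powr (2 - \<delta>) \<le> real n powr (- b)"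
    using b \<delta> by (intro f_Rs_power c0) (auto simp: E_def mult.assoc)
  ultimately have "\<forall>\<^sub>F n in sequentially. norm (tail (c * Rs (ln (real n)))) \<le> K * real n powr (- b)"
  proof eventually_elim
    case (elim n)
    then show ?case using tail_nonneg[of "c * Rs (ln (real n))"] mult_left_mono[OF elim(2) K(1)] by simp
  qed
  moreover have "summable (\<lambda>n. K * real n powr (- b))"
    using b by (intro summable_mult) (simp add: summable_real_powr_iff)
  ultimately show ?thesis by (rule summable_comparison_test_ev)
qed

lemma not_summable_tail_Rs:
  assumes c0: "0 < c" and c: "c < 1 / (2 * A) powr (1 / \<alpha>)"
  shows "\<not> summable (\<lambda>n. tail (c * Rs (ln (real n))))"
proof -
  \<comment> \<open>A slightly larger constant absorbs the width 2 of the annulus in the lower bound for the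
    tail, since \<open>Rs\<close> tends to infinity.\<close>
  obtain c' where c': "c < c'" "c' < 1 / (2 * A) powr (1 / \<alpha>)" using dense[OF c] by blast
  have c'0: "0 < c'" using c0 c' by simp
  have lt: "2 * A * c' powr \<alpha> < 1" by (rule threshold_powr(1)[OF c'0 c'(2)])
  define v where "v = unit_ball_vol (real DIM('a))"
  have v: "0 < v" by (simp add: v_def)
  define k where "k = C1 * min 1 c1"
  have k: "0 < k" using C_pos c_pos by (simp add: k_def)
  show ?thesis
  proof (rule not_summable_tail)
    show "0 < k\<^sup>2 * v" using k v by simp
    show "1 \<le> (1::real)" by simp
    have "\<forall>\<^sub>F n in sequentially. real n powr (- 1) \<le> f (c' * Rs (ln (real n))) powr 2"
      using lt by (intro f_Rs_power c'0) auto
    moreover have "\<forall>\<^sub>F n in sequentially. f (c' * Rs (ln (real n))) powr 1 \<le> real n powr (- 0)"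
      using A c'0 by (intro f_Rs_power) auto
    moreover have "\<forall>\<^sub>F n in sequentially. max 1 (2 / (c' - c)) \<le> Rs (ln (real n))"
      using filterlim_compose[OF Rs_at_top ln_real_at_top] unfolding filterlim_at_top by (rule spec)
    ultimately show "\<forall>\<^sub>F n in sequentially. k\<^sup>2 * v * real n powr (- 1) \<le> tail (c * Rs (ln (real n)))"
      using eventually_ge_at_top[of 1]
    proof eventually_elim
      case (elim n)
      define \<rho> where "\<rho> = Rs (ln (real n))"
      have \<rho>: "1 \<le> \<rho>" "2 \<le> (c' - c) * \<rho>" using elim(3) c' by (auto simp: \<rho>_def pos_divide_le_eq mult.commute)
      have pos: "0 < c * \<rho>" "0 < c' * \<rho>" using \<rho> c0 c'0 by auto
      have f1: "f (c' * \<rho>) \<le> 1" "0 < f (c' * \<rho>)" using elim(2,4) f_pos[OF pos(2)] by (auto simp: \<rho>_def)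
      have "(k * f (c' * \<rho>))\<^sup>2 * v \<le> tail (c * \<rho>)"
        unfolding v_def
      proof (rule tail_lower)
        show "0 \<le> c * \<rho>" "0 \<le> k * f (c' * \<rho>)" using pos k f1 by auto
        fix x :: 'a assume x: "c * \<rho> < norm x" "norm x < c * \<rho> + 2"
        then have x0: "x \<noteq> 0" using pos by auto
        have "norm x \<le> c' * \<rho>" using x \<rho>(2) by (simp add: algebra_simps)
        then have "f (c' * \<rho>) \<le> f (norm x)"
          using monotone_onD[OF f_anti, of "norm x" "c' * \<rho>"] x0 pos by auto
        then have "c1 * f (c' * \<rho>) \<le> \<nu> x" using nu_f(1)[OF x0] c_pos(1) by (meson mult_left_mono less_imp_le order_trans)
        moreover have "min 1 c1 * f (c' * \<rho>) \<le> c1 * f (c' * \<rho>)" using f1 by (intro mult_right_mono) auto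
        moreover have "min 1 c1 * f (c' * \<rho>) \<le> 1" using f1 c_pos by (intro mult_le_one) auto
        ultimately have "C1 * (min 1 c1 * f (c' * \<rho>)) \<le> C1 * min 1 (\<nu> x)"
          using C_pos(1) by (intro mult_left_mono) auto
        then show "k * f (c' * \<rho>) \<le> \<phi> x" using phi_nu(1)[of x] by (simp add: k_def mult.assoc)
      qed
      moreover have "k\<^sup>2 * v * real n powr (- 1) \<le> k\<^sup>2 * v * (f (c' * \<rho>))\<^sup>2"
        using elim(1) k v f1 by (intro mult_left_mono) (auto simp: \<rho>_def)
      ultimately show ?case by (simp add: \<rho>_def power_mult_distrib ac_simps)
    qed
  qed
qed

theorem light_tail_limsup:
  "AE \<omega> in N. limsup (\<lambda>n. ereal (norm (Y (real n) \<omega>) / (ln (real n) powr (1 / \<alpha>) * conj_slow r0 \<alpha> \<L> (ln (real n))))) =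
      ereal (1 / (2 * A) powr (1 / \<alpha>))"
proof -
  have pos: "\<forall>\<^sub>F n in sequentially. 0 < Rs (ln (real n))"
    using filterlim_compose[OF Rs_at_top ln_real_at_top] unfolding filterlim_at_top_dense by (rule spec)
  have lo: "AE \<omega> in N. ereal (1 / (2 * A) powr (1 / \<alpha>)) \<le> limsup (\<lambda>n. ereal (norm (Y (real n) \<omega>) / Rs (ln (real n))))"
    by (rule limsup_lower_bound[OF _ pos infinitely_often_above[OF not_summable_tail_Rs]]) (use A in auto)
  have up: "AE \<omega> in N. limsup (\<lambda>n. ereal (norm (Y (real n) \<omega>) / Rs (ln (real n)))) \<le> ereal (1 / (2 * A) powr (1 / \<alpha>))"
    by (rule limsup_upper_bound[OF pos eventually_below[OF summable_tail_Rs]])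
  have eq: "limsup (\<lambda>n. ereal (norm (Y (real n) \<omega>) / (ln (real n) powr (1 / \<alpha>) * conj_slow r0 \<alpha> \<L> (ln (real n))))) =
      limsup (\<lambda>n. ereal (norm (Y (real n) \<omega>) / Rs (ln (real n))))" for \<omega>
  proof (rule Limsup_eq)
    show "\<forall>\<^sub>F n in sequentially. ereal (norm (Y (real n) \<omega>) / (ln (real n) powr (1 / \<alpha>) * conj_slow r0 \<alpha> \<L> (ln (real n)))) =
       ereal (norm (Y (real n) \<omega>) / Rs (ln (real n)))"
      using eventually_ge_at_top[of 2] by eventually_elim (simp add: conj_slow_scale)
  qed
  show ?thesis using lo up unfolding eq by eventually_elim (rule antisym)
qed

end

section \<open>The limit laws\<close>

text \<open>The characteristic function of \<open>X t\<close> is real, hence equal to its conjugate, which is the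
  characteristic function of \<open>- X t\<close>.\<close>

lemma symmetric_levy_process_sym_levy:
  fixes X :: "real \<Rightarrow> 'w \<Rightarrow> real^'n"
  assumes "symmetric_levy_process M X A0 \<nu>"
  shows "sym_levy M X"
proof -
  have lp: "levy_process M X" and
    ch: "\<And>t \<xi>. 0 \<le> t \<Longrightarrow> (\<integral>\<omega>. exp (\<i> * complex_of_real (\<xi> \<bullet> X t \<omega>)) \<partial>M) = complex_of_real (exp (- t * levy_exponent A0 \<nu> \<xi>))"
    using assms by (auto simp: symmetric_levy_process_def)
  interpret prob_space M using lp by (simp add: levy_process_def)
  show ?thesis
  proof
    fix t :: real assume t: "0 \<le> t"
    show m [measurable]: "X t \<in> borel_measurable M" using lp t by (simp add: levy_process_def)
    show "distr M borel (\<lambda>\<omega>. - X t \<omega>) = distr M borel (X t)"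
    proof (rule characteristic_function_unique)
      fix \<xi> :: "real^'n"
      have "(\<integral>x. exp (\<i> * complex_of_real (\<xi> \<bullet> x)) \<partial>distr M borel (\<lambda>\<omega>. - X t \<omega>)) = (\<integral>\<omega>. exp (\<i> * complex_of_real ((- \<xi>) \<bullet> X t \<omega>)) \<partial>M)"
        by (subst integral_distr) auto
      also have "\<dots> = (\<integral>\<omega>. cnj (exp (\<i> * complex_of_real (\<xi> \<bullet> X t \<omega>))) \<partial>M)"
        by (simp add: exp_cnj)
      also have "\<dots> = cnj (\<integral>\<omega>. exp (\<i> * complex_of_real (\<xi> \<bullet> X t \<omega>)) \<partial>M)"
        by (rule Bochner_Integration.integral_cnj)
      also have "\<dots> = (\<integral>\<omega>. exp (\<i> * complex_of_real (\<xi> \<bullet> X t \<omega>)) \<partial>M)"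
        by (simp only: ch[OF t] complex_cnj_complex_of_real)
      also have "\<dots> = (\<integral>x. exp (\<i> * complex_of_real (\<xi> \<bullet> x)) \<partial>distr M borel (X t))"
        by (subst integral_distr) auto
      finally show "(\<integral>x. exp (\<i> * complex_of_real (\<xi> \<bullet> x)) \<partial>distr M borel (\<lambda>\<omega>. - X t \<omega>)) = (\<integral>x. exp (\<i> * complex_of_real (\<xi> \<bullet> x)) \<partial>distr M borel (X t))" .
    qed (auto intro!: prob_space_distr)
  qed (use lp in \<open>auto simp: levy_process_def\<close>)
qed

theorem corollary4p3:
  fixes M :: "'w measure" and X :: "real \<Rightarrow> 'w \<Rightarrow> real^'n"
    and A0 :: "real^'n^'n" and \<nu> :: "real^'n \<Rightarrow> real"
    and p :: "real \<Rightarrow> real^'n \<Rightarrow> real" and f :: "real \<Rightarrow> real"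
    and V :: "real^'n \<Rightarrow> real" and lam0 :: real and \<phi>0 :: "real^'n \<Rightarrow> real"
    and N :: "'v measure" and Y :: "real \<Rightarrow> 'v \<Rightarrow> real^'n"
  assumes levy: "symmetric_levy_process M X A0 \<nu>"
    and dens: "transition_density M X p"
    and paring: "jump_paring M X p \<nu> f"
    and kato: "kato_potential M X V"
    and decay: "decaying V"
    and lam0: "lam0 = Inf (spectrum (schroedinger_op M X V))"
    and neg: "lam0 < 0"
    and isol: "isolated_eigenvalue (schroedinger_op M X V) lam0"
    and ground: "ground_state (schroedinger_op M X V) lam0 \<phi>0"
    and gst: "gst_process N Y (gst_semigroup M X V lam0 \<phi>0) \<phi>0"
  shows
    "(\<forall>C1 C2 A \<alpha> r0 \<L>.
        0 < C1 \<and> 0 < C2 \<and>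
        (\<forall>x. C1 * min 1 (\<nu> x) \<le> \<phi>0 x \<and> \<phi>0 x \<le> C2 * min 1 (\<nu> x)) \<and>
        0 < A \<and> 0 < \<alpha> \<and> \<alpha> \<le> 1 \<and> 0 \<le> r0 \<and>
        slowly_varying r0 \<L> \<and>
        mono_on {r0..} (regular_part \<alpha> \<L>) \<and>
        (\<lambda>r. ln (f r) - (- A * regular_part \<alpha> \<L> r)) \<in> o[at_top](regular_part \<alpha> \<L>)
        \<longrightarrow>
        (AE \<omega> in N.
           limsup (\<lambda>n. ereal (norm (Y (real n) \<omega>) /
             (ln (real n) powr (1 / \<alpha>) * conj_slow r0 \<alpha> \<L> (ln (real n))))) =
           ereal (1 / (2 * A) powr (1 / \<alpha>))))
     \<and>
     (\<forall>\<theta>>0.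
        (\<forall>\<epsilon>. 0 < \<epsilon> \<and> \<epsilon> < 1 \<longrightarrow>
           (\<exists>C>0. \<forall>x. C * max (exp (- \<theta> * sqrt (\<bar>lam0\<bar> + \<epsilon>) * norm x)) (min 1 (\<nu> x)) \<le> \<phi>0 x))
        \<longrightarrow>
        (AE \<omega> in N.
           ereal (1 / (2 * \<theta> * sqrt \<bar>lam0\<bar>)) \<le>
           limsup (\<lambda>n. ereal (norm (Y (real n) \<omega>) / ln (real n)))))"
proof -
  interpret sym_levy M X by (rule symmetric_levy_process_sym_levy[OF levy])
  interpret gst_setting M X V lam0 \<phi>0 N Y
  proof
    show "V \<in> borel_measurable borel" using kato by (simp add: kato_potential_def)
    show "L2_fun \<phi>0" "0 < \<phi>0 x" "L2_norm \<phi>0 = 1" for x using ground by (auto simp: ground_state_def schroedinger_op_def)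
    show "gst_process N Y (gst_semigroup M X V lam0 \<phi>0) \<phi>0" by (rule gst)
  qed
  obtain \<epsilon> where eps: "0 < \<epsilon>" and sp: "spectrum (schroedinger_op M X V) \<inter> {lam0 - \<epsilon><..<lam0 + \<epsilon>} = {lam0}"
    using isol by (auto simp: isolated_eigenvalue_def)
  have res: "\<mu> \<in> resolvent_set (schroedinger_op M X V)" if "0 < \<bar>\<mu> - lam0\<bar>" "\<bar>\<mu> - lam0\<bar> < \<epsilon>" for \<mu>
  proof (rule ccontr)
    assume "\<mu> \<notin> resolvent_set (schroedinger_op M X V)"
    then have "\<mu> \<in> spectrum (schroedinger_op M X V) \<inter> {lam0 - \<epsilon><..<lam0 + \<epsilon>}"
      using that by (auto simp: spectrum_def abs_less_iff)
    then show False using that sp by auto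
  qed
  obtain tb where tb: "0 < tb" "\<And>x. 0 < p tb x" using paring by (auto simp: jump_paring_def)
  have dtb: "distributed M lborel (X tb) (\<lambda>x. ennreal (p tb x))"
    using dens tb(1) by (simp add: transition_density_def)
  interpret gapped_gst M X V lam0 \<phi>0 N Y \<epsilon> tb "p tb"
    by unfold_locales (use eps res tb dtb in blast)+
  have levy_nu: "\<nu> \<in> borel_measurable borel" "\<And>x. 0 < \<nu> x" "(\<integral>\<^sup>+z. ennreal (min 1 ((norm z)\<^sup>2)) \<partial>jump_measure \<nu>) < \<infinity>"
    using levy by (auto simp: symmetric_levy_process_def symmetric_levy_density_def)
  obtain c1 c2 where c: "0 < c1" "0 < c2" "\<And>x. x \<noteq> 0 \<Longrightarrow> c1 * f (norm x) \<le> \<nu> x" "\<And>x. x \<noteq> 0 \<Longrightarrow> \<nu> x \<le> c2 * f (norm x)"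
  proof -
    have "\<exists>c1>0. \<exists>c2>0. \<forall>x. x \<noteq> 0 \<longrightarrow> c1 * f (norm x) \<le> \<nu> x \<and> \<nu> x \<le> c2 * f (norm x)"
      using paring unfolding jump_paring_def by (elim conjE)
    then show ?thesis using that by auto
  qed
  have "\<forall>r>0. 0 < f r" using paring unfolding jump_paring_def by (rule conjunct1)
  moreover have "antimono_on {0<..} f" using paring unfolding jump_paring_def by (rule conjunct1[OF conjunct2])
  ultimately have f: "\<And>r. 0 < r \<Longrightarrow> 0 < f r" "antimono_on {0<..} f" by auto
  show ?thesis
  proof (intro conjI allI impI)
    fix C1 C2 A \<alpha> r0 :: real and \<L> :: "real \<Rightarrow> real"
    assume H: "0 < C1 \<and> 0 < C2 \<and>
        (\<forall>x. C1 * min 1 (\<nu> x) \<le> \<phi>0 x \<and> \<phi>0 x \<le> C2 * min 1 (\<nu> x)) \<and>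
        0 < A \<and> 0 < \<alpha> \<and> \<alpha> \<le> 1 \<and> 0 \<le> r0 \<and>
        slowly_varying r0 \<L> \<and>
        mono_on {r0..} (regular_part \<alpha> \<L>) \<and>
        (\<lambda>r. ln (f r) - (- A * regular_part \<alpha> \<L> r)) \<in> o[at_top](regular_part \<alpha> \<L>)"
    interpret light_tails M X V lam0 \<phi>0 N Y \<epsilon> tb "p tb" r0 \<alpha> \<L> \<nu> f c1 c2 C1 C2 A
      by unfold_locales (use H levy_nu c f in blast)+
    show "AE \<omega> in N. limsup (\<lambda>n. ereal (norm (Y (real n) \<omega>) /
             (ln (real n) powr (1 / \<alpha>) * conj_slow r0 \<alpha> \<L> (ln (real n))))) =
           ereal (1 / (2 * A) powr (1 / \<alpha>))"
      by (rule light_tail_limsup)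
  next
    fix \<theta> :: real
    assume \<theta>: "0 < \<theta>" and H: "\<forall>\<epsilon>. 0 < \<epsilon> \<and> \<epsilon> < 1 \<longrightarrow>
           (\<exists>C>0. \<forall>x. C * max (exp (- \<theta> * sqrt (\<bar>lam0\<bar> + \<epsilon>) * norm x)) (min 1 (\<nu> x)) \<le> \<phi>0 x)"
    show "AE \<omega> in N. ereal (1 / (2 * \<theta> * sqrt \<bar>lam0\<bar>)) \<le> limsup (\<lambda>n. ereal (norm (Y (real n) \<omega>) / ln (real n)))"
    proof (rule exponential_lower_limsup[OF \<theta>])
      show "lam0 \<noteq> 0" using neg by simp
      fix \<delta> :: real assume "0 < \<delta>" "\<delta> < 1"
      then obtain C where C: "0 < C" "\<And>x. C * max (exp (- \<theta> * sqrt (\<bar>lam0\<bar> + \<delta>) * norm x)) (min 1 (\<nu> x)) \<le> \<phi>0 x"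
        using H by blast
      have "C * exp (- \<theta> * sqrt (\<bar>lam0\<bar> + \<delta>) * norm x) \<le> \<phi>0 x" for x
        by (rule order_trans[OF mult_left_mono[OF max.cobounded1] C(2)]) (use C(1) in simp)
      then show "\<exists>C>0. \<forall>x. C * exp (- \<theta> * sqrt (\<bar>lam0\<bar> + \<delta>) * norm x) \<le> \<phi>0 x" using C(1) by blast
    qed
  qed
qed

end
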